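(* The facet $(\sigma W_{A_1}\times W_{A_2}\times\cdots\times W_{A_k},\{V,\underline{A_1},\underline{A_2},\ldots,\underline{A_k}\})$ of $P_{\mathcal{G}}(\Phi)$ is combinatorially equivalent to the product (of combinatorial polytopes) \[P_{\overline{\mathcal{G}}}\times P_{\mathcal{G}^{A_1}}(\Phi\cap A_1)\times\cdots\times P_{\mathcal{G}^{A_k}}(\Phi\cap A_k).\]
   Context: Let $V$ be a Euclidean space of dimension $n$, $\Phi\subset V$ a root system spanning $V$ with finite Coxeter group $W$ and simple roots $\Delta$. Let $\mathcal{G}$ be a $W$-invariant building set associated to $\Phi$ with $V\in\mathcal{G}$, and let $\mathcal{G}_{fund}$ be the set of subspaces in $\mathcal{G}$ spanned by some subset of $\Delta$. For a subspace $A$ spanned by simple roots, $W_A$ is the parabolic subgroup generated by the reflections $s_\alpha$, $\alpha\in\Phi\cap A$. $P_{\mathcal{G}}(\Phi)$ is the permutonestohedron (built from a suitable list $\epsilon_1<\dots<\epsilon_n$). Its faces are in bijection with pairs $(\sigma H,\mathcal{S})$, where $\mathcal{S}$ is a nested set of $\mathcal{G}_{fund}$ containing $V$ whose minimal elements carry labels (either $W_A$, written $\underline{A}$, or the trivial group), $H$ is the direct product of the labels, and $\sigma H$ is a coset in $W$; the face $(\sigma H,\mathcal{S})$ is $\sigma$ applied to the convex hull of the images under $H$ of the face of the nestohedron in the fundamental chamber associated with $\mathcal{S}$. Consider the facet $(\sigma W_{A_1}\times\cdots\times W_{A_k},\{V,\underline{A_1},\ldots,\underline{A_k}\})$, where $A_1,\ldots,A_k$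 are proper subspaces in $\mathcal{G}_{fund}$, all minimal in this nested set and all with nontrivial label (i.e. a facet of $P_{\mathcal{G}}(\Phi)$ not lying inside a chamber). Let $\mathcal{G}^{A_i}$ be the subset of $\mathcal{G}$ of subspaces contained in $A_i$; it is a building set for the root system $\Phi\cap A_i$, and $P_{\mathcal{G}^{A_i}}(\Phi\cap A_i)$ is the corresponding permutonestohedron. Let $D=A_1\oplus\cdots\oplus A_k$ and let $\overline{\mathcal{G}}=\{(C+D)/D : C\in\mathcal{G}_{fund}\}$, a building set in $V/D$; $P_{\overline{\mathcal{G}}}$ is the nestohedron associated with $\overline{\mathcal{G}}$ (a polytope whose face poset, ordered by reverse inclusion, is isomorphic to its nested set complex). *)

theory Defs
  imports "HOL-Analysis.Analysis" "HOL-Library.Set_Algebras"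
begin

text \<open>
  Sums of subspaces are the pointwise sums of \<^theory>\<open>HOL-Library.Set_Algebras\<close>, so
  \<open>\<Sum>T\<close> is the sum of a finite family \<open>T\<close> of subspaces.  The Euclidean space
  attached to a root system \<open>\<Phi>\<close> is \<open>span \<Phi>\<close>; this lets the same definitions apply to \<open>\<Phi>\<close> and
  to the subsystems \<open>\<Phi> \<inter> A\<close>.
\<close>

section \<open>Root systems and reflection groups\<close>

definition reflect :: "'a::euclidean_space \<Rightarrow> 'a \<Rightarrow> 'a" where
  "reflect \<alpha> x = x - (2 * (x \<bullet> \<alpha>) / (\<alpha> \<bullet> \<alpha>)) *\<^sub>R \<alpha>"

text \<open>
  Reduced root systems; integrality of the Cartan numbers is not required, so all finite Coxeter
  groups occur.
\<close>

definition root_system :: "'a::euclidean_space set \<Rightarrow> bool" where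
  "root_system \<Phi> \<longleftrightarrow> finite \<Phi> \<and> 0 \<notin> \<Phi> \<and>
     (\<forall>\<alpha>\<in>\<Phi>. \<Phi> \<inter> span {\<alpha>} = {\<alpha>, - \<alpha>}) \<and>
     (\<forall>\<alpha>\<in>\<Phi>. reflect \<alpha> ` \<Phi> = \<Phi>)"

definition nonneg_comb :: "'a::euclidean_space set \<Rightarrow> 'a \<Rightarrow> bool" where
  "nonneg_comb \<Delta> \<beta> \<longleftrightarrow> (\<exists>c. (\<forall>\<alpha>\<in>\<Delta>. 0 \<le> c \<alpha>) \<and> \<beta> = (\<Sum>\<alpha>\<in>\<Delta>. c \<alpha> *\<^sub>R \<alpha>))"

definition simple_roots :: "'a::euclidean_space set \<Rightarrow> 'a set \<Rightarrow> bool" where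
  "simple_roots \<Phi> \<Delta> \<longleftrightarrow> \<Delta> \<subseteq> \<Phi> \<and> independent \<Delta> \<and>
     (\<forall>\<beta>\<in>\<Phi>. nonneg_comb \<Delta> \<beta> \<or> nonneg_comb \<Delta> (- \<beta>))"

definition positive_roots :: "'a::euclidean_space set \<Rightarrow> 'a set \<Rightarrow> 'a set" where
  "positive_roots \<Phi> \<Delta> = {\<beta>\<in>\<Phi>. nonneg_comb \<Delta> \<beta>}"

text \<open>Reflections are involutions, so closing under composition already yields a group.\<close>

inductive_set reflection_group :: "'a::euclidean_space set \<Rightarrow> ('a \<Rightarrow> 'a) set"
  for \<Phi> :: "'a set" where
  id: "id \<in> reflection_group \<Phi>"
| reflect: "w \<in> reflection_group \<Phi> \<Longrightarrow> \<alpha> \<in> \<Phi> \<Longrightarrow> reflect \<alpha> \<circ> w \<in> reflection_group \<Phi>"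

text \<open>
  The internal direct product: all composites \<open>g i\<^sub>1 \<circ> \<dots> \<circ> g i\<^sub>k\<close> with exactly one factor from each
  \<open>H i\<close>.  Elements of different factors commute in the intended use, so allowing every
  order of the factors adds nothing.
\<close>

definition internal_product :: "('k::finite \<Rightarrow> ('a \<Rightarrow> 'a) set) \<Rightarrow> ('a \<Rightarrow> 'a) set" where
  "internal_product H =
     {foldr (\<lambda>i w. g i \<circ> w) xs id | g xs. (\<forall>i. g i \<in> H i) \<and> distinct xs \<and> set xs = UNIV}"

section \<open>Building sets and nested sets\<close>

definition sum_closure :: "'b::comm_monoid_add set set \<Rightarrow> 'b set set" where
  "sum_closure G = {\<Sum>T | T. T \<subseteq> G \<and> finite T \<and> T \<noteq> {}}"

definition direct_sum_of :: "'b::comm_monoid_add set set \<Rightarrow> 'b set \<Rightarrow> bool" where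
  "direct_sum_of T C \<longleftrightarrow> finite T \<and> C = \<Sum>T \<and>
     (\<forall>f. (\<forall>A\<in>T. f A \<in> A) \<and> (\<Sum>A\<in>T. f A) = 0 \<longrightarrow> (\<forall>A\<in>T. f A = 0))"

definition maximal_in :: "'b set set \<Rightarrow> 'b set \<Rightarrow> 'b set set" where
  "maximal_in G C = {A\<in>G. A \<subseteq> C \<and> \<not> (\<exists>B\<in>G. B \<subseteq> C \<and> A \<subset> B)}"

definition building_set :: "'a::euclidean_space set set \<Rightarrow> bool" where
  "building_set G \<longleftrightarrow> finite G \<and> (\<forall>A\<in>G. subspace A \<and> A \<noteq> {0}) \<and>
     (\<forall>C\<in>sum_closure G. direct_sum_of (maximal_in G C) C)"

text \<open>
  A building set associated to \<open>\<Phi>\<close> consists of subspaces spanned by roots and contains the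
  lines spanned by the roots, i.e. it generates under sum all nonzero subspaces spanned by roots.
\<close>

definition building_set_of :: "'a::euclidean_space set \<Rightarrow> 'a set set \<Rightarrow> bool" where
  "building_set_of \<Phi> G \<longleftrightarrow> building_set G \<and>
     (\<forall>A\<in>G. \<exists>S\<subseteq>\<Phi>. A = span S) \<and> (\<forall>\<alpha>\<in>\<Phi>. span {\<alpha>} \<in> G)"

definition invariant_under :: "('a \<Rightarrow> 'a) set \<Rightarrow> 'a set set \<Rightarrow> bool" where
  "invariant_under W G \<longleftrightarrow> (\<forall>w\<in>W. \<forall>A\<in>G. w ` A \<in> G)"

definition fundamental :: "'a::euclidean_space set \<Rightarrow> 'a set set \<Rightarrow> 'a set set" where
  "fundamental \<Delta> G = {A\<in>G. \<exists>S\<subseteq>\<Delta>. A = span S}"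

definition nested :: "'b::comm_monoid_add set set \<Rightarrow> 'b set set \<Rightarrow> bool" where
  "nested G S \<longleftrightarrow> S \<subseteq> G \<and>
     (\<forall>T\<subseteq>S. finite T \<and> 2 \<le> card T \<and> (\<forall>A\<in>T. \<forall>B\<in>T. A \<noteq> B \<longrightarrow> \<not> A \<subseteq> B) \<longrightarrow> \<Sum>T \<notin> G)"

definition restricted :: "'a set set \<Rightarrow> 'a set \<Rightarrow> 'a set set" where
  "restricted G A = {C\<in>G. C \<subseteq> A}"

text \<open>
  The subspace \<open>U/D\<close> of \<open>V/D\<close>, as a set of cosets.  Addition of cosets is again
  pointwise addition of sets, so \<^const>\<open>nested\<close> applies verbatim to families of such subspaces;
  the zero subspace of \<open>V/D\<close> is \<open>D/D = {D}\<close>.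
\<close>

definition quotient_space :: "'a::euclidean_space set \<Rightarrow> 'a set \<Rightarrow> 'a set set" where
  "quotient_space U D = {x +o D | x. x \<in> U}"

text \<open>As elements of a building set are nonzero, the zero subspace \<open>D/D\<close> is discarded.\<close>

definition quotient_building :: "'a::euclidean_space set set \<Rightarrow> 'a set \<Rightarrow> 'a set set set" where
  "quotient_building G D = {quotient_space (C + D) D | C. C \<in> G} - {quotient_space D D}"

section \<open>Nestohedra and permutonestohedra\<close>

definition half_sum :: "'a::euclidean_space set \<Rightarrow> 'a set \<Rightarrow> 'a set \<Rightarrow> 'a" where
  "half_sum \<Phi> \<Delta> A = (1/2) *\<^sub>R \<Sum>(positive_roots \<Phi> \<Delta> \<inter> A)"

text \<open>
  For fundamental \<open>B \<subseteq> A\<close>, the largest ratio between the coefficients of \<open>\<pi>\<^sub>A\<close> and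
  \<open>\<pi>\<^sub>B\<close> on the simple roots in \<open>B\<close>, where \<open>\<pi>\<^sub>A\<close> is the half sum of the positive
  roots in \<open>A\<close>.  Thus \<open>x \<bullet> \<pi>\<^sub>A \<le> (\<Sum>B\<in>T. R\<^sub>A\<^sub>B * (x \<bullet> \<pi>\<^sub>B))\<close> for \<open>x\<close> in the closed fundamental
  chamber and \<open>A = \<Sum>T\<close>.
\<close>

definition coeff_ratio :: "'a::euclidean_space set \<Rightarrow> 'a set \<Rightarrow> 'a set \<Rightarrow> 'a set \<Rightarrow> real" where
  "coeff_ratio \<Phi> \<Delta> A B =
     Max ((\<lambda>\<alpha>. representation \<Delta> (half_sum \<Phi> \<Delta> A) \<alpha> / representation \<Delta> (half_sum \<Phi> \<Delta> B) \<alpha>)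
          ` (\<Delta> \<inter> B))"

text \<open>
  A list \<open>\<epsilon> 1 < \<dots> < \<epsilon> n\<close> of positive reals is suitable if, whenever a fundamental \<open>A\<close>
  is an irredundant sum of at least two fundamental subspaces \<open>B \<in> T\<close>, the number \<open>\<epsilon> (dim A)\<close>
  exceeds the bound for \<open>x \<bullet> \<pi>\<^sub>A\<close> that results from the equations \<open>x \<bullet> \<pi>\<^sub>B = \<epsilon> (dim B)\<close>.
\<close>

definition suitable ::
    "'a::euclidean_space set \<Rightarrow> 'a set \<Rightarrow> 'a set set \<Rightarrow> (nat \<Rightarrow> real) \<Rightarrow> bool" where
  "suitable \<Phi> \<Delta> G \<epsilon> \<longleftrightarrow>
     (\<forall>i\<in>{1..dim \<Phi>}. 0 < \<epsilon> i) \<and> strict_mono_on {1..dim \<Phi>} \<epsilon> \<and>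
     (\<forall>A\<in>fundamental \<Delta> G. \<forall>T\<subseteq>fundamental \<Delta> G.
        2 \<le> card T \<and> \<Sum>T = A \<and> (\<forall>B\<in>T. \<Sum>(T - {B}) \<noteq> A) \<longrightarrow>
        (\<Sum>B\<in>T. coeff_ratio \<Phi> \<Delta> A B * \<epsilon> (dim B)) < \<epsilon> (dim A))"

text \<open>
  The nestohedron in the fundamental chamber.  Since the line spanned by a simple root \<open>\<alpha>\<close>
  belongs to \<open>G\<close> and \<open>\<pi> = \<alpha>/2\<close> for it, the inequalities force \<open>x \<bullet> \<alpha> > 0\<close>.
\<close>

definition chamber_nestohedron ::
    "'a::euclidean_space set \<Rightarrow> 'a set \<Rightarrow> 'a set set \<Rightarrow> (nat \<Rightarrow> real) \<Rightarrow> 'a set" where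
  "chamber_nestohedron \<Phi> \<Delta> G \<epsilon> =
     {x \<in> span \<Phi>. x \<bullet> half_sum \<Phi> \<Delta> (span \<Phi>) = \<epsilon> (dim \<Phi>) \<and>
        (\<forall>A\<in>fundamental \<Delta> G. \<epsilon> (dim A) \<le> x \<bullet> half_sum \<Phi> \<Delta> A)}"

definition chamber_face ::
    "'a::euclidean_space set \<Rightarrow> 'a set \<Rightarrow> 'a set set \<Rightarrow> (nat \<Rightarrow> real) \<Rightarrow> 'a set set \<Rightarrow> 'a set" where
  "chamber_face \<Phi> \<Delta> G \<epsilon> S =
     {x \<in> chamber_nestohedron \<Phi> \<Delta> G \<epsilon>. \<forall>A\<in>S. x \<bullet> half_sum \<Phi> \<Delta> A = \<epsilon> (dim A)}"

definition permutonestohedron ::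
    "'a::euclidean_space set \<Rightarrow> 'a set \<Rightarrow> 'a set set \<Rightarrow> (nat \<Rightarrow> real) \<Rightarrow> 'a set" where
  "permutonestohedron \<Phi> \<Delta> G \<epsilon> =
     convex hull (\<Union>w\<in>reflection_group \<Phi>. w ` chamber_nestohedron \<Phi> \<Delta> G \<epsilon>)"

text \<open>The face \<open>(\<sigma> H, S)\<close> of the permutonestohedron.\<close>

definition permutonestohedron_face ::
    "'a::euclidean_space set \<Rightarrow> 'a set \<Rightarrow> 'a set set \<Rightarrow> (nat \<Rightarrow> real) \<Rightarrow>
     ('a \<Rightarrow> 'a) \<Rightarrow> ('a \<Rightarrow> 'a) set \<Rightarrow> 'a set set \<Rightarrow> 'a set" where
  "permutonestohedron_face \<Phi> \<Delta> G \<epsilon> \<sigma> H S =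
     \<sigma> ` (convex hull (\<Union>h\<in>H. h ` chamber_face \<Phi> \<Delta> G \<epsilon> S))"

section \<open>Combinatorial types\<close>

definition combinatorially_equivalent ::
    "'a::euclidean_space set \<Rightarrow> 'b::euclidean_space set \<Rightarrow> bool" where
  "combinatorially_equivalent P Q \<longleftrightarrow>
     (\<exists>f. bij_betw f {F. F face_of P} {F. F face_of Q} \<and>
        (\<forall>F F'. F face_of P \<and> F' face_of P \<longrightarrow> (F \<subseteq> F' \<longleftrightarrow> f F \<subseteq> f F')))"

text \<open>
  \<open>Q\<close> is a realization of the nestohedron of a building set \<open>G\<close> with largest element \<open>V\<close>: its
  nonempty faces, ordered by reverse inclusion, form the poset of nested sets of \<open>G\<close>
  containing \<open>V\<close> (\<open>Q\<close> itself corresponds to \<open>{V}\<close>).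
\<close>

definition nestohedron ::
    "'b::comm_monoid_add set set \<Rightarrow> 'b set \<Rightarrow> 'q::euclidean_space set \<Rightarrow> bool" where
  "nestohedron G V Q \<longleftrightarrow> polytope Q \<and>
     (\<exists>f. bij_betw f {F. F face_of Q \<and> F \<noteq> {}} {S. nested G S \<and> V \<in> S} \<and>
        (\<forall>F F'. F face_of Q \<and> F \<noteq> {} \<and> F' face_of Q \<and> F' \<noteq> {} \<longrightarrow>
           (F' \<subseteq> F \<longleftrightarrow> f F \<subseteq> f F')))"

end

theory Submission
  imports Defs
begin

text \<open>
  On the facet, decompose a vector as \<open>z + (\<Sum>i. x\<^sub>i)\<close> with \<open>x\<^sub>i \<in> A\<^sub>i\<close> and \<open>z\<close> orthogonal to all
  \<open>A\<^sub>i\<close>. The inequality of a member of the building set that is not nested with the \<open>A\<^sub>i\<close> follows from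
  the others because the list is suitable, and for a member \<open>C\<close> that contains \<open>A\<^sub>i\<close>, the half sums of
  \<open>C\<close> and \<open>A\<^sub>i\<close> agree on \<open>A\<^sub>i\<close>. Hence the face of the chamber nestohedron is the product of a polytope in
  the variable \<open>z\<close> and of the chamber nestohedra of the \<open>A\<^sub>i\<close>. The group \<open>H\<close> acts on the latter factors
  separately, so the facet is the product of the former polytope and of the permutonestohedra of the
  \<open>A\<^sub>i\<close> for the list \<open>\<epsilon>\<close>. The sets of inequalities tight at a point of the polytope in \<open>z\<close> are the
  nested sets of the quotient building set, which determines its face poset.

  It remains to replace \<open>\<epsilon>\<close> by other suitable lists. The permutonestohedron is cut out by the
  inequalities \<open>x \<bullet> w (\<pi>\<^sub>V - \<pi>\<^sub>Z) \<le> \<epsilon>\<^sub>V - (\<Sum>A. \<epsilon>\<^sub>A)\<close>, where \<open>w\<close> is in the group, \<open>Z\<close> is a set of simple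
  roots and \<open>A\<close> runs over the components of its span: a linear functional may be assumed dominant, and
  it is then a nonnegative combination of vectors \<open>\<pi>\<^sub>V - \<pi>\<^sub>Z\<close> over a chain of sets \<open>Z\<close>, whose components
  form a nested set. The incidences of these hyperplanes with the vertices, and hence the face poset,
  do not depend on the list.
\<close>

section \<open>Combinatorial building sets\<close>

text \<open>Since the simple roots are independent, the numbers \<open>x \<bullet> \<alpha>\<close>
  are free coordinates, and the fundamental chamber becomes a problem about subsets of \<Delta>: the
  half sum of a fundamental subspace is a positive combination of its simple roots. Suitability
  bounds such combinations along covers, which is why nestedness is handled through covers rather
  than antichains. Levels may depend on the member itself and not only on its dimension: to find a
  point whose tight set is a given nested set, that set is extended to a maximal one and the levels
  of all members outside the given set are raised, and a list indexed by dimensions cannot be raised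
  selectively. The realization \<open>Q\<close> and the lists \<open>\<eta> i\<close> are arbitrary,
  so the factors cannot be matched by linear maps. They are compared through families of tight index
  sets, computed from systems of inequalities that may be redundant, so no facet has to be
  identified.\<close>

lemma finite_minimal_subfamily:
  assumes "finite T" and "P T"
  obtains T' where "T' \<subseteq> T" and "P T'" and "\<And>T''. T'' \<subset> T' \<Longrightarrow> \<not> P T''"
proof -
  have "finite {X. X \<subseteq> T \<and> P X}" using assms(1) by simp
  moreover have "{X. X \<subseteq> T \<and> P X} \<noteq> {}" using assms(2) by auto
  ultimately obtain M where M: "M \<in> {X. X \<subseteq> T \<and> P X}" "\<forall>b\<in>{X. X \<subseteq> T \<and> P X}. b \<le> M \<longrightarrow> M = b"
    using finite_has_minimal by (metis (no_types, lifting))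
  show thesis
  proof (rule that[of M])
    show "\<not> P T''" if "T'' \<subset> M" for T''
      using that M by blast
  qed (use M in auto)
qed

text \<open>A set-theoretic building set on the ground set \<Delta>; it is instantiated below with
  the sets of simple roots whose span belongs to \<open>G\<close>. Overlapping members have their
  union in the family, while disjoint ones may behave like direct summands.\<close>

locale building =
  fixes \<Delta> :: "'a set" and bs :: "'a set set"
  assumes fin: "finite \<Delta>"
    and sub: "B \<in> bs \<Longrightarrow> B \<subseteq> \<Delta>"
    and nonempty: "{} \<notin> bs"
    and singleton: "\<alpha> \<in> \<Delta> \<Longrightarrow> {\<alpha>} \<in> bs"
    and top: "\<Delta> \<in> bs"
    and union: "B \<in> bs \<Longrightarrow> C \<in> bs \<Longrightarrow> B \<inter> C \<noteq> {} \<Longrightarrow> B \<union> C \<in> bs"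
begin

lemma finite_bs: "finite bs"
  using fin sub by (auto intro: finite_subset[of bs "Pow \<Delta>"])

lemma finite_subfamily: "T \<subseteq> bs \<Longrightarrow> finite T"
  using finite_bs finite_subset by auto

lemma finite_mem: "B \<in> bs \<Longrightarrow> finite B"
  by (rule finite_subset[OF sub fin])

lemma mem_nonempty: "B \<in> bs \<Longrightarrow> B \<noteq> {}"
  using nonempty by blast

lemma Union_mem:
  assumes "finite T" "T \<subseteq> bs" "C \<in> bs" "\<And>B. B \<in> T \<Longrightarrow> B \<inter> C \<noteq> {}"
  shows "C \<union> \<Union>T \<in> bs"
  using assms
proof (induction T)
  case (insert B T)
  have "C \<union> \<Union>T \<in> bs" using insert by auto
  moreover have "B \<inter> (C \<union> \<Union>T) \<noteq> {}" using insert.prems(3)[of B] by blast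
  ultimately have "B \<union> (C \<union> \<Union>T) \<in> bs" using insert.prems union by blast
  then show ?case by (simp add: Un_left_commute)
qed simp

text \<open>For \<alpha> in \<open>U\<close> this union is itself a member, hence the largest one
  inside \<open>U\<close> through \<alpha>. The components of \<open>U\<close> encode the
  decomposition of its span.\<close>

definition component :: "'a set \<Rightarrow> 'a \<Rightarrow> 'a set" where
  "component U \<alpha> = \<Union>{B\<in>bs. \<alpha> \<in> B \<and> B \<subseteq> U}"

lemma component_mem:
  assumes "\<alpha> \<in> U" "U \<subseteq> \<Delta>" shows "component U \<alpha> \<in> bs"
proof -
  have "{\<alpha>} \<union> \<Union>{B\<in>bs. \<alpha> \<in> B \<and> B \<subseteq> U} \<in> bs"
    by (rule Union_mem) (use assms finite_bs singleton in auto)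
  moreover have "{\<alpha>} \<subseteq> \<Union>{B\<in>bs. \<alpha> \<in> B \<and> B \<subseteq> U}"
    using assms singleton by blast
  ultimately show ?thesis unfolding component_def by (simp add: insert_absorb)
qed

lemma component_self:
  assumes "\<alpha> \<in> U" "U \<subseteq> \<Delta>" shows "\<alpha> \<in> component U \<alpha>"
  unfolding component_def using assms singleton by blast

lemma component_sub: "component U \<alpha> \<subseteq> U"
  unfolding component_def by auto

lemma component_absorbs:
  assumes "\<alpha> \<in> U" "U \<subseteq> \<Delta>" "B \<in> bs" "B \<subseteq> U" "B \<inter> component U \<alpha> \<noteq> {}"
  shows "B \<subseteq> component U \<alpha>"
proof -
  have "B \<union> component U \<alpha> \<in> bs" using assms component_mem union by blast
  moreover have "\<alpha> \<in> B \<union> component U \<alpha>" using assms component_self by blast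
  ultimately have "B \<union> component U \<alpha> \<subseteq> component U \<alpha>"
    using assms component_sub unfolding component_def by blast
  then show ?thesis by blast
qed

definition components :: "'a set \<Rightarrow> 'a set set" where
  "components U = component U ` U"

lemma components_mem: "U \<subseteq> \<Delta> \<Longrightarrow> C \<in> components U \<Longrightarrow> C \<in> bs"
  unfolding components_def using component_mem by auto

lemma components_sub: "C \<in> components U \<Longrightarrow> C \<subseteq> U"
  unfolding components_def using component_sub by auto

lemma components_absorb:
  "U \<subseteq> \<Delta> \<Longrightarrow> C \<in> components U \<Longrightarrow> B \<in> bs \<Longrightarrow> B \<subseteq> U \<Longrightarrow> B \<inter> C \<noteq> {} \<Longrightarrow> B \<subseteq> C"
  unfolding components_def using component_absorbs[of _ U B] by blast

lemma components_cover:
  assumes "U \<subseteq> \<Delta>" "B \<in> bs" "B \<subseteq> U" shows "\<exists>C\<in>components U. B \<subseteq> C"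
proof -
  obtain \<alpha> where "\<alpha> \<in> B" using assms mem_nonempty by blast
  then show ?thesis
    using assms component_absorbs[of \<alpha> U B] component_self[of \<alpha> U] unfolding components_def by blast
qed

lemma components_disjoint:
  assumes "U \<subseteq> \<Delta>" "B \<in> components U" "C \<in> components U" "B \<noteq> C"
  shows "B \<inter> C = {}"
  using assms components_absorb components_mem components_sub by (metis inf_commute subset_antisym)

lemma finite_components: "U \<subseteq> \<Delta> \<Longrightarrow> finite (components U)"
  unfolding components_def using fin finite_subset by auto

text \<open>Equivalent to the condition that no union of at least two members of an antichain in
  \<open>S\<close> belongs to the building set, but easier to use.\<close>

definition cnested :: "'a set set \<Rightarrow> bool" where
  "cnested S \<longleftrightarrow> S \<subseteq> bs \<and> (\<forall>T\<subseteq>S. \<forall>C\<in>bs. C \<subseteq> \<Union>T \<longrightarrow> (\<exists>B\<in>T. C \<subseteq> B))"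

lemma cnestedD: "cnested S \<Longrightarrow> T \<subseteq> S \<Longrightarrow> C \<in> bs \<Longrightarrow> C \<subseteq> \<Union>T \<Longrightarrow> \<exists>B\<in>T. C \<subseteq> B"
  unfolding cnested_def by blast

lemma cnested_bs: "cnested S \<Longrightarrow> B \<in> S \<Longrightarrow> B \<in> bs"
  unfolding cnested_def by blast

lemma cnested_subset: "cnested S \<Longrightarrow> T \<subseteq> S \<Longrightarrow> cnested T"
  unfolding cnested_def by (meson subset_trans)

lemma cnested_finite: "cnested S \<Longrightarrow> finite S"
  unfolding cnested_def by (simp add: finite_subfamily)

lemma cnested_cases:
  assumes "cnested S" "B \<in> S" "C \<in> S"
  obtains "B \<subseteq> C" | "C \<subseteq> B" | "B \<inter> C = {}"
proof (cases "B \<inter> C = {}")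
  case False
  then have "B \<union> C \<in> bs" using assms union cnested_bs by blast
  then have "\<exists>X\<in>{B, C}. B \<union> C \<subseteq> X" using cnestedD[OF assms(1), of "{B,C}" "B \<union> C"] assms by auto
  then show thesis using that by blast
qed (use that in blast)

text \<open>From right to left, shrink a cover of \<open>C\<close> to a minimal one. Each of its
  members meets \<open>C\<close>, so its union is again in \<open>bs\<close>, and minimality makes
  it an antichain; the antichain condition then leaves a single member.\<close>

lemma cnested_iff:
  "cnested S \<longleftrightarrow> S \<subseteq> bs \<and> (\<forall>T\<subseteq>S. 2 \<le> card T \<and> (\<forall>A\<in>T. \<forall>B\<in>T. A \<noteq> B \<longrightarrow> \<not> A \<subseteq> B) \<longrightarrow> \<Union>T \<notin> bs)"
  (is "_ \<longleftrightarrow> _ \<and> ?anti S")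
proof
  assume S: "cnested S"
  have "\<Union>T \<notin> bs" if T: "T \<subseteq> S" "2 \<le> card T" "\<forall>A\<in>T. \<forall>B\<in>T. A \<noteq> B \<longrightarrow> \<not> A \<subseteq> B" for T
  proof
    assume "\<Union>T \<in> bs"
    then obtain B where B: "B \<in> T" "\<Union>T \<subseteq> B" using cnestedD[OF S T(1)] by blast
    then have "T = {B}" using T(3) by blast
    then show False using T(2) by simp
  qed
  moreover have "S \<subseteq> bs" using S unfolding cnested_def by (rule conjunct1)
  ultimately show "S \<subseteq> bs \<and> ?anti S" by simp
next
  assume S: "S \<subseteq> bs \<and> ?anti S"
  show "cnested S" unfolding cnested_def
  proof (intro conjI allI impI ballI)
    fix T C assume T: "T \<subseteq> S" and C: "C \<in> bs" "C \<subseteq> \<Union>T"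
    have "T \<subseteq> bs" using T S[THEN conjunct1] by simp
    then have "finite T" by (rule finite_subfamily)
    then obtain T' where T': "T' \<subseteq> T" "C \<subseteq> \<Union>T'" and
      min: "\<And>T''. T'' \<subset> T' \<Longrightarrow> \<not> C \<subseteq> \<Union>T''"
      using finite_minimal_subfamily[of T "\<lambda>T. C \<subseteq> \<Union>T"] C by blast
    have fT': "finite T'" using T'(1) \<open>finite T\<close> by (rule finite_subset)
    have meet: "B \<inter> C \<noteq> {}" if "B \<in> T'" for B
    proof
      assume "B \<inter> C = {}"
      then have "C \<subseteq> \<Union>(T' - {B})" using T'(2) by blast
      then show False using min[of "T' - {B}"] that by auto
    qed
    have "C \<union> \<Union>T' \<in> bs" using Union_mem[OF fT' _ C(1)] meet T'(1) \<open>T \<subseteq> bs\<close> by auto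
    then have "\<Union>T' \<in> bs" using T' by (simp add: subset_Un_eq)
    moreover have "\<not> A \<subseteq> B" if "A \<in> T'" "B \<in> T'" "A \<noteq> B" for A B
      using min[of "T' - {A}"] that T'(2) by blast
    ultimately have "\<not> 2 \<le> card T'" using S T T' by (meson subset_trans)
    moreover have "T' \<noteq> {}" using T' C mem_nonempty by auto
    ultimately have "card T' = 1" using fT' card_gt_0_iff[of T'] by linarith
    then obtain B where "T' = {B}" by (rule card_1_singletonE)
    then show "\<exists>B\<in>T. C \<subseteq> B" using T'(1,2) by auto
  qed (use S in blast)
qed

text \<open>Among the sets of the chain that contribute to \<open>T\<close> a component meeting
  \<open>C\<close>, take the largest. It contains all of \<open>C\<close>, so \<open>C\<close> is
  absorbed by the component of it that it meets.\<close>

lemma cnested_chain: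
  assumes "\<Z> \<subseteq> Pow \<Delta>" and chain: "\<And>Y Z. Y \<in> \<Z> \<Longrightarrow> Z \<in> \<Z> \<Longrightarrow> Y \<subseteq> Z \<or> Z \<subseteq> Y"
  shows "cnested (\<Union>(components ` \<Z>))"
  unfolding cnested_def
proof (intro conjI allI impI ballI)
  show "\<Union>(components ` \<Z>) \<subseteq> bs" using assms(1) components_mem by blast
  fix T C assume T: "T \<subseteq> \<Union>(components ` \<Z>)" and C: "C \<in> bs" "C \<subseteq> \<Union>T"
  define Y where "Y = {Z\<in>\<Z>. \<exists>B\<in>T. B \<in> components Z \<and> B \<inter> C \<noteq> {}}"
  have "finite \<Z>" using assms(1) fin by (simp add: finite_subset)
  then have "finite Y" unfolding Y_def by simp
  moreover have "Y \<noteq> {}"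
  proof -
    obtain \<gamma> where "\<gamma> \<in> C" using mem_nonempty[OF C(1)] by blast
    then obtain B where "B \<in> T" "\<gamma> \<in> B" using C(2) by blast
    then show ?thesis unfolding Y_def using T \<open>\<gamma> \<in> C\<close> by blast
  qed
  ultimately obtain Z where Z: "Z \<in> Y" "\<forall>b\<in>Y. Z \<le> b \<longrightarrow> Z = b"
    using finite_has_maximal by metis
  then have max: "Z' \<subseteq> Z" if "Z' \<in> Y" for Z' using that chain unfolding Y_def by blast
  obtain B where B: "B \<in> T" "B \<in> components Z" "B \<inter> C \<noteq> {}" using Z(1) unfolding Y_def by blast
  have "C \<subseteq> Z"
  proof
    fix \<gamma> assume \<gamma>: "\<gamma> \<in> C"
    then obtain B' where B': "B' \<in> T" "\<gamma> \<in> B'" using C by blast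
    then obtain Z' where Z': "Z' \<in> \<Z>" "B' \<in> components Z'" using T by blast
    then have "Z' \<in> Y" unfolding Y_def using B' \<gamma> by blast
    then show "\<gamma> \<in> Z" using max components_sub[OF Z'(2)] B' by blast
  qed
  moreover have "Z \<subseteq> \<Delta>" using Z(1) assms(1) unfolding Y_def by blast
  ultimately have "C \<subseteq> B" using components_absorb[of Z B C] B C by blast
  then show "\<exists>B\<in>T. C \<subseteq> B" using B by blast
qed

text \<open>The elements of \<open>C\<close> outside its smaller members are the coordinates in
  which the level of \<open>C\<close> can be adjusted without disturbing those members.\<close>

lemma cnested_gap:
  assumes "cnested S" "C \<in> bs"
  shows "C - \<Union>{B\<in>S. B \<subset> C} \<noteq> {}"
proof
  assume "C - \<Union>{B\<in>S. B \<subset> C} = {}"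
  then have "C \<subseteq> \<Union>{B\<in>S. B \<subset> C}" by blast
  then show False using cnestedD[OF assms(1), of "{B\<in>S. B \<subset> C}" C] assms(2) by blast
qed

text \<open>Given two such elements, the component of \<alpha> in \<open>C - {\<beta>}\<close> could
  be added to \<open>M\<close>. Together with \<open>cnested_gap\<close>, every member of a maximal
  nested set has exactly one element outside its smaller members.\<close>

lemma maximal_cnested_gap:
  assumes M: "cnested M" and max: "\<And>M'. cnested M' \<Longrightarrow> M \<subseteq> M' \<Longrightarrow> M' = M"
    and C: "C \<in> M" and \<alpha>: "\<alpha> \<in> C - \<Union>{B\<in>M. B \<subset> C}" and \<beta>: "\<beta> \<in> C - \<Union>{B\<in>M. B \<subset> C}"
  shows "\<alpha> = \<beta>"
proof (rule ccontr)
  assume "\<alpha> \<noteq> \<beta>"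
  define K where "K = component (C - {\<beta>}) \<alpha>"
  have Csub: "C - {\<beta>} \<subseteq> \<Delta>" using C M sub cnested_bs by blast
  have \<alpha>C: "\<alpha> \<in> C - {\<beta>}" using \<alpha> \<open>\<alpha> \<noteq> \<beta>\<close> by blast
  have K: "K \<in> bs" "\<alpha> \<in> K" "K \<subseteq> C - {\<beta>}"
    unfolding K_def using component_mem[OF \<alpha>C Csub] component_self[OF \<alpha>C Csub] component_sub by blast+
  \<comment> \<open>A set \<open>X\<close> covered by \<open>T\<close> but by no single member must
    use \<open>K\<close>. Replacing \<open>K\<close> by \<open>C\<close> puts \<open>X\<close>
    inside \<open>C\<close>; the other members it meets are proper subsets of \<open>C\<close> and
    miss \<beta>, so \<open>X\<close> misses \<beta> and is absorbed by the component
    \<open>K\<close>.\<close>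
  have "cnested (insert K M)" unfolding cnested_def
  proof (intro conjI allI impI ballI)
    show "insert K M \<subseteq> bs" using K M unfolding cnested_def by blast
    fix T X assume T: "T \<subseteq> insert K M" and X: "X \<in> bs" "X \<subseteq> \<Union>T"
    show "\<exists>B\<in>T. X \<subseteq> B"
    proof (rule ccontr)
      assume no: "\<not> (\<exists>B\<in>T. X \<subseteq> B)"
      define T' where "T' = T - {K}"
      have T': "T' \<subseteq> M" using T unfolding T'_def by blast
      have "X \<inter> K \<noteq> {}"
      proof
        assume "X \<inter> K = {}"
        then have "X \<subseteq> \<Union>T'" using X unfolding T'_def by blast
        then show False using cnestedD[OF M T' X(1)] no unfolding T'_def by blast
      qed
      have "X \<subseteq> \<Union>(insert C T')" using X K unfolding T'_def by blast
      then have XC: "X \<subseteq> C" using cnestedD[OF M, of "insert C T'" X] T' C X no unfolding T'_def by blast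
      have small: "B \<subset> C" if "B \<in> T'" "B \<inter> X \<noteq> {}" for B
      proof (rule cnested_cases[OF M C, of B])
        have "B \<in> T" "\<not> X \<subseteq> B" using that(1) no unfolding T'_def by auto
        show "B \<in> M" using that(1) T' by auto
        show "B \<subset> C" if "B \<subseteq> C" using that \<open>\<not> X \<subseteq> B\<close> XC by auto
        show "B \<subset> C" if "C \<subseteq> B" using that \<open>\<not> X \<subseteq> B\<close> XC by auto
        show "B \<subset> C" if "C \<inter> B = {}" using that \<open>B \<inter> X \<noteq> {}\<close> XC by auto
      qed
      have "\<beta> \<notin> X" using small X K \<beta> T' unfolding T'_def by blast
      then have "X \<subseteq> K" using component_absorbs[OF \<alpha>C Csub X(1)] XC \<open>X \<inter> K \<noteq> {}\<close> unfolding K_def by blast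
      moreover have "K \<in> T"
      proof (rule ccontr)
        assume "K \<notin> T"
        then have "T' = T" unfolding T'_def by blast
        then show False using cnestedD[OF M T' X(1)] X(2) no by blast
      qed
      ultimately show False using no by blast
    qed
  qed
  then have "K \<in> M" using max by blast
  then show False using K \<alpha> \<beta> by blast
qed

lemma cnested_extend_maximal:
  assumes "cnested S"
  obtains M where "cnested M" "S \<subseteq> M" "\<And>M'. cnested M' \<Longrightarrow> M \<subseteq> M' \<Longrightarrow> M' = M"
proof -
  have "finite {M. cnested M \<and> S \<subseteq> M}"
    by (rule finite_subset[of _ "Pow bs"]) (use finite_bs in \<open>auto simp: cnested_def\<close>)
  then obtain M where "M \<in> {M. cnested M \<and> S \<subseteq> M}" "\<forall>b\<in>{M. cnested M \<and> S \<subseteq> M}. M \<le> b \<longrightarrow> M = b"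
    using finite_has_maximal[of "{M. cnested M \<and> S \<subseteq> M}"] assms by auto
  then show thesis by (intro that[of M]) auto
qed

lemma cnested_insert_top:
  assumes "cnested S" shows "cnested (insert \<Delta> S)"
  unfolding cnested_def
proof (intro conjI allI impI ballI)
  show "insert \<Delta> S \<subseteq> bs" using assms top unfolding cnested_def by blast
  fix T X assume T: "T \<subseteq> insert \<Delta> S" and X: "X \<in> bs" "X \<subseteq> \<Union>T"
  show "\<exists>B\<in>T. X \<subseteq> B"
    using T X sub[OF X(1)] cnestedD[OF assms, of T X] by (cases "\<Delta> \<in> T") blast+
qed

text \<open>Saturated members are canonical representatives modulo \<open>D\<close>: among the
  members not inside \<open>D\<close> that have the same union with \<open>D\<close>, exactly one is
  saturated. It is a component of that union.\<close>

definition saturated :: "'a set \<Rightarrow> 'a set \<Rightarrow> bool" where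
  "saturated D B \<longleftrightarrow> (\<forall>C\<in>bs. C \<subseteq> B \<union> D \<and> C \<inter> B \<noteq> {} \<longrightarrow> C \<subseteq> B)"

lemma saturatedD: "saturated D B \<Longrightarrow> C \<in> bs \<Longrightarrow> C \<subseteq> B \<union> D \<Longrightarrow> C \<inter> B \<noteq> {} \<Longrightarrow> C \<subseteq> B"
  unfolding saturated_def by blast

lemma exists_saturated:
  assumes B: "B \<in> bs" and D: "D \<subseteq> \<Delta>"
  shows "\<exists>C\<in>bs. B \<subseteq> C \<and> C \<subseteq> B \<union> D \<and> saturated D C"
proof -
  obtain \<alpha> where \<alpha>: "\<alpha> \<in> B" using mem_nonempty[OF B] by blast
  define C where "C = component (B \<union> D) \<alpha>"
  have U: "\<alpha> \<in> B \<union> D" "B \<union> D \<subseteq> \<Delta>" using \<alpha> sub[OF B] D by auto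
  have C: "C \<in> bs" "C \<subseteq> B \<union> D" "\<alpha> \<in> C"
    unfolding C_def using component_mem[OF U] component_sub component_self[OF U] by auto
  have "B \<subseteq> C"
    using component_absorbs[OF U B] C(3) \<alpha> unfolding C_def by auto
  moreover have "saturated D C"
    unfolding saturated_def
  proof (intro ballI impI)
    fix X assume "X \<in> bs" "X \<subseteq> C \<union> D \<and> X \<inter> C \<noteq> {}"
    then show "X \<subseteq> C" using component_absorbs[OF U, of X] C(2) unfolding C_def by auto
  qed
  ultimately show ?thesis using C by blast
qed

text \<open>An element of \<open>C\<close> outside \<open>B\<close> lies in some \<open>A\<close> in
  \<open>\<A>\<close>, and saturation then absorbs all of \<open>A\<close>. This presents
  \<open>C\<close> as a union to which admissibility applies.\<close>

lemma saturated_cover: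
  assumes \<A>: "\<A> \<subseteq> bs" and sat: "saturated (\<Union>\<A>) C" and C: "C \<in> bs" "C \<subseteq> B \<union> \<Union>\<A>" "B \<subseteq> C"
  shows "C = B \<union> \<Union>{A\<in>\<A>. A \<subseteq> C \<and> \<not> A \<subseteq> B}"
proof
  show "C \<subseteq> B \<union> \<Union>{A\<in>\<A>. A \<subseteq> C \<and> \<not> A \<subseteq> B}"
  proof
    fix \<gamma> assume \<gamma>: "\<gamma> \<in> C"
    show "\<gamma> \<in> B \<union> \<Union>{A\<in>\<A>. A \<subseteq> C \<and> \<not> A \<subseteq> B}"
    proof (cases "\<gamma> \<in> B")
      case False
      then obtain A where A: "A \<in> \<A>" "\<gamma> \<in> A" using \<gamma> C(2) by blast
      have "A \<subseteq> C" by (rule saturatedD[OF sat]) (use A \<gamma> \<A> in auto)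
      then show ?thesis using A False by blast
    qed simp
  qed
qed (use C in blast)

end

section \<open>Nested sets as tight sets of inequalities\<close>

text \<open>Here \<open>c A \<alpha>\<close> stands for the coefficient of \<alpha> in the half sum
  of \<open>A\<close>, and a function \<open>y\<close> for the values
  \<open>x \<bullet> \<alpha>\<close> at a point \<open>x\<close>, so that \<open>val A y\<close>
  becomes the inner product of \<open>x\<close> with that half sum.\<close>

locale weighted_building = building +
  fixes c :: "'a set \<Rightarrow> 'a \<Rightarrow> real"
  assumes c_pos: "A \<in> bs \<Longrightarrow> \<alpha> \<in> A \<Longrightarrow> 0 < c A \<alpha>"
begin

definition val :: "'a set \<Rightarrow> ('a \<Rightarrow> real) \<Rightarrow> real" where
  "val A y = (\<Sum>\<alpha>\<in>A. c A \<alpha> * y \<alpha>)"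

definition ratio :: "'a set \<Rightarrow> 'a set \<Rightarrow> real" where
  "ratio A B = Max ((\<lambda>\<alpha>. c A \<alpha> / c B \<alpha>) ` B)"

definition irredundant :: "'a set set \<Rightarrow> bool" where
  "irredundant T \<longleftrightarrow> 2 \<le> card T \<and> (\<forall>B\<in>T. \<Union>(T - {B}) \<noteq> \<Union>T)"

text \<open>The combinatorial content of suitability. The levels are indexed by members rather than
  by dimensions so that they can be perturbed one member at a time.\<close>

definition admissible :: "('a set \<Rightarrow> real) \<Rightarrow> bool" where
  "admissible e \<longleftrightarrow> (\<forall>A\<in>bs. 0 < e A) \<and>
     (\<forall>T\<subseteq>bs. \<Union>T \<in> bs \<and> irredundant T \<longrightarrow> (\<Sum>B\<in>T. ratio (\<Union>T) B * e B) < e (\<Union>T))"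

lemma ratio_ge:
  assumes "B \<in> bs" "\<alpha> \<in> B" shows "c A \<alpha> \<le> ratio A B * c B \<alpha>"
proof -
  have "c A \<alpha> / c B \<alpha> \<le> ratio A B"
    unfolding ratio_def by (rule Max_ge) (use assms finite_mem in auto)
  then show ?thesis using c_pos[OF assms] by (simp add: divide_le_eq)
qed

lemma ratio_pos:
  assumes "B \<in> bs" "A \<in> bs" "B \<subseteq> A" shows "0 < ratio A B"
proof -
  obtain \<alpha> where "\<alpha> \<in> B" using assms mem_nonempty by blast
  then have "0 < ratio A B * c B \<alpha>"
    using ratio_ge[OF assms(1), of \<alpha> A] c_pos[OF assms(2), of \<alpha>] assms(3) by force
  then show ?thesis using c_pos[OF assms(1) \<open>\<alpha> \<in> B\<close>] by (simp add: zero_less_mult_iff)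
qed

text \<open>Elements lying in several members of \<open>T\<close> are counted repeatedly on the
  right, which only enlarges it since \<open>y\<close> is nonnegative there.\<close>

lemma sum_le_ratio:
  assumes T: "T \<subseteq> bs" "finite T" and A: "A \<in> bs" "\<Union>T \<subseteq> A" and y: "\<And>\<alpha>. \<alpha> \<in> \<Union>T \<Longrightarrow> 0 \<le> y \<alpha>"
  shows "(\<Sum>\<alpha>\<in>\<Union>T. c A \<alpha> * y \<alpha>) \<le> (\<Sum>B\<in>T. ratio A B * val B y)"
  using T(2,1) A(2) y
proof (induction T)
  case (insert B T)
  have fB: "finite B" and fT: "finite (\<Union>T)" using insert.prems(1) insert.hyps(1) finite_mem by auto
  have "(\<Sum>\<alpha>\<in>\<Union>(insert B T). c A \<alpha> * y \<alpha>) = (\<Sum>\<alpha>\<in>B \<union> \<Union>T. c A \<alpha> * y \<alpha>)" by simp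
  also have "\<dots> = (\<Sum>\<alpha>\<in>B. c A \<alpha> * y \<alpha>) + (\<Sum>\<alpha>\<in>\<Union>T. c A \<alpha> * y \<alpha>) - (\<Sum>\<alpha>\<in>B \<inter> \<Union>T. c A \<alpha> * y \<alpha>)"
    using fB fT by (rule sum_Un)
  also have "\<dots> \<le> (\<Sum>\<alpha>\<in>B. c A \<alpha> * y \<alpha>) + (\<Sum>\<alpha>\<in>\<Union>T. c A \<alpha> * y \<alpha>)"
  proof -
    have "0 \<le> (\<Sum>\<alpha>\<in>B \<inter> \<Union>T. c A \<alpha> * y \<alpha>)"
      by (rule sum_nonneg) (use insert.prems c_pos[OF A(1)] in \<open>auto intro!: mult_nonneg_nonneg simp: less_imp_le\<close>)
    then show ?thesis by linarith
  qed
  also have "(\<Sum>\<alpha>\<in>B. c A \<alpha> * y \<alpha>) \<le> (\<Sum>\<alpha>\<in>B. ratio A B * (c B \<alpha> * y \<alpha>))"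
  proof (rule sum_mono)
    fix \<alpha> assume "\<alpha> \<in> B"
    then have "c A \<alpha> * y \<alpha> \<le> (ratio A B * c B \<alpha>) * y \<alpha>"
      using ratio_ge[of B \<alpha> A] insert.prems by (intro mult_right_mono) auto
    then show "c A \<alpha> * y \<alpha> \<le> ratio A B * (c B \<alpha> * y \<alpha>)" by (simp add: mult.assoc)
  qed
  also have "\<dots> = ratio A B * val B y" unfolding val_def by (simp add: sum_distrib_left)
  also have "(\<Sum>\<alpha>\<in>\<Union>T. c A \<alpha> * y \<alpha>) \<le> (\<Sum>B\<in>T. ratio A B * val B y)"
    using insert.IH insert.prems by auto
  finally show ?case using insert.hyps by simp
qed simp

lemma val_le_ratio:
  assumes "T \<subseteq> bs" "\<Union>T \<in> bs" "\<And>\<alpha>. \<alpha> \<in> \<Union>T \<Longrightarrow> 0 \<le> y \<alpha>"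
  shows "val (\<Union>T) y \<le> (\<Sum>B\<in>T. ratio (\<Union>T) B * val B y)"
  using sum_le_ratio[OF assms(1) finite_subfamily[OF assms(1)] assms(2) order_refl assms(3)]
  unfolding val_def .

lemma admissible_pos: "admissible e \<Longrightarrow> A \<in> bs \<Longrightarrow> 0 < e A"
  unfolding admissible_def by blast

lemma admissibleD:
  "admissible e \<Longrightarrow> T \<subseteq> bs \<Longrightarrow> \<Union>T \<in> bs \<Longrightarrow> irredundant T \<Longrightarrow> (\<Sum>B\<in>T. ratio (\<Union>T) B * e B) < e (\<Union>T)"
  unfolding admissible_def by blast

lemma val_singleton: "val {\<alpha>} y = c {\<alpha>} \<alpha> * y \<alpha>"
  unfolding val_def by simp

lemma val_singleton_pos:
  assumes "admissible e" "\<alpha> \<in> \<Delta>" "e {\<alpha>} \<le> val {\<alpha>} y" shows "0 < y \<alpha>"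
proof -
  have "0 < c {\<alpha>} \<alpha> * y \<alpha>"
    using assms admissible_pos[OF assms(1) singleton[OF assms(2)]] by (simp add: val_singleton)
  then show ?thesis using c_pos[OF singleton[OF assms(2)], of \<alpha>] by (simp add: zero_less_mult_iff)
qed

text \<open>If a minimal cover of \<open>C\<close> by tight members had at least two of them, their
  union would be a member whose value is bounded by the ratio estimate, and admissibility would put
  that bound below its level.\<close>

lemma cnested_tight:
  assumes e: "admissible e" and y: "\<And>A. A \<in> bs \<Longrightarrow> e A \<le> val A y"
  shows "cnested {A\<in>bs. val A y = e A}"
  unfolding cnested_def
proof (intro conjI allI impI ballI)
  fix T C assume T: "T \<subseteq> {A\<in>bs. val A y = e A}" and C: "C \<in> bs" "C \<subseteq> \<Union>T"
  have "finite T" by (rule finite_subfamily) (use T in auto)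
  then obtain T' where T': "T' \<subseteq> T" "C \<subseteq> \<Union>T'" and
    min: "\<And>T''. T'' \<subset> T' \<Longrightarrow> \<not> C \<subseteq> \<Union>T''"
    using finite_minimal_subfamily[of T "\<lambda>T. C \<subseteq> \<Union>T"] C by blast
  have fT': "finite T'" using T'(1) \<open>finite T\<close> by (rule finite_subset)
  have T'bs: "T' \<subseteq> bs" using T T' by blast
  have "C \<union> \<Union>T' \<in> bs"
  proof (rule Union_mem[OF fT' T'bs C(1)])
    show "B \<inter> C \<noteq> {}" if "B \<in> T'" for B
    proof
      assume "B \<inter> C = {}"
      then have "C \<subseteq> \<Union>(T' - {B})" using T'(2) by blast
      then show False using min[of "T' - {B}"] that by auto
    qed
  qed
  then have U: "\<Union>T' \<in> bs" using T' by (simp add: subset_Un_eq)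
  have "\<not> 2 \<le> card T'"
  proof
    assume "2 \<le> card T'"
    moreover have "\<Union>(T' - {B}) \<noteq> \<Union>T'" if "B \<in> T'" for B
    proof -
      have "T' - {B} \<subset> T'" using that by blast
      then show ?thesis using min[of "T' - {B}"] T'(2) by auto
    qed
    ultimately have "irredundant T'" unfolding irredundant_def by blast
    then have "(\<Sum>B\<in>T'. ratio (\<Union>T') B * e B) < e (\<Union>T')" using admissibleD[OF e T'bs U] by blast
    moreover have "(\<Sum>B\<in>T'. ratio (\<Union>T') B * val B y) = (\<Sum>B\<in>T'. ratio (\<Union>T') B * e B)"
      by (rule sum.cong) (use T T' in auto)
    moreover have "val (\<Union>T') y \<le> (\<Sum>B\<in>T'. ratio (\<Union>T') B * val B y)"
    proof (rule val_le_ratio[OF T'bs U])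
      fix \<alpha> assume "\<alpha> \<in> \<Union>T'"
      then have "\<alpha> \<in> \<Delta>" using T'bs sub by blast
      then show "0 \<le> y \<alpha>" using val_singleton_pos[OF e _ y[OF singleton]] by (simp add: less_imp_le)
    qed
    ultimately show False using y[OF U] by linarith
  qed
  moreover have "T' \<noteq> {}" using T' C mem_nonempty by auto
  ultimately have "card T' = 1" using fT' card_gt_0_iff[of T'] by linarith
  then obtain B where "T' = {B}" by (rule card_1_singletonE)
  then show "\<exists>B\<in>T. C \<subseteq> B" using T'(1,2) by auto
qed blast

text \<open>Remove an inclusion-maximal member \<open>C\<close>, solve for the rest, and change the
  solution only on the elements of \<open>C\<close> outside its smaller members. The other equations
  do not involve these elements; admissibility leaves a positive amount for them.\<close>

lemma exists_val_eq:
  assumes e: "admissible e" and "cnested S"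
  shows "\<exists>y. (\<forall>\<alpha>. 0 < y \<alpha>) \<and> (\<forall>A\<in>S. val A y = e A)"
  using cnested_finite[OF assms(2)] assms(2)
proof (induction S rule: finite_psubset_induct)
  case (psubset S)
  show ?case
  proof (cases "S = {}")
    case True
    then show ?thesis by (intro exI[of _ "\<lambda>_. 1"]) auto
  next
    case False
    then obtain C where C: "C \<in> S" and Cmax: "\<forall>B\<in>S. C \<subseteq> B \<longrightarrow> C = B"
      using finite_has_maximal[OF psubset(1)] by auto
    have Cbs: "C \<in> bs" using C psubset.prems cnested_bs by blast
    have "S - {C} \<subset> S" "cnested (S - {C})" using C cnested_subset[OF psubset.prems, of "S - {C}"] by auto
    from psubset.IH[OF this] obtain y where y: "\<And>\<alpha>. 0 < y \<alpha>" "\<And>A. A \<in> S - {C} \<Longrightarrow> val A y = e A"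
      by auto
    define F where "F = {B\<in>S. B \<subset> C}"
    define E where "E = C - \<Union>F"
    have E: "E \<noteq> {}" unfolding E_def F_def using cnested_gap[OF psubset.prems Cbs] .
    have fC: "finite C" using finite_mem[OF Cbs] .
    have fE: "finite E" unfolding E_def using fC by blast
    have fF: "finite F" unfolding F_def using psubset(1) by simp
    have Fbs: "F \<subseteq> bs" unfolding F_def using psubset.prems cnested_bs by blast
    obtain T where T: "T \<subseteq> F" "\<Union>T = \<Union>F" and min: "\<And>T'. T' \<subset> T \<Longrightarrow> \<Union>T' \<noteq> \<Union>F"
      using finite_minimal_subfamily[of F "\<lambda>T. \<Union>T = \<Union>F"] fF by blast
    define r where "r = e C - (\<Sum>\<alpha>\<in>\<Union>F. c C \<alpha> * y \<alpha>)"
    \<comment> \<open>The smaller members alone do not cover \<open>C\<close>. Singletons of the own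
      elements complete a minimal subfamily of them to an irredundant cover of \<open>C\<close>, so
      that admissibility can be applied; the positive terms of the singletons are then
      dropped.\<close>
    define TT where "TT = T \<union> (\<lambda>\<alpha>. {\<alpha>}) ` E"
    have EC: "E \<subseteq> C" "E \<inter> \<Union>F = {}" "C = E \<union> \<Union>F" unfolding E_def F_def by blast+
    have TTbs: "TT \<subseteq> bs" unfolding TT_def using T Fbs EC sub[OF Cbs] singleton by blast
    have fTT: "finite TT" using TTbs by (rule finite_subfamily)
    have UTT: "\<Union>TT = C" unfolding TT_def using T EC by auto
    have "0 < r"
    proof (cases "2 \<le> card TT")
      case True
      have irr: "\<Union>(TT - {B}) \<noteq> \<Union>TT" if B: "B \<in> TT" for B
      proof
        assume eq: "\<Union>(TT - {B}) = \<Union>TT"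
        show False
        proof (cases "B \<in> T")
          case True
          have "\<Union>(T - {B}) = \<Union>F"
          proof
            show "\<Union>F \<subseteq> \<Union>(T - {B})"
            proof
              fix \<gamma> assume \<gamma>: "\<gamma> \<in> \<Union>F"
              then have "\<gamma> \<in> \<Union>(TT - {B})" using eq UTT EC by blast
              then show "\<gamma> \<in> \<Union>(T - {B})" unfolding TT_def using \<gamma> EC by blast
            qed
          qed (use T in blast)
          then show False using min[of "T - {B}"] True by blast
        next
          case False
          then obtain \<alpha> where \<alpha>: "\<alpha> \<in> E" "B = {\<alpha>}" using B unfolding TT_def by blast
          then have "\<alpha> \<in> \<Union>(TT - {B})" using eq B by blast
          then show False unfolding TT_def using \<alpha> EC T by blast
        qed
      qed
      then have "irredundant TT" unfolding irredundant_def using True by blast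
      then have "(\<Sum>B\<in>TT. ratio C B * e B) < e C"
        using admissibleD[OF e TTbs] UTT Cbs by simp
      moreover have "(\<Sum>B\<in>T. ratio C B * e B) \<le> (\<Sum>B\<in>TT. ratio C B * e B)"
      proof (rule sum_mono2[OF fTT])
        fix B assume "B \<in> TT - T"
        then have "B \<in> bs" "B \<subseteq> C" using TTbs UTT by blast+
        then show "0 \<le> ratio C B * e B"
          using ratio_pos[OF _ Cbs] admissible_pos[OF e] by (simp add: less_imp_le)
      qed (auto simp: TT_def)
      moreover have "(\<Sum>\<alpha>\<in>\<Union>F. c C \<alpha> * y \<alpha>) \<le> (\<Sum>B\<in>T. ratio C B * val B y)"
        using sum_le_ratio[of T C y] T Fbs fF finite_subset[of T F] Cbs y(1) EC by (auto simp: less_imp_le)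
      moreover have "(\<Sum>B\<in>T. ratio C B * val B y) = (\<Sum>B\<in>T. ratio C B * e B)"
      proof (rule sum.cong)
        fix B assume "B \<in> T"
        then have "B \<in> S - {C}" using T(1) unfolding F_def by auto
        then show "ratio C B * val B y = ratio C B * e B" using y(2) by simp
      qed simp
      ultimately show ?thesis unfolding r_def by linarith
    next
      case False
      \<comment> \<open>One member of \<open>T\<close> and one singleton from \<open>E\<close> would
        already give two members of \<open>TT\<close>.\<close>
      have "T = {}"
      proof (rule ccontr)
        assume "T \<noteq> {}"
        then obtain B where B: "B \<in> T" by blast
        obtain \<alpha> where \<alpha>: "\<alpha> \<in> E" using E by blast
        then have "B \<noteq> {\<alpha>}" using B T EC by blast
        then have "card {B, {\<alpha>}} = 2" by simp
        moreover have "card {B, {\<alpha>}} \<le> card TT"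
          by (rule card_mono[OF fTT]) (use B \<alpha> in \<open>auto simp: TT_def\<close>)
        ultimately show False using False by linarith
      qed
      then have "\<Union>F = {}" using T(2) by (simp only: Union_empty)
      then show ?thesis unfolding r_def using admissible_pos[OF e Cbs] by (simp only: sum.empty)
    qed
    \<comment> \<open>The missing amount \<open>r\<close> is shared equally: each own element
      contributes \<open>r / card E\<close> to the value of \<open>C\<close>.\<close>
    define y' where "y' = (\<lambda>\<alpha>. if \<alpha> \<in> E then r / (card E * c C \<alpha>) else y \<alpha>)"
    have cE: "0 < card E" using E fE by (simp add: card_gt_0_iff)
    have "0 < y' \<alpha>" for \<alpha>
      unfolding y'_def using y(1) \<open>0 < r\<close> c_pos[OF Cbs, of \<alpha>] EC cE by auto
    moreover have "val A y' = e A" if A: "A \<in> S" for A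
    proof (cases "A = C")
      case True
      have fUF: "finite (\<Union>F)" using EC(3) fC by (metis finite_Un)
      have "val C y' = (\<Sum>\<alpha>\<in>E \<union> \<Union>F. c C \<alpha> * y' \<alpha>)"
        unfolding val_def using EC(3) by (rule sum.cong) (rule refl)
      also have "\<dots> = (\<Sum>\<alpha>\<in>E. c C \<alpha> * y' \<alpha>) + (\<Sum>\<alpha>\<in>\<Union>F. c C \<alpha> * y' \<alpha>)"
        by (rule sum.union_disjoint[OF fE fUF EC(2)])
      also have "(\<Sum>\<alpha>\<in>E. c C \<alpha> * y' \<alpha>) = (\<Sum>\<alpha>\<in>E. r / card E)"
      proof (rule sum.cong)
        fix \<alpha> assume "\<alpha> \<in> E"
        then have "0 < c C \<alpha>" using c_pos[OF Cbs] EC(1) by auto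
        then show "c C \<alpha> * y' \<alpha> = r / card E" using \<open>\<alpha> \<in> E\<close> by (simp add: y'_def)
      qed simp
      also have "\<dots> = r" using cE by simp
      also have "(\<Sum>\<alpha>\<in>\<Union>F. c C \<alpha> * y' \<alpha>) = (\<Sum>\<alpha>\<in>\<Union>F. c C \<alpha> * y \<alpha>)"
        by (rule sum.cong) (use EC in \<open>auto simp: y'_def\<close>)
      finally show ?thesis unfolding r_def True by simp
    next
      case False
      have "A \<inter> E = {}"
      proof (rule cnested_cases[OF psubset.prems A C])
        show "A \<inter> E = {}" if "A \<subseteq> C"
        proof -
          have "A \<in> F" using that False A unfolding F_def by blast
          then show ?thesis using EC(2) by blast
        qed
        show "A \<inter> E = {}" if "C \<subseteq> A" using that False A Cmax by auto
        show "A \<inter> E = {}" if "A \<inter> C = {}" using that EC(1) by auto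
      qed
      then have "val A y' = val A y" unfolding val_def y'_def by (intro sum.cong) auto
      then show ?thesis using y(2) A False by simp
    qed
    ultimately show ?thesis by blast
  qed
qed

text \<open>Let \<open>C\<close> be the smallest member of \<open>M\<close> containing
  \<open>B\<close>. Then \<open>C\<close> is the union of \<open>B\<close> and some smaller members
  of \<open>M\<close>, which are tight; in the ratio estimate for this cover their terms agree with
  those of the admissibility bound, and only the terms of \<open>B\<close> are left to
  compare.\<close>

lemma val_gt_of_maximal:
  assumes e: "admissible e" and M: "cnested M" "\<Delta> \<in> M"
    and max: "\<And>M'. cnested M' \<Longrightarrow> M \<subseteq> M' \<Longrightarrow> M' = M"
    and y: "\<And>\<alpha>. 0 < y \<alpha>" "\<And>A. A \<in> M \<Longrightarrow> val A y = e A"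
    and B: "B \<in> bs" "B \<notin> M"
  shows "e B < val B y"
proof -
  have "finite {A\<in>M. B \<subseteq> A}" "{A\<in>M. B \<subseteq> A} \<noteq> {}"
    using cnested_finite[OF M(1)] M(2) sub[OF B(1)] by auto
  from finite_has_minimal[OF this] obtain C where "C \<in> {A\<in>M. B \<subseteq> A}"
    "\<forall>A\<in>{A\<in>M. B \<subseteq> A}. A \<subseteq> C \<longrightarrow> C = A" ..
  then obtain C where C: "C \<in> M" "B \<subseteq> C"
    and Cmin: "\<And>A. A \<in> M \<Longrightarrow> B \<subseteq> A \<Longrightarrow> A \<subseteq> C \<Longrightarrow> A = C"
    by auto
  have Cbs: "C \<in> bs" using C M cnested_bs by blast
  define F where "F = {B\<in>M. B \<subset> C}"
  obtain \<alpha> where \<alpha>: "\<alpha> \<in> C - \<Union>F" unfolding F_def using cnested_gap[OF M(1) Cbs] by blast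
  have CF: "C = insert \<alpha> (\<Union>F)"
    using maximal_cnested_gap[OF M(1) max C(1)] \<alpha> unfolding F_def by blast
  \<comment> \<open>Otherwise \<open>B\<close> would be covered by the smaller members of
    \<open>C\<close>, hence lie in one of them by nestedness, against the choice of
    \<open>C\<close>.\<close>
  have \<alpha>B: "\<alpha> \<in> B"
  proof (rule ccontr)
    assume "\<alpha> \<notin> B"
    then have "B \<subseteq> \<Union>F" using C CF by blast
    then obtain B' where "B' \<in> F" "B \<subseteq> B'" using cnestedD[OF M(1) _ B(1), of F] unfolding F_def by blast
    then show False using Cmin unfolding F_def by blast
  qed
  have fF: "finite F" unfolding F_def using cnested_finite[OF M(1)] by simp
  have "B \<union> \<Union>F = C" using CF C \<alpha>B by blast
  then obtain T where T: "T \<subseteq> F" "B \<union> \<Union>T = C" and min: "\<And>T'. T' \<subset> T \<Longrightarrow> B \<union> \<Union>T' \<noteq> C"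
    using finite_minimal_subfamily[of F "\<lambda>T. B \<union> \<Union>T = C"] fF by blast
  have fT: "finite T" using T(1) fF by (rule finite_subset)
  have BT: "B \<notin> T" using T B unfolding F_def by blast
  have UT: "\<Union>(insert B T) = C" using T by auto
  have Tbs: "insert B T \<subseteq> bs" using T B M cnested_bs unfolding F_def by blast
  have "T \<noteq> {}" using T B C by auto
  then have "2 \<le> card (insert B T)" using fT BT by (simp add: card_gt_0_iff Suc_le_eq)
  moreover have "\<Union>(insert B T - {X}) \<noteq> C" if X: "X \<in> insert B T" for X
  proof (cases "X = B")
    case True
    then show ?thesis using \<alpha> T by blast
  next
    case False
    then have "\<Union>(insert B T - {X}) = B \<union> \<Union>(T - {X})" by blast
    then show ?thesis using min[of "T - {X}"] X False by auto
  qed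
  ultimately have "irredundant (insert B T)" unfolding irredundant_def UT by blast
  then have "(\<Sum>X\<in>insert B T. ratio C X * e X) < e C"
    using admissibleD[OF e Tbs] Cbs unfolding UT by blast
  moreover have "e C \<le> (\<Sum>X\<in>insert B T. ratio C X * val X y)"
    using val_le_ratio[OF Tbs] Cbs y C(1) unfolding UT by (metis less_imp_le)
  moreover have "(\<Sum>X\<in>T. ratio C X * val X y) = (\<Sum>X\<in>T. ratio C X * e X)"
    by (rule sum.cong) (use T y(2) in \<open>auto simp: F_def\<close>)
  ultimately have "ratio C B * e B < ratio C B * val B y" using fT BT by simp
  then show ?thesis using ratio_pos[OF B(1) Cbs C(2)] by simp
qed

text \<open>Admissibility consists of finitely many strict inequalities, so it survives a small
  increase of the levels outside \<open>S\<close>.\<close>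

lemma admissible_perturb:
  assumes e: "admissible e"
  shows "\<exists>\<delta>>0. admissible (\<lambda>A. if A \<in> S then e A else e A + \<delta>)"
proof -
  let ?e = "\<lambda>\<delta> A. if A \<in> S then e A else e A + \<delta>"
  have lim: "((\<lambda>\<delta>. ?e \<delta> A) \<longlongrightarrow> e A) (at_right 0)" for A
    by (cases "A \<in> S") (auto intro!: tendsto_eq_intros)
  have "\<forall>\<^sub>F \<delta> in at_right 0. \<forall>T\<in>{T. T \<subseteq> bs \<and> \<Union>T \<in> bs \<and> irredundant T}.
      (\<Sum>B\<in>T. ratio (\<Union>T) B * ?e \<delta> B) < ?e \<delta> (\<Union>T)"
  proof (rule eventually_ball_finite, goal_cases)
    case 1
    then show ?case using finite_subset[OF _ finite_Pow_iff[THEN iffD2, OF finite_bs]] by (metis (no_types, lifting) Pow_iff mem_Collect_eq subsetI)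
  next
    case 2
    show ?case
    proof
      fix T assume T: "T \<in> {T. T \<subseteq> bs \<and> \<Union>T \<in> bs \<and> irredundant T}"
      have "((\<lambda>\<delta>. ?e \<delta> (\<Union>T) - (\<Sum>B\<in>T. ratio (\<Union>T) B * ?e \<delta> B)) \<longlongrightarrow>
          e (\<Union>T) - (\<Sum>B\<in>T. ratio (\<Union>T) B * e B)) (at_right 0)"
        by (intro tendsto_diff tendsto_sum tendsto_mult tendsto_const lim)
      moreover have "0 < e (\<Union>T) - (\<Sum>B\<in>T. ratio (\<Union>T) B * e B)"
        using admissibleD[OF e] T by auto
      ultimately have "\<forall>\<^sub>F \<delta> in at_right 0. 0 < ?e \<delta> (\<Union>T) - (\<Sum>B\<in>T. ratio (\<Union>T) B * ?e \<delta> B)"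
        by (rule order_tendstoD(1))
      then show "\<forall>\<^sub>F \<delta> in at_right 0. (\<Sum>B\<in>T. ratio (\<Union>T) B * ?e \<delta> B) < ?e \<delta> (\<Union>T)"
        by (rule eventually_mono) linarith
    qed
  qed
  moreover have "\<forall>\<^sub>F \<delta> in at_right (0::real). 0 < \<delta>" by (simp add: eventually_at_right_less)
  ultimately have "\<forall>\<^sub>F \<delta> in at_right 0. 0 < \<delta> \<and> (\<forall>T\<in>{T. T \<subseteq> bs \<and> \<Union>T \<in> bs \<and> irredundant T}.
      (\<Sum>B\<in>T. ratio (\<Union>T) B * ?e \<delta> B) < ?e \<delta> (\<Union>T))"
    using eventually_conj by blast
  then obtain \<delta> where \<delta>: "0 < \<delta>" "\<forall>T\<in>{T. T \<subseteq> bs \<and> \<Union>T \<in> bs \<and> irredundant T}.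
      (\<Sum>B\<in>T. ratio (\<Union>T) B * ?e \<delta> B) < ?e \<delta> (\<Union>T)"
    using eventually_happens[of _ "at_right (0::real)"] trivial_limit_at_right_real[of "0::real"] by blast
  have "admissible (?e \<delta>)"
    unfolding admissible_def using \<delta> admissible_pos[OF e] by (auto intro: add_pos_pos)
  then show ?thesis using \<delta>(1) by blast
qed

text \<open>Solving for \<open>S\<close> alone gives no control of the other members. Solve instead
  for a maximal nested set containing \<open>S\<close>, with the levels outside \<open>S\<close>
  raised by \<delta>: every member outside \<open>S\<close> then reaches its raised level and so
  exceeds the original one.\<close>

lemma exists_tight_eq:
  assumes e: "admissible e" and S: "cnested S" "\<Delta> \<in> S"
  shows "\<exists>y. (\<forall>\<alpha>. 0 < y \<alpha>) \<and> (\<forall>A\<in>S. val A y = e A) \<and> (\<forall>A\<in>bs - S. e A < val A y)"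
proof -
  obtain M where M: "cnested M" "S \<subseteq> M" and max: "\<And>M'. cnested M' \<Longrightarrow> M \<subseteq> M' \<Longrightarrow> M' = M"
    using cnested_extend_maximal[OF S(1)] by blast
  obtain \<delta> where \<delta>: "0 < \<delta>" "admissible (\<lambda>A. if A \<in> S then e A else e A + \<delta>)"
    using admissible_perturb[OF e] by blast
  let ?e = "\<lambda>A. if A \<in> S then e A else e A + \<delta>"
  obtain y where y: "\<And>\<alpha>. 0 < y \<alpha>" "\<And>A. A \<in> M \<Longrightarrow> val A y = ?e A"
    using exists_val_eq[OF \<delta>(2) M(1)] by blast
  have "e A < val A y" if A: "A \<in> bs" "A \<notin> S" for A
  proof (cases "A \<in> M")
    case True
    then show ?thesis using y(2) A \<delta> by simp
  next
    case False
    then have "?e A < val A y"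
      using val_gt_of_maximal[OF \<delta>(2) M(1) _ max y A(1)] M(2) S(2) by blast
    then show ?thesis using A \<delta>(1) by simp
  qed
  moreover have "val A y = e A" if "A \<in> S" for A using y(2)[of A] that M(2) by auto
  ultimately show ?thesis using y(1) by blast
qed

text \<open>The inequality of a member \<open>B\<close> that meets some members of \<open>\<A>\<close> without containing them is implied
  by that of the union of \<open>B\<close> with these members, by admissibility.\<close>

lemma feasible_of_saturated:
  assumes e: "admissible e" and \<A>: "cnested \<A>"
    and disj: "\<And>A A'. A \<in> \<A> \<Longrightarrow> A' \<in> \<A> \<Longrightarrow> A \<noteq> A' \<Longrightarrow> A \<inter> A' = {}"
    and y1: "\<And>A. A \<in> \<A> \<Longrightarrow> val A y = e A"
    and y2: "\<And>A B. A \<in> \<A> \<Longrightarrow> B \<in> bs \<Longrightarrow> B \<subseteq> A \<Longrightarrow> e B \<le> val B y"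
    and y3: "\<And>B. B \<in> bs \<Longrightarrow> \<not> B \<subseteq> \<Union>\<A> \<Longrightarrow> saturated (\<Union>\<A>) B \<Longrightarrow> e B \<le> val B y"
    and B: "B \<in> bs"
  shows "e B \<le> val B y"
proof -
  define D where "D = \<Union>\<A>"
  have D: "D \<subseteq> \<Delta>" unfolding D_def using cnested_bs[OF \<A>] sub by blast
  have \<A>bs: "\<A> \<subseteq> bs" using cnested_bs[OF \<A>] by blast
  have posD: "0 < y \<alpha>" if \<alpha>D: "\<alpha> \<in> D" for \<alpha>
  proof -
    obtain A where A: "A \<in> \<A>" "\<alpha> \<in> A" using \<alpha>D[unfolded D_def] by (rule UnionE)
    have "\<alpha> \<in> \<Delta>" using \<alpha>D D by auto
    then show ?thesis using val_singleton_pos[OF e _ y2[OF A(1) singleton]] A(2) by simp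
  qed
  \<comment> \<open>The cover by \<open>B\<close> and \<open>T\<close> is irredundant:
    \<open>B\<close> has an element outside \<open>D\<close>, and each \<open>A\<close> in
    \<open>T\<close> has an element outside \<open>B\<close>, which lies in no other member of
    \<open>T\<close> by disjointness.\<close>
  have key: "(\<Sum>A\<in>T. ratio C A * e A) + ratio C B * e B < e C"
    if T: "T = {A\<in>\<A>. A \<subseteq> C \<and> \<not> A \<subseteq> B}" and C: "C = B \<union> \<Union>T" "C \<in> bs" "T \<noteq> {}"
      and B: "B \<in> bs" "\<not> B \<subseteq> D" for T C B
  proof -
    have Tbs: "T \<subseteq> bs" using T \<A>bs by auto
    have fT: "finite T" using Tbs by (rule finite_subfamily)
    have BT: "B \<notin> T" using T by auto
    have UT: "\<Union>(insert B T) = C" using C by auto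
    have "\<Union>(insert B T - {X}) \<noteq> C" if X: "X \<in> insert B T" for X
    proof (cases "X = B")
      case True
      have "\<Union>(insert B T - {X}) \<subseteq> D" using True T unfolding D_def by blast
      then show ?thesis using C(1) B(2) by auto
    next
      case False
      then have XT: "X \<in> T" using X by simp
      then obtain \<gamma> where \<gamma>: "\<gamma> \<in> X" "\<gamma> \<notin> B" using T by blast
      have "\<gamma> \<notin> X'" if "X' \<in> T" "X' \<noteq> X" for X'
        using disj[of X' X] that XT T \<gamma>(1) by auto
      then have "\<gamma> \<notin> \<Union>(insert B T - {X})" using \<gamma> by auto
      moreover have "\<gamma> \<in> C" using \<gamma>(1) XT C(1) by auto
      ultimately show ?thesis by auto
    qed
    moreover have "2 \<le> card (insert B T)" using fT BT C(3) by (simp add: card_gt_0_iff Suc_le_eq)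
    ultimately have "irredundant (insert B T)" unfolding irredundant_def UT by blast
    then have "(\<Sum>X\<in>insert B T. ratio C X * e X) < e C"
      using admissibleD[OF e, of "insert B T"] Tbs B(1) C(2) UT by simp
    then show ?thesis using fT BT by simp
  qed
  have valT: "(\<Sum>A\<in>T. ratio C A * val A y) = (\<Sum>A\<in>T. ratio C A * e A)" if "T \<subseteq> \<A>" for T C
    by (rule sum.cong) (use y1 that in auto)
  \<comment> \<open>The ratio estimate requires nonnegative coordinates, so positivity outside
    \<open>D\<close> comes first. Saturate \<open>{\<alpha>}\<close>; the contribution of the
    absorbed members stays below \<open>e C\<close>, which leaves a positive share for
    \<alpha>.\<close>
  have pos: "0 < y \<alpha>" if \<alpha>: "\<alpha> \<in> \<Delta>" for \<alpha>
  proof (cases "\<alpha> \<in> D")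
    case True
    then show ?thesis by (rule posD)
  next
    case False
    note sing = singleton[OF \<alpha>]
    obtain C where C: "C \<in> bs" "{\<alpha>} \<subseteq> C" "C \<subseteq> {\<alpha>} \<union> D" "saturated D C"
      using exists_saturated[OF sing D] by blast
    define T where "T = {A\<in>\<A>. A \<subseteq> C \<and> \<not> A \<subseteq> {\<alpha>}}"
    have UT: "C = {\<alpha>} \<union> \<Union>T"
      using saturated_cover[OF \<A>bs C(4)[unfolded D_def] C(1) _ C(2)] C(3) unfolding T_def D_def by simp
    have TA: "T \<subseteq> \<A>" unfolding T_def by blast
    have UTD: "\<Union>T \<subseteq> D" unfolding T_def D_def by blast
    have Tbs: "T \<subseteq> bs" using TA \<A>bs by blast
    have eC: "e C \<le> val C y" using y3[OF C(1)] C(2,4) False unfolding D_def by auto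
    have "val C y = c C \<alpha> * y \<alpha> + (\<Sum>\<gamma>\<in>\<Union>T. c C \<gamma> * y \<gamma>)"
    proof -
      have "finite (\<Union>T)" using UT finite_mem[OF C(1)] by (metis finite_Un)
      moreover have "\<alpha> \<notin> \<Union>T" using UTD False by auto
      ultimately have "(\<Sum>\<gamma>\<in>insert \<alpha> (\<Union>T). c C \<gamma> * y \<gamma>) = c C \<alpha> * y \<alpha> + (\<Sum>\<gamma>\<in>\<Union>T. c C \<gamma> * y \<gamma>)"
        by (rule sum.insert)
      then show ?thesis unfolding val_def using UT by simp
    qed
    also have "(\<Sum>\<gamma>\<in>\<Union>T. c C \<gamma> * y \<gamma>) \<le> (\<Sum>A\<in>T. ratio C A * e A)"
      using sum_le_ratio[OF Tbs finite_subfamily[OF Tbs] C(1), of y] UT posD UTD valT[OF TA, of C]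
      by (auto simp: less_imp_le subset_iff)
    finally have le: "e C \<le> c C \<alpha> * y \<alpha> + (\<Sum>A\<in>T. ratio C A * e A)" using eC by simp
    have "(\<Sum>A\<in>T. ratio C A * e A) < e C"
    proof (cases "T = {}")
      case True
      then show ?thesis using admissible_pos[OF e C(1)] by simp
    next
      case ne: False
      have "(\<Sum>A\<in>T. ratio C A * e A) + ratio C {\<alpha>} * e {\<alpha>} < e C"
        by (rule key[OF T_def UT C(1) ne sing]) (use False in auto)
      moreover have "0 < ratio C {\<alpha>} * e {\<alpha>}"
        using ratio_pos[OF sing C(1)] C(2) admissible_pos[OF e sing] by simp
      ultimately show ?thesis by linarith
    qed
    then have "0 < c C \<alpha> * y \<alpha>" using le by linarith
    then show ?thesis using c_pos[OF C(1), of \<alpha>] C(2) by (simp add: zero_less_mult_iff)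
  qed
  show ?thesis
  proof (cases "B \<subseteq> D")
    case True
    then obtain A where "A \<in> \<A>" "B \<subseteq> A" using cnestedD[OF \<A> order_refl B] unfolding D_def by auto
    then show ?thesis using y2 B by auto
  next
    case False
    obtain C where C: "C \<in> bs" "B \<subseteq> C" "C \<subseteq> B \<union> D" "saturated D C"
      using exists_saturated[OF B D] by blast
    define T where "T = {A\<in>\<A>. A \<subseteq> C \<and> \<not> A \<subseteq> B}"
    have UT: "C = B \<union> \<Union>T"
      using saturated_cover[OF \<A>bs C(4)[unfolded D_def] C(1) _ C(2)] C(3) unfolding T_def D_def by simp
    have TA: "T \<subseteq> \<A>" unfolding T_def by blast
    have Tbs: "T \<subseteq> bs" using TA \<A>bs by blast
    have fT: "finite T" using Tbs by (rule finite_subfamily)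
    have BT: "B \<notin> T" unfolding T_def by blast
    have eC: "e C \<le> val C y" using y3[OF C(1)] C(2,4) False unfolding D_def by auto
    show ?thesis
    proof (cases "T = {}")
      case True
      then show ?thesis using eC UT by simp
    next
      case ne: False
      have U: "\<Union>(insert B T) = C" using UT by auto
      have "val C y \<le> (\<Sum>X\<in>insert B T. ratio C X * val X y)"
        unfolding U[symmetric]
      proof (rule val_le_ratio)
        fix \<alpha> assume "\<alpha> \<in> \<Union>(insert B T)"
        then have "\<alpha> \<in> \<Delta>" unfolding U using sub[OF C(1)] by auto
        then show "0 \<le> y \<alpha>" using pos by (simp add: less_imp_le)
      qed (use U C(1) Tbs B in auto)
      then have "val C y \<le> ratio C B * val B y + (\<Sum>X\<in>T. ratio C X * e X)"
        using fT BT valT[OF TA] by simp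
      moreover have "(\<Sum>A\<in>T. ratio C A * e A) + ratio C B * e B < e C"
        by (rule key[OF T_def UT C(1) ne B False])
      ultimately have "ratio C B * e B \<le> ratio C B * val B y" using eC by linarith
      then show ?thesis using ratio_pos[OF B C(1,2)] by simp
    qed
  qed
qed

end

section \<open>Face posets of polyhedra\<close>

text \<open>The order condition of \<open>nestohedron\<close> with an arbitrary family of labels, so
  that tight index sets and nested sets can both serve as labels of faces.\<close>

definition face_poset :: "'p::euclidean_space set \<Rightarrow> 'i set set \<Rightarrow> bool" where
  "face_poset P \<T> \<longleftrightarrow>
     (\<exists>f. bij_betw f {F. F face_of P \<and> F \<noteq> {}} \<T> \<and>
        (\<forall>F F'. F face_of P \<and> F \<noteq> {} \<and> F' face_of P \<and> F' \<noteq> {} \<longrightarrow>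
           (F' \<subseteq> F \<longleftrightarrow> f F \<subseteq> f F')))"

lemma face_posetE:
  assumes "face_poset P \<T>"
  obtains f where "bij_betw f {F. F face_of P \<and> F \<noteq> {}} \<T>"
    and "\<And>F F'. F face_of P \<Longrightarrow> F \<noteq> {} \<Longrightarrow> F' face_of P \<Longrightarrow> F' \<noteq> {} \<Longrightarrow> F' \<subseteq> F \<longleftrightarrow> f F \<subseteq> f F'"
proof -
  from assms[unfolded face_poset_def] obtain f where f: "bij_betw f {F. F face_of P \<and> F \<noteq> {}} \<T> \<and>
    (\<forall>F F'. F face_of P \<and> F \<noteq> {} \<and> F' face_of P \<and> F' \<noteq> {} \<longrightarrow> (F' \<subseteq> F \<longleftrightarrow> f F \<subseteq> f F'))" ..
  show thesis by (rule that[OF conjunct1[OF f]]) (use conjunct2[OF f] in simp)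
qed

lemma combinatorially_equivalentE:
  assumes "combinatorially_equivalent P Q"
  obtains f where "bij_betw f {F. F face_of P} {F. F face_of Q}"
    and "\<And>F F'. F face_of P \<Longrightarrow> F' face_of P \<Longrightarrow> F \<subseteq> F' \<longleftrightarrow> f F \<subseteq> f F'"
proof -
  from assms[unfolded combinatorially_equivalent_def] obtain f where f:
    "bij_betw f {F. F face_of P} {F. F face_of Q} \<and>
     (\<forall>F F'. F face_of P \<and> F' face_of P \<longrightarrow> (F \<subseteq> F' \<longleftrightarrow> f F \<subseteq> f F'))" ..
  show thesis by (rule that[OF conjunct1[OF f]]) (use conjunct2[OF f] in simp)
qed

lemma nestohedron_face_poset: "nestohedron G V Q \<Longrightarrow> face_poset Q {S. nested G S \<and> V \<in> S}"
  unfolding nestohedron_def face_poset_def by (rule conjunct2)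

lemma face_poset_transfer:
  assumes "face_poset P \<T>" and bij: "bij_betw g \<T> \<U>"
    and ord: "\<And>X Y. X \<in> \<T> \<Longrightarrow> Y \<in> \<T> \<Longrightarrow> X \<subseteq> Y \<longleftrightarrow> g X \<subseteq> g Y"
  shows "face_poset P \<U>"
proof -
  obtain f where f: "bij_betw f {F. F face_of P \<and> F \<noteq> {}} \<T>"
    "\<And>F F'. F face_of P \<Longrightarrow> F \<noteq> {} \<Longrightarrow> F' face_of P \<Longrightarrow> F' \<noteq> {} \<Longrightarrow> F' \<subseteq> F \<longleftrightarrow> f F \<subseteq> f F'"
    by (rule face_posetE[OF assms(1)]) (rule that; assumption)
  have mem: "f F \<in> \<T>" if "F face_of P" "F \<noteq> {}" for F
    using bij_betwE[OF f(1)] that by blast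
  show ?thesis unfolding face_poset_def
  proof (intro exI[of _ "g \<circ> f"] conjI allI impI)
    show "bij_betw (g \<circ> f) {F. F face_of P \<and> F \<noteq> {}} \<U>" by (rule bij_betw_trans[OF f(1) bij])
    fix F F' assume "F face_of P \<and> F \<noteq> {} \<and> F' face_of P \<and> F' \<noteq> {}"
    then show "F' \<subseteq> F \<longleftrightarrow> (g \<circ> f) F \<subseteq> (g \<circ> f) F'" using f(2) ord mem by simp
  qed
qed

lemma combinatorially_equivalent_of_face_poset:
  assumes "face_poset P \<T>" "face_poset Q \<T>"
  shows "combinatorially_equivalent P Q"
proof -
  obtain f where f: "bij_betw f {F. F face_of P \<and> F \<noteq> {}} \<T>"
    and fo: "\<And>F F'. F face_of P \<Longrightarrow> F \<noteq> {} \<Longrightarrow> F' face_of P \<Longrightarrow> F' \<noteq> {} \<Longrightarrow> F' \<subseteq> F \<longleftrightarrow> f F \<subseteq> f F'"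
    by (rule face_posetE[OF assms(1)]) (rule that; assumption)
  obtain g where g: "bij_betw g {F. F face_of Q \<and> F \<noteq> {}} \<T>"
    and go: "\<And>F F'. F face_of Q \<Longrightarrow> F \<noteq> {} \<Longrightarrow> F' face_of Q \<Longrightarrow> F' \<noteq> {} \<Longrightarrow> F' \<subseteq> F \<longleftrightarrow> g F \<subseteq> g F'"
    by (rule face_posetE[OF assms(2)]) (rule that; assumption)
  define h where "h = inv_into {F. F face_of Q \<and> F \<noteq> {}} g \<circ> f"
  have h: "bij_betw h {F. F face_of P \<and> F \<noteq> {}} {F. F face_of Q \<and> F \<noteq> {}}"
    unfolding h_def by (rule bij_betw_trans[OF f bij_betw_inv_into[OF g]])
  have gh: "g (h F) = f F" if "F face_of P" "F \<noteq> {}" for F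
  proof -
    have "f F \<in> \<T>" using bij_betwE[OF f] that by blast
    then show ?thesis unfolding h_def using bij_betw_inv_into_right[OF g] by simp
  qed
  have hmem: "h F face_of Q" "h F \<noteq> {}" if "F face_of P" "F \<noteq> {}" for F
    using bij_betwE[OF h] that by blast+
  \<comment> \<open>Labels exist for nonempty faces only; the empty face is matched
    separately.\<close>
  define k where "k = (\<lambda>F. if F = {} then {} else h F)"
  have decP: "{F. F face_of P} = insert {} {F. F face_of P \<and> F \<noteq> {}}"
    and decQ: "{F. F face_of Q} = insert {} {F. F face_of Q \<and> F \<noteq> {}}"
    using empty_face_of by blast+
  have kh: "bij_betw k {F. F face_of P \<and> F \<noteq> {}} {F. F face_of Q \<and> F \<noteq> {}}"
    by (rule iffD1[OF bij_betw_cong h]) (auto simp: k_def)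
  have "bij_betw k {F. F face_of P} {F. F face_of Q}"
    unfolding decP decQ using notIn_Un_bij_betw3[of "{}" "{F. F face_of P \<and> F \<noteq> {}}" k "{F. F face_of Q \<and> F \<noteq> {}}"] kh
    by (auto simp: k_def)
  moreover have "F \<subseteq> F' \<longleftrightarrow> k F \<subseteq> k F'" if F: "F face_of P" "F' face_of P" for F F'
  proof (cases "F = {} \<or> F' = {}")
    case True
    then show ?thesis using hmem(2)[OF F(1)] F by (auto simp: k_def)
  next
    case False
    then have "F \<subseteq> F' \<longleftrightarrow> g (h F') \<subseteq> g (h F)" using fo F gh by simp
    also have "\<dots> \<longleftrightarrow> h F \<subseteq> h F'" using go hmem F False by simp
    finally show ?thesis using False by (simp add: k_def)
  qed
  ultimately show ?thesis unfolding combinatorially_equivalent_def by (intro exI[of _ k]) simp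
qed

lemma combinatorially_equivalent_trans:
  assumes "combinatorially_equivalent P Q" "combinatorially_equivalent Q R"
  shows "combinatorially_equivalent P R"
proof -
  obtain f where f: "bij_betw f {F. F face_of P} {F. F face_of Q}"
    "\<And>F F'. F face_of P \<Longrightarrow> F' face_of P \<Longrightarrow> F \<subseteq> F' \<longleftrightarrow> f F \<subseteq> f F'"
    by (rule combinatorially_equivalentE[OF assms(1)]) (rule that; assumption)
  obtain g where g: "bij_betw g {F. F face_of Q} {F. F face_of R}"
    "\<And>F F'. F face_of Q \<Longrightarrow> F' face_of Q \<Longrightarrow> F \<subseteq> F' \<longleftrightarrow> g F \<subseteq> g F'"
    by (rule combinatorially_equivalentE[OF assms(2)]) (rule that; assumption)
  have mem: "f F face_of Q" if "F face_of P" for F using bij_betwE[OF f(1)] that by blast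
  show ?thesis unfolding combinatorially_equivalent_def
    using bij_betw_trans[OF f(1) g(1)] f(2) g(2) mem by (intro exI[of _ "g \<circ> f"]) simp
qed

lemma combinatorially_equivalent_empty:
  assumes f: "bij_betw f {F. F face_of P} {F. F face_of Q}"
    and fo: "\<And>F F'. F face_of P \<Longrightarrow> F' face_of P \<Longrightarrow> F \<subseteq> F' \<longleftrightarrow> f F \<subseteq> f F'"
  shows "f {} = {}"
proof -
  have "{} \<in> f ` {F. F face_of P}" unfolding bij_betw_imp_surj_on[OF f] using empty_face_of[of Q] by simp
  then obtain X where "X face_of P" "f X = {}" by auto
  then show ?thesis using fo[OF empty_face_of, of X] by auto
qed

lemma face_of_Times_fst_snd:
  fixes P :: "'p::euclidean_space set" and Q :: "'q::euclidean_space set"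
  assumes "C face_of P \<times> Q" "C \<noteq> {}"
  shows "fst ` C face_of P" "snd ` C face_of Q" "C = fst ` C \<times> snd ` C"
proof -
  obtain F F' where F: "F face_of P" "F' face_of Q" "C = F \<times> F'"
    using assms(1) face_of_Times_decomp[of C P Q] by blast
  then have "F \<noteq> {}" "F' \<noteq> {}" using assms(2) by auto
  then show "fst ` C face_of P" "snd ` C face_of Q" "C = fst ` C \<times> snd ` C" using F by simp_all
qed

text \<open>A nonempty face of a product is the product of its two projections, which are faces. The
  empty face has many factorizations and is treated apart, using that both equivalences preserve it
  as the least face.\<close>

lemma combinatorially_equivalent_Times:
  assumes "combinatorially_equivalent P P'" "combinatorially_equivalent Q Q'"
  shows "combinatorially_equivalent (P \<times> Q) (P' \<times> Q')"
proof -
  obtain f where f: "bij_betw f {F. F face_of P} {F. F face_of P'}"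
    and fo: "\<And>F F'. F face_of P \<Longrightarrow> F' face_of P \<Longrightarrow> F \<subseteq> F' \<longleftrightarrow> f F \<subseteq> f F'"
    by (rule combinatorially_equivalentE[OF assms(1)]) (rule that; assumption)
  obtain g where g: "bij_betw g {F. F face_of Q} {F. F face_of Q'}"
    and go: "\<And>F F'. F face_of Q \<Longrightarrow> F' face_of Q \<Longrightarrow> F \<subseteq> F' \<longleftrightarrow> g F \<subseteq> g F'"
    by (rule combinatorially_equivalentE[OF assms(2)]) (rule that; assumption)
  have f0: "f {} = {}" and g0: "g {} = {}"
    using combinatorially_equivalent_empty[OF f fo] combinatorially_equivalent_empty[OF g go] by auto
  have fne: "f F \<noteq> {}" if "F face_of P" "F \<noteq> {}" for F
    using fo[OF that(1) empty_face_of] that f0 by auto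
  have gne: "g F \<noteq> {}" if "F face_of Q" "F \<noteq> {}" for F
    using go[OF that(1) empty_face_of] that g0 by auto
  have fm: "f F face_of P'" if "F face_of P" for F using bij_betwE[OF f] that by blast
  have gm: "g F face_of Q'" if "F face_of Q" for F using bij_betwE[OF g] that by blast
  define h where "h = (\<lambda>C. f (fst ` C) \<times> g (snd ` C))"
  have h0: "h {} = {}" by (simp add: h_def f0)
  note dec = face_of_Times_fst_snd
  have hne: "h C \<noteq> {}" if "C face_of P \<times> Q" "C \<noteq> {}" for C
    unfolding h_def using fne[OF dec(1)[OF that]] gne[OF dec(2)[OF that]] that by (simp add: times_eq_iff)
  have order: "C \<subseteq> C' \<longleftrightarrow> h C \<subseteq> h C'" if C: "C face_of P \<times> Q" "C' face_of P \<times> Q" for C C'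
  proof (cases "C = {} \<or> C' = {}")
    case True
    then show ?thesis using hne C h0 by auto
  next
    case False
    then have ne: "C \<noteq> {}" "C' \<noteq> {}" by auto
    note d = dec[OF C(1) ne(1)] and d' = dec[OF C(2) ne(2)]
    have "C \<subseteq> C' \<longleftrightarrow> fst ` C \<times> snd ` C \<subseteq> fst ` C' \<times> snd ` C'" using d(3) d'(3) by simp
    also have "\<dots> \<longleftrightarrow> fst ` C \<subseteq> fst ` C' \<and> snd ` C \<subseteq> snd ` C'"
      using ne by (simp add: times_subset_iff)
    also have "\<dots> \<longleftrightarrow> f (fst ` C) \<subseteq> f (fst ` C') \<and> g (snd ` C) \<subseteq> g (snd ` C')"
      using fo[OF d(1) d'(1)] go[OF d(2) d'(2)] by simp
    also have "\<dots> \<longleftrightarrow> h C \<subseteq> h C'"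
      unfolding h_def using fne[OF d(1)] gne[OF d(2)] ne by (simp add: times_subset_iff)
    finally show ?thesis .
  qed
  have "bij_betw h {C. C face_of P \<times> Q} {C. C face_of P' \<times> Q'}"
  proof (rule bij_betwI')
    fix C C' assume "C \<in> {C. C face_of P \<times> Q}" "C' \<in> {C. C face_of P \<times> Q}"
    then show "h C = h C' \<longleftrightarrow> C = C'" using order by (metis mem_Collect_eq subset_antisym order_refl)
  next
    fix C assume "C \<in> {C. C face_of P \<times> Q}"
    then have C: "C face_of P \<times> Q" by simp
    show "h C \<in> {C. C face_of P' \<times> Q'}"
    proof (cases "C = {}")
      case True
      then show ?thesis using h0 empty_face_of by simp
    next
      case False
      show ?thesis unfolding h_def
        using face_of_Times[OF fm[OF dec(1)[OF C False]] gm[OF dec(2)[OF C False]]] by simp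
    qed
  next
    fix C assume "C \<in> {C. C face_of P' \<times> Q'}"
    then have C: "C face_of P' \<times> Q'" by simp
    show "\<exists>X\<in>{C. C face_of P \<times> Q}. C = h X"
    proof (cases "C = {}")
      case True
      then show ?thesis using h0 empty_face_of by blast
    next
      case False
      note d = dec[OF C False]
      have "fst ` C \<in> f ` {F. F face_of P}" "snd ` C \<in> g ` {F. F face_of Q}"
        unfolding bij_betw_imp_surj_on[OF f] bij_betw_imp_surj_on[OF g] using d by simp_all
      then obtain X Y where X: "X face_of P" "f X = fst ` C" and Y: "Y face_of Q" "g Y = snd ` C" by auto
      have "X \<noteq> {}" "Y \<noteq> {}" using X Y f0 g0 False by auto
      then have "h (X \<times> Y) = C" unfolding h_def using X Y d(3) by simp
      then show ?thesis using face_of_Times[OF X(1) Y(1)] by blast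
    qed
  qed
  then show ?thesis unfolding combinatorially_equivalent_def using order by (intro exI[of _ h]) simp
qed

lemma linear_convex_diff:
  "linear a \<Longrightarrow> a ((1 - t) *\<^sub>R x + t *\<^sub>R y) = (1 - t) * a x + t * (a y :: real)"
  by (simp add: linear_add linear_scale)

text \<open>Finitely many inequalities on an affine subspace, possibly redundant. The functionals
  are kept apart from the bounds \<open>b\<close>, so that one set of functionals serves for
  different levels.\<close>

locale polyhedron_by =
  fixes L :: "'p::euclidean_space set" and I :: "'i set" and a :: "'i \<Rightarrow> 'p \<Rightarrow> real" and b :: "'i \<Rightarrow> real"
  assumes affine: "affine L" and finite_I: "finite I" and linear_a: "i \<in> I \<Longrightarrow> linear (a i)"
begin

definition body :: "'p set" where
  "body = {x\<in>L. \<forall>i\<in>I. a i x \<le> b i}"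

definition tight :: "'p \<Rightarrow> 'i set" where
  "tight x = {i\<in>I. a i x = b i}"

definition tight_on :: "'p set \<Rightarrow> 'i set" where
  "tight_on F = {i\<in>I. \<forall>x\<in>F. a i x = b i}"

lemma convex_body: "convex body"
  unfolding convex_alt
proof (intro ballI allI impI)
  fix x y and t :: real assume xy: "x \<in> body" "y \<in> body" and t: "0 \<le> t \<and> t \<le> 1"
  have "a i ((1 - t) *\<^sub>R x + t *\<^sub>R y) \<le> b i" if "i \<in> I" for i
  proof -
    have "(1 - t) * a i x \<le> (1 - t) * b i" "t * a i y \<le> t * b i"
      using xy t that unfolding body_def by (auto intro: mult_left_mono)
    then show ?thesis unfolding linear_convex_diff[OF linear_a[OF that]] by (simp add: algebra_simps)
  qed
  moreover have "(1 - t) *\<^sub>R x + t *\<^sub>R y \<in> L"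
    using affine xy unfolding affine_alt body_def by blast
  ultimately show "(1 - t) *\<^sub>R x + t *\<^sub>R y \<in> body" unfolding body_def by blast
qed

lemma tight_segment:
  assumes x: "x \<in> body" "y \<in> body" and t: "0 < t" "t < 1" and i: "i \<in> I"
    and eq: "a i ((1 - t) *\<^sub>R x + t *\<^sub>R y) = b i"
  shows "a i x = b i" "a i y = b i"
proof -
  have le: "a i x \<le> b i" "a i y \<le> b i" using x i unfolding body_def by auto
  have eq': "(1 - t) * a i x + t * a i y = b i" using eq unfolding linear_convex_diff[OF linear_a[OF i]] .
  have l1: "(1 - t) * a i x \<le> (1 - t) * b i" and l2: "t * a i y \<le> t * b i"
    using le t by (auto intro: mult_left_mono)
  have "(1 - t) * b i + t * b i = b i" by (simp add: algebra_simps)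
  then have "(1 - t) * a i x = (1 - t) * b i" "t * a i y = t * b i" using eq' l1 l2 by linarith+
  then show "a i x = b i" "a i y = b i" using t by auto
qed

lemma face_of_tight:
  shows "{y\<in>body. K \<subseteq> tight y} face_of body"
  unfolding face_of_def
proof (intro conjI ballI impI)
  show "{y \<in> body. K \<subseteq> tight y} \<subseteq> body" by blast
  show "convex {y \<in> body. K \<subseteq> tight y}" unfolding convex_alt
  proof (intro ballI allI impI)
    fix x y and t :: real
    assume xy: "x \<in> {y \<in> body. K \<subseteq> tight y}" "y \<in> {y \<in> body. K \<subseteq> tight y}" and t: "0 \<le> t \<and> t \<le> 1"
    have "(1 - t) *\<^sub>R x + t *\<^sub>R y \<in> body"
      using convex_body xy t unfolding convex_alt by blast
    moreover have "i \<in> tight ((1 - t) *\<^sub>R x + t *\<^sub>R y)" if "i \<in> K" for i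
    proof -
      have i: "i \<in> I" "a i x = b i" "a i y = b i" using that xy unfolding tight_def by blast+
      then show ?thesis unfolding tight_def
        by (simp add: linear_convex_diff[OF linear_a[OF i(1)]] left_diff_distrib)
    qed
    ultimately show "(1 - t) *\<^sub>R x + t *\<^sub>R y \<in> {y \<in> body. K \<subseteq> tight y}" by blast
  qed
  fix x y z assume xy: "x \<in> body" "y \<in> body" and z: "z \<in> {y \<in> body. K \<subseteq> tight y}" "z \<in> open_segment x y"
  obtain t where t: "0 < t" "t < 1" "z = (1 - t) *\<^sub>R x + t *\<^sub>R y"
    using z(2) unfolding in_segment by blast
  have "i \<in> tight x \<and> i \<in> tight y" if "i \<in> K" for i
    using tight_segment[OF xy t(1,2), of i] that z(1) t(3) unfolding tight_def by blast
  then show "x \<in> {y \<in> body. K \<subseteq> tight y}" "y \<in> {y \<in> body. K \<subseteq> tight y}" using xy by blast+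
qed

text \<open>Prolong the segment from \<open>y\<close> to \<open>x\<close> slightly beyond
  \<open>x\<close>. Inequalities tight at \<open>x\<close> are tight at \<open>y\<close> too and
  stay tight along the line, the others have room left at \<open>x\<close>. So \<open>x\<close> is
  interior to a segment of the polyhedron ending at \<open>y\<close>.\<close>

lemma face_contains_tighter:
  assumes F: "F face_of body" and x: "x \<in> F" and y: "y \<in> body" "tight x \<subseteq> tight y"
  shows "y \<in> F"
proof (cases "y = x")
  case False
  have xb: "x \<in> body" using F x face_of_imp_subset by blast
  define w where "w = (\<lambda>s::real. x + s *\<^sub>R (x - y))"
  have "\<forall>\<^sub>F s in at_right 0. \<forall>i\<in>I. a i (w s) \<le> b i"
  proof (rule eventually_ball_finite[OF finite_I], rule ballI)
    fix i assume i: "i \<in> I"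
    have w: "a i (w s) = a i x + s * (a i x - a i y)" for s
      unfolding w_def by (simp add: linear_add linear_scale linear_diff linear_a[OF i])
    show "\<forall>\<^sub>F s in at_right 0. a i (w s) \<le> b i"
    proof (cases "i \<in> tight x")
      case True
      then have "a i x = b i" "a i y = b i" using y(2) unfolding tight_def by blast+
      then show ?thesis by (simp add: w)
    next
      case False
      then have "a i x < b i" using xb i unfolding body_def tight_def by force
      moreover have "((\<lambda>s. a i x + s * (a i x - a i y)) \<longlongrightarrow> a i x) (at_right 0)"
        by (auto intro!: tendsto_eq_intros)
      ultimately have "\<forall>\<^sub>F s in at_right 0. a i x + s * (a i x - a i y) < b i"
        by (metis order_tendstoD(2))
      then show ?thesis unfolding w by (rule eventually_mono) simp
    qed
  qed
  moreover have "\<forall>\<^sub>F s in at_right (0::real). 0 < s" by (simp add: eventually_at_right_less)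
  ultimately have "\<forall>\<^sub>F s in at_right 0. 0 < s \<and> (\<forall>i\<in>I. a i (w s) \<le> b i)"
    using eventually_conj by blast
  then obtain s where s: "0 < s" "\<forall>i\<in>I. a i (w s) \<le> b i"
    using eventually_happens[of _ "at_right (0::real)"] trivial_limit_at_right_real[of "0::real"] by blast
  have "w s = (1 + s) *\<^sub>R x + (- s) *\<^sub>R y" unfolding w_def by (simp add: algebra_simps)
  moreover have "(1 + s) *\<^sub>R x + (- s) *\<^sub>R y \<in> L"
    using affine[unfolded affine_def, rule_format, of x y "1 + s" "- s"] xb y(1) unfolding body_def by simp
  ultimately have wb: "w s \<in> body" unfolding body_def using s by simp
  define t where "t = 1 / (1 + s)"
  have ts: "t * (1 + s) = 1" unfolding t_def using s(1) by simp
  have t: "0 < t" "t < 1" unfolding t_def using s(1) by auto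
  have "x = (1 - t) *\<^sub>R y + t *\<^sub>R w s"
  proof -
    have "(1 - t) *\<^sub>R y + t *\<^sub>R w s = (t * (1 + s)) *\<^sub>R x + (1 - t * (1 + s)) *\<^sub>R y"
      unfolding w_def by (simp add: algebra_simps)
    then show ?thesis unfolding ts by simp
  qed
  moreover have "w s \<noteq> y"
  proof
    assume "w s = y"
    then have "(1 + s) *\<^sub>R (x - y) = 0" unfolding w_def by (simp add: algebra_simps)
    then show False using s(1) False by simp
  qed
  ultimately have "x \<in> open_segment y (w s)" using t unfolding in_segment by auto
  then show ?thesis using F x y(1) wb unfolding face_of_def by blast
qed (use x in simp)

text \<open>Treat the indices one by one: the midpoint with a point where the new inequality is
  slack makes it slack, and it makes no other inequality tight.\<close>

lemma exists_generic_point: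
  assumes C: "convex F" "F \<subseteq> body" "F \<noteq> {}"
  obtains x where "x \<in> F" "tight x = tight_on F"
proof -
  have "finite K \<Longrightarrow> K \<subseteq> I \<Longrightarrow> \<exists>x\<in>F. \<forall>i\<in>K. a i x = b i \<longrightarrow> (\<forall>z\<in>F. a i z = b i)" for K
  proof (induction K rule: finite_induct)
    case empty
    then show ?case using C by blast
  next
    case (insert j K)
    then obtain x where x: "x \<in> F" "\<forall>i\<in>K. a i x = b i \<longrightarrow> (\<forall>z\<in>F. a i z = b i)" by blast
    show ?case
    proof (cases "\<forall>z\<in>F. a j z = b j")
      case True
      then show ?thesis using x by blast
    next
      case False
      then obtain z where z: "z \<in> F" "a j z \<noteq> b j" by blast
      define m where "m = (1 - 1/2) *\<^sub>R x + (1/2::real) *\<^sub>R z"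
      have mF: "m \<in> F" 
        unfolding m_def using C(1)[unfolded convex_alt, rule_format, OF x(1) z(1), of "1/2"] by simp
      have "a i x = b i \<and> a i z = b i" if "i \<in> insert j K" "a i m = b i" for i
        using tight_segment[of x z "1/2" i] x(1) z(1) C(2) that insert.prems unfolding m_def by auto
      then have "\<forall>i\<in>insert j K. a i m = b i \<longrightarrow> (\<forall>z\<in>F. a i z = b i)" using x(2) z(2) by blast
      then show ?thesis using mF by blast
    qed
  qed
  from this[OF finite_I order_refl] obtain x
    where "x \<in> F" "\<forall>i\<in>I. a i x = b i \<longrightarrow> (\<forall>z\<in>F. a i z = b i)" by blast
  then show thesis using that[of x] unfolding tight_def tight_on_def by blast
qed

text \<open>A nonempty face is determined by the inequalities that are tight at a generic point of it.\<close>

lemma face_eq: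
  assumes F: "F face_of body" "F \<noteq> {}"
  shows "F = {y\<in>body. tight_on F \<subseteq> tight y}"
proof -
  obtain x where x: "x \<in> F" "tight x = tight_on F"
    using exists_generic_point[of F] F face_of_imp_convex face_of_imp_subset by metis
  show ?thesis
  proof
    show "F \<subseteq> {y\<in>body. tight_on F \<subseteq> tight y}"
      using F(1) face_of_imp_subset unfolding tight_on_def tight_def by blast
    show "{y\<in>body. tight_on F \<subseteq> tight y} \<subseteq> F"
      using face_contains_tighter[OF F(1) x(1)] x(2) by auto
  qed
qed

text \<open>By \<open>face_eq\<close> a nonempty face is recovered from its tight indices;
  conversely the tight set of a point is that of the smallest face through the point.\<close>

lemma face_poset_tight: "face_poset body (tight ` body)"
  unfolding face_poset_def
proof (intro exI[of _ tight_on] conjI allI impI)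
  have order: "F' \<subseteq> F \<longleftrightarrow> tight_on F \<subseteq> tight_on F'"
    if F: "F face_of body" "F \<noteq> {}" "F' face_of body" "F' \<noteq> {}" for F F'
  proof
    show "tight_on F \<subseteq> tight_on F'" if "F' \<subseteq> F" using that unfolding tight_on_def by blast
    show "F' \<subseteq> F" if "tight_on F \<subseteq> tight_on F'"
      using that face_eq[OF F(1,2)] face_eq[OF F(3,4)] by blast
  qed
  show "F' \<subseteq> F \<longleftrightarrow> tight_on F \<subseteq> tight_on F'"
    if "F face_of body \<and> F \<noteq> {} \<and> F' face_of body \<and> F' \<noteq> {}" for F F'
    using order[of F F'] that by simp
  show "bij_betw tight_on {F. F face_of body \<and> F \<noteq> {}} (tight ` body)"
  proof (rule bij_betwI')
    fix F F' assume "F \<in> {F. F face_of body \<and> F \<noteq> {}}" "F' \<in> {F. F face_of body \<and> F \<noteq> {}}"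
    then have F: "F face_of body" "F \<noteq> {}" "F' face_of body" "F' \<noteq> {}" by auto
    show "tight_on F = tight_on F' \<longleftrightarrow> F = F'"
      using order[OF F] order[OF F(3,4,1,2)] by auto
  next
    fix F assume "F \<in> {F. F face_of body \<and> F \<noteq> {}}"
    then have F: "F face_of body" "F \<noteq> {}" by auto
    obtain x where "x \<in> F" "tight x = tight_on F"
      using exists_generic_point[of F] F face_of_imp_convex face_of_imp_subset by metis
    moreover have "x \<in> body" if "x \<in> F" for x using that F face_of_imp_subset by blast
    ultimately show "tight_on F \<in> tight ` body" by (metis imageI)
  next
    fix K assume "K \<in> tight ` body"
    then obtain x where x: "x \<in> body" "K = tight x" by blast
    let ?F = "{y\<in>body. tight x \<subseteq> tight y}"
    have xF: "x \<in> ?F" using x(1) by simp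
    have "tight_on ?F = tight x" using xF unfolding tight_on_def tight_def by blast
    then show "\<exists>F\<in>{F. F face_of body \<and> F \<noteq> {}}. K = tight_on F"
      using face_of_tight[of "tight x"] xF x(2) by blast
  qed
qed

text \<open>A convex combination attains a bound exactly when all points with positive coefficient
  attain it. Hence the family of tight sets is computed from the incidences of the generating
  points.\<close>

lemma tight_convex_hull:
  assumes J: "finite J" and v: "v ` J \<subseteq> body" and hull: "body = convex hull (v ` J)"
  shows "tight ` body = {\<Inter>j\<in>K. tight (v j) | K. K \<subseteq> J \<and> K \<noteq> {}}"
proof (intro subset_antisym subsetI)
  fix X assume "X \<in> tight ` body"
  then obtain x where x: "x \<in> body" "X = tight x" by blast
  have "finite (v ` J)" using J by simp
  then obtain u where u: "\<forall>z\<in>v ` J. 0 \<le> u z" "sum u (v ` J) = 1" "(\<Sum>z\<in>v ` J. u z *\<^sub>R z) = x"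
    using x(1) unfolding hull by (auto simp: convex_hull_finite)
  \<comment> \<open>The coefficients belong to points and \<open>v\<close> may repeat points, so
    \<open>K\<close> collects every index of a point with positive coefficient.\<close>
  define K where "K = {j\<in>J. 0 < u (v j)}"
  have KJ: "K \<subseteq> J" unfolding K_def by blast
  have Kne: "K \<noteq> {}"
  proof
    assume "K = {}"
    then have "sum u (v ` J) = 0" using u(1) unfolding K_def by (intro sum.neutral) force
    then show False using u(2) by simp
  qed
  have iff: "a i x = b i \<longleftrightarrow> (\<forall>j\<in>K. a i (v j) = b i)" if i: "i \<in> I" for i
  proof -
    have ax: "a i x = (\<Sum>z\<in>v ` J. u z * a i z)"
      unfolding u(3)[symmetric] by (simp add: linear_sum[OF linear_a[OF i]] linear_scale[OF linear_a[OF i]])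
    have "b i - a i x = (\<Sum>z\<in>v ` J. u z * (b i - a i z))"
      unfolding ax right_diff_distrib sum_subtractf sum_distrib_right[symmetric] u(2) by simp
    moreover have nn: "0 \<le> u z * (b i - a i z)" if "z \<in> v ` J" for z
    proof -
      have "a i z \<le> b i" using v that i unfolding body_def by auto
      moreover have "0 \<le> u z" using u(1) that by blast
      ultimately show ?thesis by simp
    qed
    ultimately have "a i x = b i \<longleftrightarrow> (\<forall>z\<in>v ` J. u z * (b i - a i z) = 0)"
      using sum_nonneg_eq_0_iff[of "v ` J" "\<lambda>z. u z * (b i - a i z)"] J by auto
    also have "\<dots> \<longleftrightarrow> (\<forall>j\<in>K. a i (v j) = b i)"
      unfolding K_def using u(1) by force
    finally show ?thesis .
  qed
  have "tight x = (\<Inter>j\<in>K. tight (v j))"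
    unfolding tight_def using iff Kne by auto
  then show "X \<in> {\<Inter>j\<in>K. tight (v j) | K. K \<subseteq> J \<and> K \<noteq> {}}" using x(2) KJ Kne by blast
next
  fix X assume "X \<in> {\<Inter>j\<in>K. tight (v j) | K. K \<subseteq> J \<and> K \<noteq> {}}"
  then obtain K where K: "K \<subseteq> J" "K \<noteq> {}" "X = (\<Inter>j\<in>K. tight (v j))" by blast
  let ?F = "convex hull (v ` K)"
  have F: "convex ?F" "?F \<subseteq> body" "?F \<noteq> {}"
    using hull_mono[of "v ` K" "v ` J" convex] K unfolding hull by auto
  then obtain x where x: "x \<in> ?F" "tight x = tight_on ?F" using exists_generic_point by metis
  have "tight_on ?F = (\<Inter>j\<in>K. tight (v j))"
  proof
    show "tight_on ?F \<subseteq> (\<Inter>j\<in>K. tight (v j))"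
      unfolding tight_on_def tight_def using hull_subset[of "v ` K" convex] by blast
    show "(\<Inter>j\<in>K. tight (v j)) \<subseteq> tight_on ?F"
    proof
      fix i assume i: "i \<in> (\<Inter>j\<in>K. tight (v j))"
      then have iI: "i \<in> I" and eq: "\<forall>j\<in>K. a i (v j) = b i" using K(2) unfolding tight_def by auto
      have "convex {z. a i z = b i}" unfolding convex_alt
        by (simp add: linear_convex_diff[OF linear_a[OF iI]] left_diff_distrib)
      moreover have "v ` K \<subseteq> {z. a i z = b i}" using eq by blast
      ultimately have "?F \<subseteq> {z. a i z = b i}" by (simp add: hull_minimal)
      then show "i \<in> tight_on ?F" unfolding tight_on_def using iI by blast
    qed
  qed
  then show "X \<in> tight ` body" using x F K(3) by blast
qed

end

text \<open>Injectivity is assumed on \<open>S\<close> only, because the map that assembles the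
  facet from its factors is injective on the relevant product of subspaces and not on the whole
  product space.\<close>

lemma face_of_image_inj_on:
  assumes f: "linear f" "inj_on f S" and S: "convex S" and F: "F \<subseteq> S"
  shows "f ` F face_of f ` S \<longleftrightarrow> F face_of S"
proof -
  have seg: "f x \<in> open_segment (f y) (f z) \<longleftrightarrow> x \<in> open_segment y z" if xyz: "x \<in> S" "y \<in> S" "z \<in> S" for x y z
  proof -
    have "f x = (1 - t) *\<^sub>R f y + t *\<^sub>R f z \<longleftrightarrow> x = (1 - t) *\<^sub>R y + t *\<^sub>R z" if "0 < t" "t < 1" for t
    proof -
      have "(1 - t) *\<^sub>R y + t *\<^sub>R z \<in> S" using S xyz that unfolding convex_alt by auto
      moreover have "f ((1 - t) *\<^sub>R y + t *\<^sub>R z) = (1 - t) *\<^sub>R f y + t *\<^sub>R f z"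
        by (simp add: linear_add linear_scale f)
      ultimately show ?thesis using f(2) xyz(1) by (metis inj_onD)
    qed
    moreover have "f y \<noteq> f z \<longleftrightarrow> y \<noteq> z" using f(2) xyz by (metis inj_onD)
    ultimately show ?thesis unfolding in_segment by blast
  qed
  have memF: "f x \<in> f ` F \<longleftrightarrow> x \<in> F" if "x \<in> S" for x
    using that f(2) F by (meson inj_on_image_mem_iff)
  have conv: "convex (f ` F) \<longleftrightarrow> convex F"
  proof
    assume c: "convex (f ` F)"
    show "convex F" unfolding convex_alt
    proof (intro ballI allI impI)
      fix x y and t :: real assume xy: "x \<in> F" "y \<in> F" and t: "0 \<le> t \<and> t \<le> 1"
      have "f ((1 - t) *\<^sub>R x + t *\<^sub>R y) \<in> f ` F"
        using c xy t unfolding convex_alt by (simp add: linear_add linear_scale f)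
      moreover have "(1 - t) *\<^sub>R x + t *\<^sub>R y \<in> S" using S xy t F unfolding convex_alt by blast
      ultimately show "(1 - t) *\<^sub>R x + t *\<^sub>R y \<in> F" using memF by blast
    qed
  qed (use f convex_linear_image in blast)
  have sub: "f ` F \<subseteq> f ` S \<longleftrightarrow> F \<subseteq> S" using F by blast
  have "(\<forall>y\<in>f ` S. \<forall>z\<in>f ` S. \<forall>x\<in>f ` F. x \<in> open_segment y z \<longrightarrow> y \<in> f ` F \<and> z \<in> f ` F)
     \<longleftrightarrow> (\<forall>y\<in>S. \<forall>z\<in>S. \<forall>x\<in>F. x \<in> open_segment y z \<longrightarrow> y \<in> F \<and> z \<in> F)"
    using seg memF F by (simp add: subset_iff)
  then show ?thesis unfolding face_of_def conv sub by blast
qed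

lemma combinatorially_equivalent_linear_image:
  assumes f: "linear f" "inj_on f S" and S: "convex S"
  shows "combinatorially_equivalent (f ` S) S"
proof -
  have sub: "F \<subseteq> S" if "F face_of S" for F using that face_of_imp_subset by blast
  have bij: "bij_betw (image f) {F. F face_of S} {F. F face_of f ` S}"
  proof (rule bij_betwI')
    fix F F' assume "F \<in> {F. F face_of S}" "F' \<in> {F. F face_of S}"
    then show "f ` F = f ` F' \<longleftrightarrow> F = F'" using inj_on_image_eq_iff[OF f(2) sub sub] by simp
  next
    fix F assume "F \<in> {F. F face_of S}"
    then show "f ` F \<in> {F. F face_of f ` S}" using face_of_image_inj_on[OF f S] sub by blast
  next
    fix F assume "F \<in> {F. F face_of f ` S}"
    then have F: "F face_of f ` S" by simp
    then obtain X where "X \<subseteq> S" "F = f ` X" by (meson face_of_imp_subset subset_imageE)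
    then show "\<exists>X\<in>{F. F face_of S}. F = f ` X" using F face_of_image_inj_on[OF f S] by blast
  qed
  define g where "g = inv_into {F. F face_of S} (image f)"
  have g: "bij_betw g {F. F face_of f ` S} {F. F face_of S}"
    unfolding g_def by (rule bij_betw_inv_into[OF bij])
  have fg: "f ` g F = F" if "F face_of f ` S" for F
    unfolding g_def using bij_betw_inv_into_right[OF bij] that by simp
  have gm: "g F face_of S" if "F face_of f ` S" for F using bij_betwE[OF g] that by blast
  have "F \<subseteq> F' \<longleftrightarrow> g F \<subseteq> g F'" if F: "F face_of f ` S" "F' face_of f ` S" for F F'
    using inj_on_image_subset_iff[OF f(2) sub[OF gm[OF F(1)]] sub[OF gm[OF F(2)]]] fg F by simp
  then show ?thesis unfolding combinatorially_equivalent_def using g by (intro exI[of _ g]) simp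
qed

section \<open>Root systems and dominance\<close>

lemma linear_reflect: "linear (reflect \<alpha>)"
  by (rule linearI) (auto simp: reflect_def inner_add_left algebra_simps add_divide_distrib)

lemma reflect_self: "\<alpha> \<noteq> 0 \<Longrightarrow> reflect \<alpha> \<alpha> = - \<alpha>"
  by (simp add: reflect_def scaleR_2)

lemma reflect_minus: "reflect (- \<alpha>) = reflect \<alpha>"
  by (simp add: reflect_def fun_eq_iff)

lemma reflect_fixes: "x \<bullet> \<alpha> = 0 \<Longrightarrow> reflect \<alpha> x = x"
  by (simp add: reflect_def)

lemma inner_reflect:
  assumes "\<alpha> \<noteq> 0" shows "reflect \<alpha> x \<bullet> reflect \<alpha> y = x \<bullet> y"
proof -
  define k where "k z = 2 * (z \<bullet> \<alpha>) / (\<alpha> \<bullet> \<alpha>)" for z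
  have k: "k z * (\<alpha> \<bullet> \<alpha>) = 2 * (z \<bullet> \<alpha>)" for z unfolding k_def using assms by simp
  have "reflect \<alpha> x \<bullet> reflect \<alpha> y = x \<bullet> y - k y * (x \<bullet> \<alpha>) - k x * (y \<bullet> \<alpha>) + k x * (k y * (\<alpha> \<bullet> \<alpha>))"
    unfolding reflect_def k_def[symmetric]
    by (simp add: inner_diff_left inner_diff_right inner_commute algebra_simps)
  also have "k x * (k y * (\<alpha> \<bullet> \<alpha>)) = k x * (y \<bullet> \<alpha>) + k y * (x \<bullet> \<alpha>)"
    using k[of x] k[of y] by algebra
  finally show ?thesis by simp
qed

lemma reflect_reflect:
  assumes "\<alpha> \<noteq> 0" shows "reflect \<alpha> (reflect \<alpha> x) = x"
  using assms by (simp add: reflect_def inner_diff_left algebra_simps)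

lemma reflect_adjoint:
  assumes "\<alpha> \<noteq> 0" shows "reflect \<alpha> x \<bullet> y = x \<bullet> reflect \<alpha> y"
  using inner_reflect[OF assms, of x "reflect \<alpha> y"] reflect_reflect[OF assms] by simp

lemma reflect_conjugate:
  assumes "linear u" "\<And>x y. u x \<bullet> u y = x \<bullet> y"
  shows "u (reflect \<alpha> x) = reflect (u \<alpha>) (u x)"
  using assms by (simp add: reflect_def linear_diff linear_scale)

lemma nonneg_comb_add:
  assumes "nonneg_comb \<Delta> x" "nonneg_comb \<Delta> y" shows "nonneg_comb \<Delta> (x + y)"
proof -
  obtain c d where "\<forall>\<alpha>\<in>\<Delta>. 0 \<le> c \<alpha>" "x = (\<Sum>\<alpha>\<in>\<Delta>. c \<alpha> *\<^sub>R \<alpha>)"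
    "\<forall>\<alpha>\<in>\<Delta>. 0 \<le> d \<alpha>" "y = (\<Sum>\<alpha>\<in>\<Delta>. d \<alpha> *\<^sub>R \<alpha>)"
    using assms unfolding nonneg_comb_def by blast
  then show ?thesis unfolding nonneg_comb_def
    by (intro exI[of _ "\<lambda>\<alpha>. c \<alpha> + d \<alpha>"]) (simp add: scaleR_add_left sum.distrib)
qed

lemma nonneg_comb_scale:
  assumes "nonneg_comb \<Delta> x" "0 \<le> t" shows "nonneg_comb \<Delta> (t *\<^sub>R x)"
proof -
  obtain c where "\<forall>\<alpha>\<in>\<Delta>. 0 \<le> c \<alpha>" "x = (\<Sum>\<alpha>\<in>\<Delta>. c \<alpha> *\<^sub>R \<alpha>)"
    using assms unfolding nonneg_comb_def by blast
  then show ?thesis unfolding nonneg_comb_def using assms(2)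
    by (intro exI[of _ "\<lambda>\<alpha>. t * c \<alpha>"]) (simp add: scaleR_sum_right)
qed

lemma nonneg_comb_0: "nonneg_comb \<Delta> 0"
  unfolding nonneg_comb_def by (intro exI[of _ "\<lambda>_. 0"]) simp

lemma nonneg_comb_sum:
  "(\<And>i. i \<in> I \<Longrightarrow> nonneg_comb \<Delta> (f i)) \<Longrightarrow> nonneg_comb \<Delta> (\<Sum>i\<in>I. f i)"
  by (induction I rule: infinite_finite_induct) (auto intro: nonneg_comb_add nonneg_comb_0)

lemma nonneg_comb_inner:
  assumes "nonneg_comb \<Delta> v" "\<And>\<alpha>. \<alpha> \<in> \<Delta> \<Longrightarrow> 0 \<le> x \<bullet> \<alpha>" shows "0 \<le> x \<bullet> v"
  using assms unfolding nonneg_comb_def by (auto simp: inner_sum_right intro!: sum_nonneg)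

locale root_basis =
  fixes \<Phi> \<Delta> :: "'a::euclidean_space set"
  assumes root_system: "root_system \<Phi>" and simple_roots: "simple_roots \<Phi> \<Delta>"
begin

abbreviation "W \<equiv> reflection_group \<Phi>"
abbreviation "coef \<equiv> representation \<Delta>"
abbreviation "dominant x \<equiv> (\<forall>\<alpha>\<in>\<Delta>. 0 \<le> x \<bullet> \<alpha>)"

lemma finite_roots: "finite \<Phi>" and zero_root: "0 \<notin> \<Phi>"
  using root_system unfolding root_system_def by auto

lemma root_nonzero: "\<alpha> \<in> \<Phi> \<Longrightarrow> \<alpha> \<noteq> 0"
  using zero_root by blast

lemma reflect_root: "\<alpha> \<in> \<Phi> \<Longrightarrow> \<beta> \<in> \<Phi> \<Longrightarrow> reflect \<alpha> \<beta> \<in> \<Phi>"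
  using root_system unfolding root_system_def by blast

lemma root_line: "\<alpha> \<in> \<Phi> \<Longrightarrow> \<beta> \<in> \<Phi> \<Longrightarrow> \<beta> \<in> span {\<alpha>} \<Longrightarrow> \<beta> = \<alpha> \<or> \<beta> = - \<alpha>"
  using root_system unfolding root_system_def by blast

lemma minus_root: "\<alpha> \<in> \<Phi> \<Longrightarrow> - \<alpha> \<in> \<Phi>"
  using reflect_root[of \<alpha> \<alpha>] reflect_self[OF root_nonzero] by simp

lemma simple_sub: "\<Delta> \<subseteq> \<Phi>" and indep: "independent \<Delta>"
  using simple_roots unfolding simple_roots_def by auto

lemma finite_simple: "finite \<Delta>"
  using simple_sub finite_roots finite_subset by blast

lemma simple_nonzero: "\<alpha> \<in> \<Delta> \<Longrightarrow> \<alpha> \<noteq> 0"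
  using simple_sub root_nonzero by blast

lemma root_sign: "\<beta> \<in> \<Phi> \<Longrightarrow> nonneg_comb \<Delta> \<beta> \<or> nonneg_comb \<Delta> (- \<beta>)"
  using simple_roots unfolding simple_roots_def by blast

lemma coef_comb:
  assumes "\<alpha> \<in> \<Delta>" shows "coef (\<Sum>\<beta>\<in>\<Delta>. c \<beta> *\<^sub>R \<beta>) \<alpha> = c \<alpha>"
proof -
  have "coef (\<Sum>\<beta>\<in>\<Delta>. c \<beta> *\<^sub>R \<beta>) = (\<lambda>\<beta>. if \<beta> \<in> \<Delta> then c \<beta> else 0)"
    by (rule representation_eqI[OF indep])
      (use finite_simple in \<open>auto intro: span_sum span_scale span_base sum.mono_neutral_cong_left split: if_splits\<close>)
  then show ?thesis using assms by simp
qed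

lemma coef_expand: "v \<in> span \<Delta> \<Longrightarrow> v = (\<Sum>\<alpha>\<in>\<Delta>. coef v \<alpha> *\<^sub>R \<alpha>)"
  using sum_representation_eq[OF indep _ finite_simple order_refl, of v] by simp

lemma nonneg_comb_span: "nonneg_comb \<Delta> v \<Longrightarrow> v \<in> span \<Delta>"
  unfolding nonneg_comb_def by (auto intro: span_sum span_scale span_base)

lemma nonneg_comb_iff: "nonneg_comb \<Delta> v \<longleftrightarrow> v \<in> span \<Delta> \<and> (\<forall>\<alpha>\<in>\<Delta>. 0 \<le> coef v \<alpha>)"
proof
  show "v \<in> span \<Delta> \<and> (\<forall>\<alpha>\<in>\<Delta>. 0 \<le> coef v \<alpha>)" if "nonneg_comb \<Delta> v"
    using nonneg_comb_span[OF that] that coef_comb unfolding nonneg_comb_def by auto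
  show "nonneg_comb \<Delta> v" if "v \<in> span \<Delta> \<and> (\<forall>\<alpha>\<in>\<Delta>. 0 \<le> coef v \<alpha>)"
    unfolding nonneg_comb_def using that coef_expand by blast
qed

lemma span_simple: "span \<Delta> = span \<Phi>"
proof
  show "span \<Delta> \<subseteq> span \<Phi>" using simple_sub by (rule span_mono)
  have "\<Phi> \<subseteq> span \<Delta>"
  proof
    fix \<beta> assume "\<beta> \<in> \<Phi>"
    then have "\<beta> \<in> span \<Delta> \<or> - \<beta> \<in> span \<Delta>" using root_sign nonneg_comb_span by blast
    then show "\<beta> \<in> span \<Delta>" using span_neg[of "- \<beta>" \<Delta>] by auto
  qed
  then show "span \<Phi> \<subseteq> span \<Delta>" by (simp add: span_minimal)
qed

lemma root_span: "\<beta> \<in> \<Phi> \<Longrightarrow> \<beta> \<in> span \<Delta>"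
  unfolding span_simple by (rule span_base)

lemma coef_simple: "\<alpha> \<in> \<Delta> \<Longrightarrow> \<beta> \<in> \<Delta> \<Longrightarrow> coef \<alpha> \<beta> = (if \<alpha> = \<beta> then 1 else 0)"
  using representation_basis[OF indep, of \<alpha>] by auto

lemma coef_diff: "u \<in> span \<Delta> \<Longrightarrow> v \<in> span \<Delta> \<Longrightarrow> coef (u - v) \<alpha> = coef u \<alpha> - coef v \<alpha>"
  using representation_diff[OF indep, of v u] by simp

lemma coef_scale: "v \<in> span \<Delta> \<Longrightarrow> coef (t *\<^sub>R v) \<alpha> = t * coef v \<alpha>"
  using representation_scale[OF indep, of v t] by simp

lemma coef_minus: "v \<in> span \<Delta> \<Longrightarrow> coef (- v) \<alpha> = - coef v \<alpha>"
  using representation_neg[OF indep, of v] by simp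

lemma coef_reflect:
  assumes "v \<in> span \<Delta>" "\<alpha> \<in> \<Delta>" "\<gamma> \<in> \<Delta>" "\<gamma> \<noteq> \<alpha>"
  shows "coef (reflect \<alpha> v) \<gamma> = coef v \<gamma>"
proof -
  have "coef (reflect \<alpha> v) \<gamma> = coef v \<gamma> - (2 * (v \<bullet> \<alpha>) / (\<alpha> \<bullet> \<alpha>)) * coef \<alpha> \<gamma>"
    unfolding reflect_def using assms
    by (subst coef_diff) (auto intro: span_scale span_base simp: coef_scale span_base)
  then show ?thesis using assms coef_simple[of \<alpha> \<gamma>] by simp
qed

lemma not_both_signs:
  assumes "nonneg_comb \<Delta> v" "nonneg_comb \<Delta> (- v)" shows "v = 0"
proof -
  have v: "v \<in> span \<Delta>" using assms(1) nonneg_comb_span by blast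
  have "coef v \<alpha> = 0" if "\<alpha> \<in> \<Delta>" for \<alpha>
    using assms that coef_minus[OF v] unfolding nonneg_comb_iff by force
  then show ?thesis using coef_expand[OF v] by simp
qed

lemma coef_pos_of_root:
  assumes \<beta>: "\<beta> \<in> \<Phi>" and "\<gamma> \<in> \<Delta>" "0 < coef \<beta> \<gamma>" shows "nonneg_comb \<Delta> \<beta>"
  using root_sign[OF \<beta>] assms coef_minus[OF root_span[OF \<beta>]] unfolding nonneg_comb_iff
  by (smt (verit, best))

text \<open>A positive root other than \<alpha> has a positive coefficient at another simple root.
  The reflection keeps this coefficient, and a root with one positive coefficient is
  positive.\<close>

lemma reflect_simple_positive:
  assumes \<alpha>: "\<alpha> \<in> \<Delta>" and \<beta>: "\<beta> \<in> \<Phi>" "nonneg_comb \<Delta> \<beta>" "\<beta> \<noteq> \<alpha>"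
  shows "nonneg_comb \<Delta> (reflect \<alpha> \<beta>)"
proof -
  note bs = root_span[OF \<beta>(1)]
  have "\<exists>\<gamma>\<in>\<Delta> - {\<alpha>}. coef \<beta> \<gamma> \<noteq> 0"
  proof (rule ccontr)
    assume "\<not> ?thesis"
    then have "(\<Sum>\<gamma>\<in>\<Delta> - {\<alpha>}. coef \<beta> \<gamma> *\<^sub>R \<gamma>) = 0" by (intro sum.neutral) auto
    then have "\<beta> = coef \<beta> \<alpha> *\<^sub>R \<alpha>"
      using coef_expand[OF bs] sum.remove[OF finite_simple \<alpha>, of "\<lambda>\<gamma>. coef \<beta> \<gamma> *\<^sub>R \<gamma>"] by simp
    then have "\<beta> \<in> span {\<alpha>}" by (metis insertI1 span_base span_scale)
    then have "\<beta> = - \<alpha>" using root_line \<alpha> \<beta> simple_sub by blast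
    then have "nonneg_comb \<Delta> (- \<alpha>)" using \<beta> by simp
    moreover have "nonneg_comb \<Delta> \<alpha>"
      unfolding nonneg_comb_iff using \<alpha> by (auto simp: span_base coef_simple)
    ultimately show False using not_both_signs simple_nonzero[OF \<alpha>] by blast
  qed
  then obtain \<gamma> where \<gamma>: "\<gamma> \<in> \<Delta>" "\<gamma> \<noteq> \<alpha>" "coef \<beta> \<gamma> \<noteq> 0" by blast
  then have "0 < coef \<beta> \<gamma>" using \<beta>(2) unfolding nonneg_comb_iff by force
  then have "0 < coef (reflect \<alpha> \<beta>) \<gamma>" using coef_reflect[OF bs \<alpha>] \<gamma> by simp
  then show ?thesis using coef_pos_of_root[OF reflect_root \<gamma>(1)] \<alpha> \<beta>(1) simple_sub by blast
qed

lemma simple_nonneg: "\<alpha> \<in> \<Delta> \<Longrightarrow> nonneg_comb \<Delta> \<alpha>"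
  unfolding nonneg_comb_iff by (auto simp: span_base coef_simple)

text \<open>With a positive inner product the positive root \<open>reflect \<alpha> \<beta>\<close>
  would have a negative coefficient at \<alpha>.\<close>

lemma simple_obtuse:
  assumes "\<alpha> \<in> \<Delta>" "\<beta> \<in> \<Delta>" "\<alpha> \<noteq> \<beta>" shows "\<alpha> \<bullet> \<beta> \<le> 0"
proof (rule ccontr)
  assume pos: "\<not> \<alpha> \<bullet> \<beta> \<le> 0"
  have n: "nonneg_comb \<Delta> (reflect \<alpha> \<beta>)"
    using reflect_simple_positive simple_nonneg assms simple_sub by blast
  have "coef (reflect \<alpha> \<beta>) \<alpha> = coef \<beta> \<alpha> - (2 * (\<beta> \<bullet> \<alpha>) / (\<alpha> \<bullet> \<alpha>)) * coef \<alpha> \<alpha>"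
    unfolding reflect_def using assms
    by (subst coef_diff) (auto intro: span_scale span_base simp: coef_scale span_base)
  also have "\<dots> = - (2 * (\<beta> \<bullet> \<alpha>) / (\<alpha> \<bullet> \<alpha>))" using assms by (simp add: coef_simple)
  also have "\<dots> < 0" using pos simple_nonzero[OF assms(1)] by (simp add: inner_commute)
  finally show False using n assms(1) unfolding nonneg_comb_iff by force
qed

lemma group_props:
  assumes "w \<in> W"
  shows "linear w" and "w x \<bullet> w y = x \<bullet> y" and "\<beta> \<in> \<Phi> \<Longrightarrow> w \<beta> \<in> \<Phi>"
    and "(\<forall>\<alpha>\<in>\<Phi>. z \<bullet> \<alpha> = 0) \<Longrightarrow> w z = z"
  using assms
proof (induction arbitrary: x y \<beta> z)
  case id
  { case 1 show ?case by (rule linear_id) next case 2 then show ?case by simp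
    next case 3 then show ?case by simp next case 4 then show ?case by simp }
next
  case (reflect w \<alpha>)
  { case 1 then show ?case using reflect linear_compose linear_reflect by blast
    next case 2 then show ?case using reflect inner_reflect[OF root_nonzero] by simp
    next case 3 then show ?case using reflect reflect_root by simp
    next case 4 then show ?case using reflect reflect_fixes by (metis comp_apply) }
qed

lemma group_comp: "w \<in> W \<Longrightarrow> u \<in> W \<Longrightarrow> w \<circ> u \<in> W"
  by (induction rule: reflection_group.induct)
    (auto simp: comp_assoc intro: reflection_group.reflect)

lemma reflect_in_group: "\<alpha> \<in> \<Phi> \<Longrightarrow> reflect \<alpha> \<in> W"
  using reflection_group.reflect[OF reflection_group.id, of \<alpha> \<Phi>] by simp

lemma group_inverse: "w \<in> W \<Longrightarrow> \<exists>u\<in>W. (\<forall>x. u (w x) = x) \<and> (\<forall>x. w (u x) = x)"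
proof (induction rule: reflection_group.induct)
  case id
  show ?case using reflection_group.id[of \<Phi>] by (intro bexI[of _ id]) auto
next
  case (reflect w \<alpha>)
  then obtain u where u: "u \<in> W" "\<forall>x. u (w x) = x" "\<forall>x. w (u x) = x" by blast
  show ?case
    by (intro bexI[of _ "u \<circ> reflect \<alpha>"])
      (use u group_comp reflect_in_group[OF reflect(2)] reflect_reflect[OF root_nonzero[OF reflect(2)]] in auto)
qed

lemma group_span: "w \<in> W \<Longrightarrow> x \<in> span \<Phi> \<Longrightarrow> w x \<in> span \<Phi>"
  using linear_span_image[OF group_props(1), of w \<Phi>] group_props(3)[of w] span_mono[of "w ` \<Phi>" \<Phi>]
  by blast

lemma group_injective: "w \<in> W \<Longrightarrow> inj w"
  using group_inverse[of w] by (metis injI)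

text \<open>An element fixes the orthogonal complement of the roots, so it is determined by its
  action on the finite set of roots.\<close>

lemma finite_group: "finite W"
proof -
  have "inj_on (\<lambda>w. restrict w \<Phi>) W"
  proof (rule inj_onI)
    fix w u assume w: "w \<in> W" and u: "u \<in> W" and eq: "restrict w \<Phi> = restrict u \<Phi>"
    show "w = u"
    proof
      fix x
      obtain p q where pq: "p \<in> span \<Phi>" "\<And>v. v \<in> span \<Phi> \<Longrightarrow> orthogonal q v" "x = p + q"
        using orthogonal_subspace_decomp_exists[of \<Phi> x] by metis
      have "w \<beta> = u \<beta>" if "\<beta> \<in> \<Phi>" for \<beta> using fun_cong[OF eq, of \<beta>] that by simp
      then have "w p = u p"
        using linear_eq_on_span[OF group_props(1)[OF w] group_props(1)[OF u]] pq(1) by blast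
      moreover have "\<forall>\<alpha>\<in>\<Phi>. q \<bullet> \<alpha> = 0" using pq(2) span_base unfolding orthogonal_def by blast
      ultimately show "w x = u x"
        using group_props(4)[OF w] group_props(4)[OF u] pq(3)
        by (simp add: linear_add group_props(1)[OF w] group_props(1)[OF u])
    qed
  qed
  moreover have "(\<lambda>w. restrict w \<Phi>) ` W \<subseteq> \<Phi> \<rightarrow>\<^sub>E \<Phi>" using group_props(3) by auto
  moreover have "finite (\<Phi> \<rightarrow>\<^sub>E \<Phi>)" using finite_roots by (simp add: finite_PiE)
  ultimately show ?thesis using finite_imageD finite_subset by metis
qed

section \<open>Words in simple reflections and the exchange condition\<close>

primrec words :: "nat \<Rightarrow> ('a \<Rightarrow> 'a) set" where
  "words 0 = {id}"
| "words (Suc n) = {reflect \<alpha> \<circ> u | \<alpha> u. \<alpha> \<in> \<Delta> \<and> u \<in> words n}"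

lemma words_group: "u \<in> words n \<Longrightarrow> u \<in> W"
  using simple_sub by (induction n arbitrary: u) (auto intro: reflection_group.intros)

lemma words_Suc_right:
  "words (Suc n) = {u \<circ> reflect \<alpha> | \<alpha> u. \<alpha> \<in> \<Delta> \<and> u \<in> words n}"
proof (induction n)
  case (Suc n)
  have "words (Suc (Suc n)) = {reflect \<alpha> \<circ> (u \<circ> reflect \<beta>) | \<alpha> \<beta> u. \<alpha> \<in> \<Delta> \<and> \<beta> \<in> \<Delta> \<and> u \<in> words n}"
    unfolding words.simps(2)[of "Suc n"] Suc by blast
  also have "\<dots> = {(reflect \<alpha> \<circ> u) \<circ> reflect \<beta> | \<alpha> \<beta> u. \<alpha> \<in> \<Delta> \<and> \<beta> \<in> \<Delta> \<and> u \<in> words n}"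
    unfolding comp_assoc ..
  also have "\<dots> = {u \<circ> reflect \<alpha> | \<alpha> u. \<alpha> \<in> \<Delta> \<and> u \<in> words (Suc n)}"
    unfolding words.simps(2)[of n] by blast
  finally show ?case .
qed simp

lemma words_append: "u \<in> words m \<Longrightarrow> v \<in> words n \<Longrightarrow> u \<circ> v \<in> words (m + n)"
  by (induction m arbitrary: u) (auto simp: comp_assoc, metis comp_assoc)

text \<open>Follow \<alpha> through the letters of the word from the right. At the letter \<beta>
  where it first turns negative its image equals \<beta>, since a simple reflection changes the sign
  of no other positive root; that letter cancels against the appended reflection.\<close>

lemma words_exchange:
  "w \<in> words n \<Longrightarrow> \<alpha> \<in> \<Delta> \<Longrightarrow> nonneg_comb \<Delta> (- w \<alpha>) \<Longrightarrow> \<exists>m. n = Suc m \<and> w \<circ> reflect \<alpha> \<in> words m"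
proof (induction n arbitrary: w)
  case 0
  then show ?case using not_both_signs simple_nonneg simple_nonzero by auto
next
  case (Suc n)
  obtain \<beta> u where w: "w = reflect \<beta> \<circ> u" and \<beta>: "\<beta> \<in> \<Delta>" and u: "u \<in> words n"
    using Suc.prems(1) by auto
  note g = group_props[OF words_group[OF u]]
  have root: "u \<alpha> \<in> \<Phi>" using g(3) Suc.prems(2) simple_sub by blast
  show ?case
  proof (cases "nonneg_comb \<Delta> (- u \<alpha>)")
    case True
    obtain m where "n = Suc m" "u \<circ> reflect \<alpha> \<in> words m" using Suc.IH[OF u Suc.prems(2) True] by blast
    moreover from this have "reflect \<beta> \<circ> (u \<circ> reflect \<alpha>) \<in> words (Suc m)" using \<beta> by (simp only: words.simps) blast
    ultimately show ?thesis unfolding w comp_assoc by blast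
  next
    case False
    then have pos: "nonneg_comb \<Delta> (u \<alpha>)" using root_sign[OF root] by blast
    have "u \<alpha> = \<beta>"
    proof (rule ccontr)
      assume "u \<alpha> \<noteq> \<beta>"
      then have "nonneg_comb \<Delta> (w \<alpha>)" using reflect_simple_positive[OF \<beta> root pos] w by simp
      then have "w \<alpha> = 0" using not_both_signs Suc.prems(3) by blast
      moreover have "w \<alpha> \<in> \<Phi>" unfolding w using reflect_root root \<beta> simple_sub by auto
      ultimately show False using zero_root by simp
    qed
    then have "w \<circ> reflect \<alpha> = u"
      by (rule_tac ext) (simp add: w reflect_conjugate[OF g(1,2)] reflect_reflect[OF simple_nonzero[OF \<beta>]])
    then show ?thesis using u by simp
  qed
qed

text \<open>Take a counterexample \<gamma> of least height. Some simple \<alpha> has positive inner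
  product with it, as otherwise \<open>\<gamma> \<bullet> \<gamma> \<le> 0\<close>; reflecting by
  \<alpha> lowers the height, and the reflection in \<gamma> is conjugate by
  \<open>reflect \<alpha>\<close> to that in the lower root.\<close>

lemma reflect_words:
  assumes "\<beta> \<in> \<Phi>" "nonneg_comb \<Delta> \<beta>" shows "\<exists>n. reflect \<beta> \<in> words n"
proof (rule ccontr)
  define height where "height v = (\<Sum>\<alpha>\<in>\<Delta>. coef v \<alpha>)" for v
  define Bad where "Bad = {\<beta>\<in>\<Phi>. nonneg_comb \<Delta> \<beta> \<and> \<not> (\<exists>n. reflect \<beta> \<in> words n)}"
  assume "\<not> ?thesis"
  then have "Bad \<noteq> {}" "finite Bad" unfolding Bad_def using assms finite_roots by auto
  then obtain \<gamma> where \<gamma>: "\<gamma> \<in> Bad" and min: "\<And>\<delta>. \<delta> \<in> Bad \<Longrightarrow> height \<gamma> \<le> height \<delta>"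
    using ex_min_if_finite[of "height ` Bad"] by (metis (no_types, lifting) finite_imageI image_iff image_is_empty not_le)
  have \<gamma>': "\<gamma> \<in> \<Phi>" "nonneg_comb \<Delta> \<gamma>" using \<gamma> unfolding Bad_def by auto
  have "\<exists>\<alpha>\<in>\<Delta>. 0 < \<gamma> \<bullet> \<alpha>"
  proof (rule ccontr)
    assume "\<not> ?thesis"
    then have "0 \<le> (- \<gamma>) \<bullet> \<gamma>" by (intro nonneg_comb_inner[OF \<gamma>'(2)]) (simp add: not_less)
    moreover have "0 < \<gamma> \<bullet> \<gamma>" using root_nonzero[OF \<gamma>'(1)] by simp
    ultimately show False by simp
  qed
  then obtain \<alpha> where \<alpha>: "\<alpha> \<in> \<Delta>" "0 < \<gamma> \<bullet> \<alpha>" by blast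
  have single: "reflect \<alpha> \<in> words 1" using \<alpha> by auto
  have "\<gamma> \<noteq> \<alpha>" using \<gamma> single unfolding Bad_def by blast
  define \<delta> where "\<delta> = reflect \<alpha> \<gamma>"
  have \<delta>: "\<delta> \<in> \<Phi>" "nonneg_comb \<Delta> \<delta>"
    unfolding \<delta>_def using reflect_root reflect_simple_positive[OF \<alpha>(1) \<gamma>' \<open>\<gamma> \<noteq> \<alpha>\<close>] \<alpha> \<gamma>' simple_sub by blast+
  have "height \<delta> = height \<gamma> - 2 * (\<gamma> \<bullet> \<alpha>) / (\<alpha> \<bullet> \<alpha>)"
  proof -
    have c: "coef \<delta> \<beta> = coef \<gamma> \<beta> - (2 * (\<gamma> \<bullet> \<alpha>) / (\<alpha> \<bullet> \<alpha>)) * coef \<alpha> \<beta>" for \<beta>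
      unfolding \<delta>_def reflect_def using \<alpha> root_span[OF \<gamma>'(1)]
      by (subst coef_diff) (auto intro: span_scale span_base simp: coef_scale span_base)
    have "(\<Sum>\<beta>\<in>\<Delta>. coef \<alpha> \<beta>) = 1"
      using \<alpha>(1) finite_simple coef_simple[OF \<alpha>(1)] by simp
    then show ?thesis
      unfolding height_def c by (simp only: sum_subtractf sum_distrib_left[symmetric] mult_1_right)
  qed
  moreover have "0 < 2 * (\<gamma> \<bullet> \<alpha>) / (\<alpha> \<bullet> \<alpha>)" using \<alpha> simple_nonzero[OF \<alpha>(1)] by simp
  ultimately have "height \<delta> < height \<gamma>" by linarith
  then have "\<delta> \<notin> Bad" using min[of \<delta>] by linarith
  then obtain n where n: "reflect \<delta> \<in> words n" using \<delta> unfolding Bad_def by blast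
  have a0: "\<alpha> \<noteq> 0" using simple_nonzero[OF \<alpha>(1)] .
  have "reflect \<alpha> \<circ> (reflect \<delta> \<circ> reflect \<alpha>) = reflect \<gamma>"
  proof
    fix x
    have "reflect \<alpha> (reflect \<delta> (reflect \<alpha> x)) = reflect (reflect \<alpha> \<delta>) (reflect \<alpha> (reflect \<alpha> x))"
      by (rule reflect_conjugate[OF linear_reflect inner_reflect[OF a0]])
    then show "(reflect \<alpha> \<circ> (reflect \<delta> \<circ> reflect \<alpha>)) x = reflect \<gamma> x"
      unfolding \<delta>_def by (simp add: reflect_reflect[OF a0])
  qed
  then have "reflect \<gamma> \<in> words (1 + (n + 1))"
    using words_append[OF single words_append[OF n single]] by simp
  then show False using \<gamma> unfolding Bad_def by blast
qed

lemma group_words: "w \<in> W \<Longrightarrow> \<exists>n. w \<in> words n"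
proof (induction rule: reflection_group.induct)
  case id
  have "id \<in> words 0" by simp
  then show ?case by blast
next
  case (reflect w \<alpha>)
  obtain m where "reflect \<alpha> \<in> words m"
    using root_sign[OF reflect(2)] reflect_words[OF reflect(2)]
      reflect_words[OF minus_root[OF reflect(2)]] reflect_minus[of \<alpha>] by auto
  then show ?case using reflect.IH words_append by blast
qed

text \<open>A dominant vector is the largest element of its orbit; the induction removes one letter of
  a word, or two when the exchange condition applies.\<close>

lemma dominant_diff:
  assumes \<mu>: "dominant \<mu>" and "w \<in> W" shows "nonneg_comb \<Delta> (\<mu> - w \<mu>)"
proof -
  have "w \<in> words n \<Longrightarrow> nonneg_comb \<Delta> (\<mu> - w \<mu>)" for n w
  proof (induction n arbitrary: w rule: less_induct)
    case (less n)
    show ?case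
    proof (cases n)
      case 0
      then show ?thesis using less.prems nonneg_comb_0 by simp
    next
      case (Suc m)
      then obtain u \<alpha> where w: "w = u \<circ> reflect \<alpha>" and \<alpha>: "\<alpha> \<in> \<Delta>" and u: "u \<in> words m"
        using less.prems words_Suc_right by blast
      note g = group_props[OF words_group[OF u]]
      show ?thesis
      proof (cases "nonneg_comb \<Delta> (- u \<alpha>)")
        case True
        then obtain k where "m = Suc k" "w \<in> words k" using words_exchange[OF u \<alpha>] w by blast
        then show ?thesis using less.IH[of k w] Suc by simp
      next
        case False
        have "u \<alpha> \<in> \<Phi>" using g(3) \<alpha> simple_sub by blast
        then have pos: "nonneg_comb \<Delta> (u \<alpha>)" using False root_sign by blast
        have eq: "\<mu> - w \<mu> = (\<mu> - u \<mu>) + (2 * (\<mu> \<bullet> \<alpha>) / (\<alpha> \<bullet> \<alpha>)) *\<^sub>R u \<alpha>"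
          by (simp add: w reflect_def linear_diff linear_scale g(1))
        have "0 \<le> 2 * (\<mu> \<bullet> \<alpha>) / (\<alpha> \<bullet> \<alpha>)" using \<mu> \<alpha> by simp
        then show ?thesis
          unfolding eq by (intro nonneg_comb_add nonneg_comb_scale[OF pos] less.IH[of m u]) (use u Suc in auto)
      qed
    qed
  qed
  then show ?thesis using group_words[OF assms(2)] by blast
qed

lemma dominant_inner_le:
  assumes "dominant x" "dominant \<mu>" "w \<in> W" shows "x \<bullet> w \<mu> \<le> x \<bullet> \<mu>"
  using nonneg_comb_inner[OF dominant_diff[OF assms(2,3)], of x] assms(1) by (simp add: inner_diff_right)

text \<open>Pairing with a strictly dominant vector detects every coefficient of the nonnegative
  combination \<open>\<mu> - w \<mu>\<close>. This is the equality case that decides which points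
  lie on a hyperplane.\<close>

lemma dominant_inner_eq:
  assumes x: "\<forall>\<alpha>\<in>\<Delta>. 0 < x \<bullet> \<alpha>" and \<mu>: "dominant \<mu>" and w: "w \<in> W" and eq: "x \<bullet> w \<mu> = x \<bullet> \<mu>"
  shows "w \<mu> = \<mu>"
proof -
  obtain c where c: "\<forall>\<alpha>\<in>\<Delta>. 0 \<le> c \<alpha>" "\<mu> - w \<mu> = (\<Sum>\<alpha>\<in>\<Delta>. c \<alpha> *\<^sub>R \<alpha>)"
    using dominant_diff[OF \<mu> w] unfolding nonneg_comb_def by blast
  have "x \<bullet> (\<mu> - w \<mu>) = 0" using eq by (simp add: inner_diff_right)
  then have "(\<Sum>\<alpha>\<in>\<Delta>. c \<alpha> * (x \<bullet> \<alpha>)) = 0" unfolding c(2) by (simp add: inner_sum_right)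
  moreover have "0 \<le> c \<alpha> * (x \<bullet> \<alpha>)" if "\<alpha> \<in> \<Delta>" for \<alpha> using c(1) x that by (simp add: less_imp_le)
  ultimately have "\<forall>\<alpha>\<in>\<Delta>. c \<alpha> * (x \<bullet> \<alpha>) = 0"
    using sum_nonneg_eq_0_iff[OF finite_simple, of "\<lambda>\<alpha>. c \<alpha> * (x \<bullet> \<alpha>)"] by blast
  then have "\<forall>\<alpha>\<in>\<Delta>. c \<alpha> = 0" using x by force
  then show ?thesis using c(2) by simp
qed

section \<open>Half sums of positive roots\<close>

lemma finite_positive: "finite (positive_roots \<Phi> \<Delta>)"
  unfolding positive_roots_def using finite_roots by simp

text \<open>The reflection permutes the positive roots in \<open>A\<close> other than \<alpha> and
  changes the sign of \<alpha>.\<close>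

lemma reflect_half_sum:
  assumes A: "subspace A" and \<alpha>: "\<alpha> \<in> \<Delta>" "\<alpha> \<in> A"
  shows "reflect \<alpha> (half_sum \<Phi> \<Delta> A) = half_sum \<Phi> \<Delta> A - \<alpha>"
proof -
  define P where "P = positive_roots \<Phi> \<Delta> \<inter> A"
  have a0: "\<alpha> \<noteq> 0" using simple_nonzero[OF \<alpha>(1)] .
  have fP: "finite P" unfolding P_def using finite_positive by blast
  have \<alpha>P: "\<alpha> \<in> P" unfolding P_def positive_roots_def using \<alpha> simple_nonneg simple_sub by blast
  have refl: "reflect \<alpha> \<beta> \<in> P - {\<alpha>}" if "\<beta> \<in> P - {\<alpha>}" for \<beta>
  proof -
    have \<beta>: "\<beta> \<in> \<Phi>" "nonneg_comb \<Delta> \<beta>" "\<beta> \<in> A" "\<beta> \<noteq> \<alpha>"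
      using that unfolding P_def positive_roots_def by auto
    have "reflect \<alpha> \<beta> \<in> A"
      unfolding reflect_def using subspace_diff[OF A] subspace_scale[OF A] \<beta>(3) \<alpha>(2) by blast
    moreover have "reflect \<alpha> \<beta> \<noteq> \<alpha>"
    proof
      assume "reflect \<alpha> \<beta> = \<alpha>"
      then have "\<beta> = - \<alpha>" using reflect_reflect[OF a0, of \<beta>] reflect_self[OF a0] by simp
      then show False using not_both_signs[of \<alpha>] \<beta>(2) simple_nonneg[OF \<alpha>(1)] a0 by simp
    qed
    ultimately show ?thesis unfolding P_def positive_roots_def
      using reflect_simple_positive[OF \<alpha>(1) \<beta>(1,2,4)] reflect_root \<alpha>(1) \<beta>(1) simple_sub by blast
  qed
  have "reflect \<alpha> (\<Sum>(P - {\<alpha>})) = (\<Sum>\<beta>\<in>P - {\<alpha>}. reflect \<alpha> \<beta>)"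
    using linear_sum[OF linear_reflect, of \<alpha> "\<lambda>x. x" "P - {\<alpha>}"] by simp
  also have "\<dots> = \<Sum>(P - {\<alpha>})"
    by (rule sum.reindex_bij_witness[of _ "reflect \<alpha>" "reflect \<alpha>"])
      (use refl reflect_reflect[OF a0] in auto)
  finally have S: "reflect \<alpha> (\<Sum>(P - {\<alpha>})) = \<Sum>(P - {\<alpha>})" .
  have dec: "\<Sum>P = \<alpha> + \<Sum>(P - {\<alpha>})" using sum.remove[OF fP \<alpha>P, of "\<lambda>x. x"] by simp
  have "reflect \<alpha> (\<Sum>P) = \<Sum>P - 2 *\<^sub>R \<alpha>"
    unfolding dec using S by (simp add: linear_add[OF linear_reflect] reflect_self[OF a0] scaleR_2)
  then have "(1/2) *\<^sub>R reflect \<alpha> (\<Sum>P) = (1/2) *\<^sub>R \<Sum>P - \<alpha>" by (simp add: scaleR_diff_right)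
  then show ?thesis unfolding half_sum_def P_def[symmetric] by (simp add: linear_scale[OF linear_reflect])
qed

text \<open>The value does not depend on \<open>A\<close>. Hence the half sums of two subspaces
  differ by a vector orthogonal to all simple roots that they share, which underlies both the facet
  inequalities and the splitting of the facet.\<close>

lemma half_sum_inner:
  assumes "subspace A" "\<alpha> \<in> \<Delta>" "\<alpha> \<in> A"
  shows "half_sum \<Phi> \<Delta> A \<bullet> \<alpha> = \<alpha> \<bullet> \<alpha> / 2"
proof -
  have "(2 * (half_sum \<Phi> \<Delta> A \<bullet> \<alpha>) / (\<alpha> \<bullet> \<alpha>)) *\<^sub>R \<alpha> = 1 *\<^sub>R \<alpha>"
    using reflect_half_sum[OF assms] unfolding reflect_def by simp
  then have "2 * (half_sum \<Phi> \<Delta> A \<bullet> \<alpha>) / (\<alpha> \<bullet> \<alpha>) = 1"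
    unfolding scaleR_cancel_right using simple_nonzero[OF assms(2)] by blast
  then have "2 * (half_sum \<Phi> \<Delta> A \<bullet> \<alpha>) = \<alpha> \<bullet> \<alpha>" by (rule right_inverse_eq[THEN iffD1, rotated]) (use simple_nonzero[OF assms(2)] in simp)
  then show ?thesis by simp
qed

lemma half_sum_in: "subspace A \<Longrightarrow> half_sum \<Phi> \<Delta> A \<in> A"
  unfolding half_sum_def by (intro subspace_scale subspace_sum) auto

lemma half_sum_nonneg: "nonneg_comb \<Delta> (half_sum \<Phi> \<Delta> A)"
  unfolding half_sum_def
  by (intro nonneg_comb_scale nonneg_comb_sum) (auto simp: positive_roots_def)

lemma half_sum_span: "half_sum \<Phi> \<Delta> A \<in> span \<Delta>"
  using half_sum_nonneg nonneg_comb_span by blast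

text \<open>Choose the point of the orbit with the largest inner product with the half sum of all
  positive roots; a simple reflection changes this inner product by the value on the simple
  root.\<close>

lemma exists_dominant: "\<exists>w\<in>W. dominant (w x)"
proof -
  define \<rho> where "\<rho> = half_sum \<Phi> \<Delta> UNIV"
  have "finite ((\<lambda>w. w x \<bullet> \<rho>) ` W)" "(\<lambda>w. w x \<bullet> \<rho>) ` W \<noteq> {}"
    using finite_group reflection_group.id by auto
  from Max_in[OF this] obtain w where w: "w \<in> W" "Max ((\<lambda>w. w x \<bullet> \<rho>) ` W) = w x \<bullet> \<rho>" by auto
  have max: "u x \<bullet> \<rho> \<le> w x \<bullet> \<rho>" if "u \<in> W" for u
    unfolding w(2)[symmetric] by (rule Max_ge) (use finite_group that in auto)
  have "0 \<le> w x \<bullet> \<alpha>" if \<alpha>: "\<alpha> \<in> \<Delta>" for \<alpha>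
  proof -
    have "(reflect \<alpha> \<circ> w) x \<bullet> \<rho> \<le> w x \<bullet> \<rho>"
      by (rule max[OF reflection_group.reflect[OF w(1)]]) (use \<alpha> simple_sub in blast)
    moreover have "(reflect \<alpha> \<circ> w) x \<bullet> \<rho> = w x \<bullet> \<rho> - w x \<bullet> \<alpha>"
      unfolding \<rho>_def using reflect_adjoint[OF simple_nonzero[OF \<alpha>], of "w x"]
        reflect_half_sum[OF subspace_UNIV \<alpha>] by (simp add: inner_diff_right)
    ultimately show ?thesis by linarith
  qed
  then show ?thesis using w(1) by blast
qed

lemma span_inter_simple: "S \<subseteq> \<Delta> \<Longrightarrow> span S \<inter> \<Delta> = S"
proof
  assume S: "S \<subseteq> \<Delta>"
  show "span S \<inter> \<Delta> \<subseteq> S"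
  proof
    fix \<alpha> assume \<alpha>: "\<alpha> \<in> span S \<inter> \<Delta>"
    show "\<alpha> \<in> S"
    proof (rule ccontr)
      assume "\<alpha> \<notin> S"
      then have "S \<subseteq> \<Delta> - {\<alpha>}" using S by blast
      then have "\<alpha> \<in> span (\<Delta> - {\<alpha>})" using \<alpha> span_mono by blast
      then show False using indep \<alpha> unfolding dependent_def by blast
    qed
  qed
qed (auto intro: span_base)

lemma span_simple_subset_iff: "S \<subseteq> \<Delta> \<Longrightarrow> T \<subseteq> \<Delta> \<Longrightarrow> span S \<subseteq> span T \<longleftrightarrow> S \<subseteq> T"
  using span_inter_simple span_mono span_superset by (metis Int_greatest inf.absorb_iff2 inf.coboundedI1 inf_commute le_inf_iff order_trans)

lemma span_simple_inj: "inj_on span (Pow \<Delta>)"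
  by (rule inj_onI) (metis Pow_iff span_inter_simple)

lemma coef_outside:
  assumes S: "S \<subseteq> \<Delta>" and v: "v \<in> span S" and \<alpha>: "\<alpha> \<notin> S" shows "coef v \<alpha> = 0"
proof -
  have "coef v = representation S v" by (rule representation_extend[OF indep v S])
  then show ?thesis using \<alpha> representation_ne_zero[of S v \<alpha>] by auto
qed

lemma coef_half_sum_pos:
  assumes A: "subspace A" and \<alpha>: "\<alpha> \<in> \<Delta>" "\<alpha> \<in> A"
  shows "0 < coef (half_sum \<Phi> \<Delta> A) \<alpha>"
proof -
  define P where "P = positive_roots \<Phi> \<Delta> \<inter> A"
  have fP: "finite P" unfolding P_def using finite_positive by blast
  have \<alpha>P: "\<alpha> \<in> P" unfolding P_def positive_roots_def using \<alpha> simple_nonneg simple_sub by blast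
  define q where "q = half_sum \<Phi> \<Delta> A - (1/2) *\<^sub>R \<alpha>"
  have "q = (1/2) *\<^sub>R \<Sum>(P - {\<alpha>})"
    unfolding q_def half_sum_def P_def[symmetric] using sum.remove[OF fP \<alpha>P, of "\<lambda>x. x"] by (simp add: algebra_simps)
  moreover have "nonneg_comb \<Delta> ((1/2) *\<^sub>R \<Sum>(P - {\<alpha>}))"
    by (intro nonneg_comb_scale nonneg_comb_sum) (auto simp: P_def positive_roots_def)
  ultimately have "0 \<le> coef q \<alpha>" using \<alpha>(1) unfolding nonneg_comb_iff by simp
  moreover have "coef q \<alpha> = coef (half_sum \<Phi> \<Delta> A) \<alpha> - 1/2 * coef \<alpha> \<alpha>"
    unfolding q_def using half_sum_span \<alpha>(1) by (simp add: coef_diff coef_scale span_base span_scale)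
  ultimately show ?thesis using \<alpha>(1) by (simp add: coef_simple)
qed

text \<open>The coefficients of the half sum are nonnegative and vanish at \<alpha>, and distinct
  simple roots have nonpositive inner products.\<close>

lemma half_sum_inner_outside:
  assumes S: "S \<subseteq> \<Delta>" and \<alpha>: "\<alpha> \<in> \<Delta> - S"
  shows "half_sum \<Phi> \<Delta> (span S) \<bullet> \<alpha> \<le> 0"
proof -
  let ?h = "half_sum \<Phi> \<Delta> (span S)"
  have h: "?h \<in> span S" by (rule half_sum_in[OF subspace_span])
  have "?h \<bullet> \<alpha> = (\<Sum>\<beta>\<in>\<Delta>. coef ?h \<beta> * (\<beta> \<bullet> \<alpha>))"
    by (subst coef_expand[OF half_sum_span, of "span S"]) (simp add: inner_sum_left)
  also have "\<dots> \<le> 0"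
  proof (rule sum_nonpos)
    fix \<beta> assume \<beta>: "\<beta> \<in> \<Delta>"
    show "coef ?h \<beta> * (\<beta> \<bullet> \<alpha>) \<le> 0"
    proof (cases "\<beta> = \<alpha>")
      case True
      then show ?thesis using coef_outside[OF S h] \<alpha> by simp
    next
      case False
      then show ?thesis using simple_obtuse[OF \<beta>] \<alpha> half_sum_nonneg \<beta>
        unfolding nonneg_comb_iff by (simp add: mult_nonneg_nonpos)
    qed
  qed
  finally show ?thesis .
qed

text \<open>Turns a solution \<open>y\<close> of the combinatorial system into a point of the
  space.\<close>

lemma exists_coordinates: "\<exists>x\<in>span \<Phi>. \<forall>\<alpha>\<in>\<Delta>. x \<bullet> \<alpha> = y \<alpha>"
proof -
  obtain g :: "'a \<Rightarrow> real" where g: "linear g" "\<forall>\<alpha>\<in>\<Delta>. g \<alpha> = y \<alpha>"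
    using linear_independent_extend[OF indep, of y] by blast
  define z where "z = adjoint g 1"
  have z: "z \<bullet> \<alpha> = g \<alpha>" for \<alpha>
    unfolding z_def using adjoint_works[OF g(1), of \<alpha> 1] by (simp add: inner_commute)
  obtain p q where pq: "p \<in> span \<Phi>" "\<And>v. v \<in> span \<Phi> \<Longrightarrow> orthogonal q v" "z = p + q"
    using orthogonal_subspace_decomp_exists[of \<Phi> z] by metis
  have "p \<bullet> \<alpha> = y \<alpha>" if "\<alpha> \<in> \<Delta>" for \<alpha>
  proof -
    have "q \<bullet> \<alpha> = 0" using pq(2) span_base simple_sub that unfolding orthogonal_def by blast
    then show ?thesis using z[of \<alpha>] g(2) that pq(3) by (simp add: inner_add_left)
  qed
  then show ?thesis using pq(1) by blast
qed

lemma inner_half_sum: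
  assumes S: "S \<subseteq> \<Delta>"
  shows "x \<bullet> half_sum \<Phi> \<Delta> (span S) = (\<Sum>\<alpha>\<in>S. coef (half_sum \<Phi> \<Delta> (span S)) \<alpha> * (x \<bullet> \<alpha>))"
proof -
  let ?h = "half_sum \<Phi> \<Delta> (span S)"
  have h: "?h \<in> span S" by (rule half_sum_in[OF subspace_span])
  have "x \<bullet> ?h = (\<Sum>\<alpha>\<in>\<Delta>. coef ?h \<alpha> * (x \<bullet> \<alpha>))"
    by (subst coef_expand[OF half_sum_span, of "span S"]) (simp add: inner_sum_right)
  also have "\<dots> = (\<Sum>\<alpha>\<in>S. coef ?h \<alpha> * (x \<bullet> \<alpha>))"
    by (rule sum.mono_neutral_right[OF finite_simple S]) (use coef_outside[OF S h] in auto)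
  finally show ?thesis .
qed

end

section \<open>Building sets of root systems\<close>

lemma sum_subspaces:
  fixes \<S> :: "'a::euclidean_space set set"
  assumes "finite \<S>" "\<And>X. X \<in> \<S> \<Longrightarrow> subspace X"
  shows "\<Sum>\<S> = span (\<Union>\<S>)"
  using assms
proof (induction \<S>)
  case empty
  then show ?case by (simp add: set_zero)
next
  case (insert X \<S>)
  have "\<Sum>(insert X \<S>) = X + span (\<Union>\<S>)" using insert by simp
  also have "\<dots> = span X + span (\<Union>\<S>)" using insert.prems by (simp add: span_eq_iff[THEN iffD2])
  also have "\<dots> = span (X \<union> \<Union>\<S>)" unfolding span_Un set_plus_def by blast
  finally show ?case by simp
qed

lemma sum_spans:
  fixes T :: "'a::euclidean_space set set"
  assumes "finite T" shows "\<Sum>(span ` T) = span (\<Union>T)"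
proof -
  have "\<Sum>(span ` T) = span (\<Union>(span ` T))"
    by (rule sum_subspaces) (use assms in auto)
  also have "\<dots> = span (\<Union>T)"
  proof (rule antisym)
    show "span (\<Union>(span ` T)) \<subseteq> span (\<Union>T)"
      by (rule span_minimal) (auto dest: span_mono[OF Union_upper])
    show "span (\<Union>T) \<subseteq> span (\<Union>(span ` T))"
      by (rule span_mono) (auto intro: span_base)
  qed
  finally show ?thesis .
qed

text \<open>The consequences of the building set axioms in terms of sets of simple roots. In this
  form they pass to subsystems by restriction. The last condition says that a root of
  \<open>span Z\<close> already lies in a member spanned by part of \<open>Z\<close>; it makes the
  roots of \<open>span Z\<close> split among the components of \<open>Z\<close>.\<close>

locale nested_root_system = root_basis +
  fixes G :: "'a set set"
  assumes top_mem: "span \<Phi> \<in> G"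
    and zero_mem: "{0} \<notin> G"
    and line_mem: "\<alpha> \<in> \<Delta> \<Longrightarrow> span {\<alpha>} \<in> G"
    and union_mem: "S \<subseteq> \<Delta> \<Longrightarrow> T \<subseteq> \<Delta> \<Longrightarrow> span S \<in> G \<Longrightarrow> span T \<in> G \<Longrightarrow> S \<inter> T \<noteq> {} \<Longrightarrow>
      span (S \<union> T) \<in> G"
    and root_support: "\<beta> \<in> \<Phi> \<Longrightarrow> Z \<subseteq> \<Delta> \<Longrightarrow> \<beta> \<in> span Z \<Longrightarrow> \<exists>S\<subseteq>Z. span S \<in> G \<and> \<beta> \<in> span S"
begin

definition bs :: "'a set set" where
  "bs = {S. S \<subseteq> \<Delta> \<and> span S \<in> G}"

abbreviation hs :: "'a set \<Rightarrow> 'a" where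
  "hs S \<equiv> half_sum \<Phi> \<Delta> (span S)"

sublocale weighted_building \<Delta> bs "\<lambda>S. representation \<Delta> (hs S)"
proof
  show "finite \<Delta>" by (rule finite_simple)
  show "B \<subseteq> \<Delta>" if "B \<in> bs" for B using that unfolding bs_def by blast
  show "{} \<notin> bs" unfolding bs_def using zero_mem by simp
  show "{\<alpha>} \<in> bs" if "\<alpha> \<in> \<Delta>" for \<alpha> unfolding bs_def using line_mem that by simp
  show "\<Delta> \<in> bs" unfolding bs_def using top_mem span_simple by simp
  show "B \<union> C \<in> bs" if "B \<in> bs" "C \<in> bs" "B \<inter> C \<noteq> {}" for B C
    using that union_mem unfolding bs_def by simp
  show "0 < representation \<Delta> (hs A) \<alpha>" if "A \<in> bs" "\<alpha> \<in> A" for A \<alpha>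
    using coef_half_sum_pos[of "span A" \<alpha>] that span_base[of \<alpha> A] unfolding bs_def by auto
qed

lemma val_inner: "S \<subseteq> \<Delta> \<Longrightarrow> val S (\<lambda>\<alpha>. x \<bullet> \<alpha>) = x \<bullet> hs S"
  unfolding val_def by (rule inner_half_sum[symmetric])

lemma fundamental_eq: "fundamental \<Delta> G = span ` bs"
  unfolding fundamental_def bs_def by auto

lemma span_inj_on: "T \<subseteq> Pow \<Delta> \<Longrightarrow> inj_on span T"
  using span_simple_inj inj_on_subset by blast

lemma bs_sub_Pow: "T \<subseteq> bs \<Longrightarrow> T \<subseteq> Pow \<Delta>"
  unfolding bs_def by blast

lemma span_mem_fundamental: "S \<subseteq> \<Delta> \<Longrightarrow> span S \<in> fundamental \<Delta> G \<longleftrightarrow> S \<in> bs"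
  unfolding fundamental_def bs_def by auto

lemma nested_iff_cnested:
  assumes S: "S \<subseteq> bs" shows "nested (fundamental \<Delta> G) (span ` S) \<longleftrightarrow> cnested S"
proof -
  have key: "(finite (span ` T) \<and> 2 \<le> card (span ` T) \<and> (\<forall>A\<in>span ` T. \<forall>B\<in>span ` T. A \<noteq> B \<longrightarrow> \<not> A \<subseteq> B)
        \<longrightarrow> \<Sum>(span ` T) \<notin> fundamental \<Delta> G) \<longleftrightarrow>
      (2 \<le> card T \<and> (\<forall>A\<in>T. \<forall>B\<in>T. A \<noteq> B \<longrightarrow> \<not> A \<subseteq> B) \<longrightarrow> \<Union>T \<notin> bs)" if T: "T \<subseteq> S" for T
  proof -
    have Tbs: "T \<subseteq> bs" using T S by simp
    have TP: "T \<subseteq> Pow \<Delta>" using bs_sub_Pow[OF Tbs] .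
    have fT: "finite T" using finite_subfamily[OF Tbs] .
    have "card (span ` T) = card T" by (rule card_image[OF span_inj_on[OF TP]])
    moreover have "(\<forall>A\<in>span ` T. \<forall>B\<in>span ` T. A \<noteq> B \<longrightarrow> \<not> A \<subseteq> B) \<longleftrightarrow> (\<forall>A\<in>T. \<forall>B\<in>T. A \<noteq> B \<longrightarrow> \<not> A \<subseteq> B)"
    proof -
      have "(span A \<noteq> span B \<longrightarrow> \<not> span A \<subseteq> span B) \<longleftrightarrow> (A \<noteq> B \<longrightarrow> \<not> A \<subseteq> B)" if "A \<in> T" "B \<in> T" for A B
      proof -
        have "A \<subseteq> \<Delta>" "B \<subseteq> \<Delta>" using TP that by auto
        then show ?thesis using span_simple_subset_iff[of A B] span_simple_subset_iff[of B A] by auto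
      qed
      then show ?thesis by simp
    qed
    moreover have "\<Sum>(span ` T) \<in> fundamental \<Delta> G \<longleftrightarrow> \<Union>T \<in> bs"
      unfolding sum_spans[OF fT] by (rule span_mem_fundamental) (use TP in auto)
    ultimately show ?thesis using fT by simp
  qed
  have fund: "span ` S \<subseteq> fundamental \<Delta> G" unfolding fundamental_eq using S by auto
  have "nested (fundamental \<Delta> G) (span ` S) \<longleftrightarrow> (\<forall>T\<subseteq>S. finite (span ` T) \<and> 2 \<le> card (span ` T) \<and>
      (\<forall>A\<in>span ` T. \<forall>B\<in>span ` T. A \<noteq> B \<longrightarrow> \<not> A \<subseteq> B) \<longrightarrow> \<Sum>(span ` T) \<notin> fundamental \<Delta> G)"
    unfolding nested_def using fund by (simp only: all_subset_image simp_thms)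
  also have "\<dots> \<longleftrightarrow> (\<forall>T\<subseteq>S. 2 \<le> card T \<and> (\<forall>A\<in>T. \<forall>B\<in>T. A \<noteq> B \<longrightarrow> \<not> A \<subseteq> B) \<longrightarrow> \<Union>T \<notin> bs)"
    using key by simp
  also have "\<dots> \<longleftrightarrow> cnested S" unfolding cnested_iff using S by simp
  finally show ?thesis .
qed

lemma dim_span_bs:
  assumes "S \<in> bs" shows "dim (span S) \<in> {1..dim \<Phi>}"
proof -
  have S: "S \<subseteq> \<Delta>" "S \<noteq> {}" using assms mem_nonempty sub by auto
  have "dim (span S) = card S"
    using dim_span_eq_card_independent[of S] independent_mono[OF indep S(1)] by simp
  moreover have "card S \<noteq> 0" using S finite_subset[OF S(1) finite_simple] by simp
  moreover have "dim (span S) \<le> dim (span \<Phi>)"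
    by (rule dim_subset) (use span_mono[OF S(1)] span_simple in simp)
  ultimately show ?thesis by simp
qed

lemma coeff_ratio_eq: "B \<subseteq> \<Delta> \<Longrightarrow> coeff_ratio \<Phi> \<Delta> (span A) (span B) = ratio A B"
  unfolding coeff_ratio_def ratio_def using span_inter_simple[of B] by (simp add: Int_commute)

abbreviation level :: "(nat \<Rightarrow> real) \<Rightarrow> 'a set \<Rightarrow> real" where
  "level \<epsilon> S \<equiv> \<epsilon> (dim (span S))"

lemma suitable_admissible:
  assumes "suitable \<Phi> \<Delta> G \<epsilon>" shows "admissible (level \<epsilon>)"
  unfolding admissible_def
proof (intro conjI ballI allI impI)
  show "0 < level \<epsilon> A" if "A \<in> bs" for A
    using assms dim_span_bs[OF that] unfolding suitable_def by blast
  fix T assume T: "T \<subseteq> bs" and "\<Union>T \<in> bs \<and> irredundant T"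
  then have U: "\<Union>T \<in> bs" and irr: "2 \<le> card T" "\<forall>B\<in>T. \<Union>(T - {B}) \<noteq> \<Union>T"
    unfolding irredundant_def by auto
  note TP = bs_sub_Pow[OF T]
  note inj = span_inj_on[OF TP]
  note fT = finite_subfamily[OF T]
  have A: "span (\<Union>T) \<in> fundamental \<Delta> G" "span ` T \<subseteq> fundamental \<Delta> G"
    using U T unfolding fundamental_eq by auto
  have "2 \<le> card (span ` T)" using irr(1) card_image[OF inj] by simp
  moreover have "\<Sum>(span ` T) = span (\<Union>T)" by (rule sum_spans[OF fT])
  moreover have "\<forall>B\<in>span ` T. \<Sum>(span ` T - {B}) \<noteq> span (\<Union>T)"
  proof
    fix B' assume "B' \<in> span ` T"
    then obtain B where B: "B \<in> T" "B' = span B" by blast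
    have "span ` T - {B'} = span ` (T - {B})"
      using inj_on_image_set_diff[OF inj, of T "{B}"] B by simp
    then have "\<Sum>(span ` T - {B'}) = span (\<Union>(T - {B}))" using sum_spans[of "T - {B}"] fT by simp
    moreover have "\<Union>(T - {B}) \<subseteq> \<Delta> \<and> \<Union>T \<subseteq> \<Delta>" using TP by auto
    then have "span (\<Union>(T - {B})) = span (\<Union>T) \<Longrightarrow> \<Union>(T - {B}) = \<Union>T"
      using inj_onD[OF span_simple_inj, of "\<Union>(T - {B})" "\<Union>T"] by simp
    ultimately show "\<Sum>(span ` T - {B'}) \<noteq> span (\<Union>T)"
      using irr(2) B(1) by metis
  qed
  ultimately have "(\<Sum>B\<in>span ` T. coeff_ratio \<Phi> \<Delta> (span (\<Union>T)) B * \<epsilon> (dim B)) < \<epsilon> (dim (span (\<Union>T)))"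
    using assms[unfolded suitable_def, THEN conjunct2, THEN conjunct2, rule_format, OF A] by blast
  moreover have "(\<Sum>B\<in>span ` T. coeff_ratio \<Phi> \<Delta> (span (\<Union>T)) B * \<epsilon> (dim B))
      = (\<Sum>B\<in>T. ratio (\<Union>T) B * level \<epsilon> B)"
    unfolding sum.reindex[OF inj] comp_def
    by (rule sum.cong) (use TP coeff_ratio_eq in auto)
  ultimately show "(\<Sum>B\<in>T. ratio (\<Union>T) B * level \<epsilon> B) < level \<epsilon> (\<Union>T)" by simp
qed

section \<open>Cells of the fundamental chamber with prescribed levels\<close>

definition cell :: "('a set \<Rightarrow> real) \<Rightarrow> 'a set" where
  "cell e = {x\<in>span \<Phi>. x \<bullet> hs \<Delta> = e \<Delta> \<and> (\<forall>S\<in>bs. e S \<le> x \<bullet> hs S)}"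

lemma chamber_nestohedron_eq: "chamber_nestohedron \<Phi> \<Delta> G \<epsilon> = cell (level \<epsilon>)"
  unfolding chamber_nestohedron_def cell_def fundamental_eq span_simple by simp

lemma cell_positive:
  assumes "admissible e" "x \<in> cell e" "\<alpha> \<in> \<Delta>" shows "0 < x \<bullet> \<alpha>"
proof -
  have "e {\<alpha>} \<le> x \<bullet> hs {\<alpha>}" using assms(2) singleton[OF assms(3)] unfolding cell_def by simp
  then have "e {\<alpha>} \<le> val {\<alpha>} (\<lambda>\<alpha>. x \<bullet> \<alpha>)" using val_inner[of "{\<alpha>}" x] assms(3) by simp
  from val_singleton_pos[OF assms(1,3) this] show ?thesis .
qed

lemma cnested_tight_cell:
  assumes "admissible e" "x \<in> cell e" shows "cnested {S\<in>bs. x \<bullet> hs S = e S}"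
proof -
  have v: "val S (\<lambda>\<alpha>. x \<bullet> \<alpha>) = x \<bullet> hs S" if "S \<in> bs" for S
    using val_inner[OF sub[OF that]] .
  have "cnested {S\<in>bs. val S (\<lambda>\<alpha>. x \<bullet> \<alpha>) = e S}"
    by (rule cnested_tight[OF assms(1)]) (use assms(2) v in \<open>auto simp: cell_def\<close>)
  moreover have "{S\<in>bs. val S (\<lambda>\<alpha>. x \<bullet> \<alpha>) = e S} = {S\<in>bs. x \<bullet> hs S = e S}" using v by auto
  ultimately show ?thesis by simp
qed

lemma exists_cell_point:
  assumes e: "admissible e" and S: "cnested S" "\<Delta> \<in> S"
  shows "\<exists>x\<in>cell e. \<forall>A\<in>bs. x \<bullet> hs A = e A \<longleftrightarrow> A \<in> S"
proof -
  obtain y where y: "\<forall>A\<in>S. val A y = e A" "\<forall>A\<in>bs - S. e A < val A y"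
    using exists_tight_eq[OF e S] by blast
  obtain x where x: "x \<in> span \<Phi>" "\<forall>\<alpha>\<in>\<Delta>. x \<bullet> \<alpha> = y \<alpha>" using exists_coordinates by blast
  have v: "x \<bullet> hs A = val A y" if "A \<in> bs" for A
  proof -
    have "val A (\<lambda>\<alpha>. x \<bullet> \<alpha>) = val A y"
      unfolding val_def by (rule sum.cong) (use x(2) sub[OF that] in auto)
    then show ?thesis using val_inner[OF sub[OF that]] by simp
  qed
  have eq: "x \<bullet> hs A = e A \<longleftrightarrow> A \<in> S" if "A \<in> bs" for A
    using y v[OF that] that by (cases "A \<in> S") force+
  have "e A \<le> x \<bullet> hs A" if "A \<in> bs" for A
    using y v[OF that] that by (cases "A \<in> S") (force simp: less_imp_le)+
  moreover have "x \<bullet> hs \<Delta> = e \<Delta>" using eq[OF top] S(2) by simp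
  ultimately have "x \<in> cell e" unfolding cell_def using x(1) by simp
  then show ?thesis using eq by blast
qed

text \<open>By \<open>root_support\<close> every positive root in \<open>span Z\<close> lies in the
  span of some component, and disjoint components have spans meeting only in 0.\<close>

lemma half_sum_components:
  assumes Z: "Z \<subseteq> \<Delta>" shows "hs Z = (\<Sum>A\<in>components Z. hs A)"
proof -
  define P where "P A = positive_roots \<Phi> \<Delta> \<inter> span A" for A
  have fP: "finite (P A)" for A unfolding P_def using finite_positive by simp
  have "P Z = (\<Union>A\<in>components Z. P A)"
  proof
    show "P Z \<subseteq> (\<Union>A\<in>components Z. P A)"
    proof
      fix \<beta> assume \<beta>: "\<beta> \<in> P Z"
      then have "\<beta> \<in> \<Phi>" "\<beta> \<in> span Z" unfolding P_def positive_roots_def by auto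
      then obtain S where S: "S \<subseteq> Z" "span S \<in> G" "\<beta> \<in> span S" using root_support Z by blast
      then have "S \<in> bs" unfolding bs_def using Z by blast
      then obtain A where A: "A \<in> components Z" "S \<subseteq> A" using components_cover[OF Z _ S(1)] by blast
      have "\<beta> \<in> span A" using S(3) span_mono[OF A(2)] by blast
      then show "\<beta> \<in> (\<Union>A\<in>components Z. P A)" using A(1) \<beta> unfolding P_def by blast
    qed
    show "(\<Union>A\<in>components Z. P A) \<subseteq> P Z"
      unfolding P_def using span_mono[OF components_sub] by fastforce
  qed
  moreover have "P A \<inter> P B = {}" if AB: "A \<in> components Z" "B \<in> components Z" "A \<noteq> B" for A B
  proof -
    have "v = 0" if v: "v \<in> span A" "v \<in> span B" for v
    proof -
      have sub': "A \<subseteq> \<Delta>" "B \<subseteq> \<Delta>" using AB components_sub Z by blast+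
      have "A \<inter> B = {}" using components_disjoint[OF Z AB] .
      then have "coef v \<alpha> = 0" for \<alpha>
        using coef_outside[OF sub'(1) v(1), of \<alpha>] coef_outside[OF sub'(2) v(2), of \<alpha>] by blast
      moreover have "v \<in> span \<Delta>" using v(1) span_mono[OF sub'(1)] by blast
      ultimately show ?thesis using coef_expand[of v] by simp
    qed
    then show ?thesis unfolding P_def positive_roots_def using zero_root by auto
  qed
  ultimately have "\<Sum>(P Z) = (\<Sum>A\<in>components Z. \<Sum>(P A))"
    using sum.UNION_disjoint[OF finite_components[OF Z], of P "\<lambda>x. x"] fP by simp
  then show ?thesis unfolding half_sum_def P_def[symmetric] by (simp add: scaleR_sum_right)
qed

text \<open>As \<open>weight Z\<close> is orthogonal to \<open>Z\<close>, the inequality \<open>x \<bullet> weight Z \<le> bound e Z\<close> is invariant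
  under the parabolic subgroup of \<open>Z\<close>; it is the facet inequality of the permutonestohedron belonging
  to the components of \<open>Z\<close>.\<close>

definition weight :: "'a set \<Rightarrow> 'a" where
  "weight Z = hs \<Delta> - hs Z"

definition bound :: "('a set \<Rightarrow> real) \<Rightarrow> 'a set \<Rightarrow> real" where
  "bound e Z = e \<Delta> - (\<Sum>A\<in>components Z. e A)"

lemma weight_inner_zero:
  assumes "Z \<subseteq> \<Delta>" "\<alpha> \<in> Z" shows "weight Z \<bullet> \<alpha> = 0"
proof -
  have "\<alpha> \<in> \<Delta>" using assms by blast
  then show ?thesis unfolding weight_def
    using half_sum_inner[of "span Z" \<alpha>] half_sum_inner[of "span \<Delta>" \<alpha>] assms(2)
    by (simp add: inner_diff_left span_base)
qed

lemma weight_inner_pos: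
  assumes "Z \<subseteq> \<Delta>" "\<alpha> \<in> \<Delta> - Z" shows "0 < weight Z \<bullet> \<alpha>"
proof -
  have "hs \<Delta> \<bullet> \<alpha> = \<alpha> \<bullet> \<alpha> / 2"
    using half_sum_inner[of "span \<Delta>" \<alpha>] assms(2) by (simp add: span_base)
  moreover have "hs Z \<bullet> \<alpha> \<le> 0" by (rule half_sum_inner_outside[OF assms])
  moreover have "0 < \<alpha> \<bullet> \<alpha>" using simple_nonzero assms(2) by simp
  ultimately show ?thesis unfolding weight_def inner_diff_left by linarith
qed

lemma weight_dominant: "Z \<subseteq> \<Delta> \<Longrightarrow> dominant (weight Z)"
  using weight_inner_zero[of Z] weight_inner_pos[of Z] by (metis DiffI less_imp_le order_refl)

lemma weight_span: "weight Z \<in> span \<Phi>"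
  unfolding weight_def span_simple[symmetric] by (intro span_diff half_sum_span)

text \<open>The difference of the two sides is the sum of the slacks
  \<open>x \<bullet> hs A - e A\<close> over the components of \<open>Z\<close>, and all of these
  are nonnegative on the cell.\<close>

lemma cell_weight:
  assumes x: "x \<in> cell e" and Z: "Z \<subseteq> \<Delta>"
  shows "x \<bullet> weight Z \<le> bound e Z"
    and "x \<bullet> weight Z = bound e Z \<longleftrightarrow> components Z \<subseteq> {S\<in>bs. x \<bullet> hs S = e S}"
proof -
  have cb: "components Z \<subseteq> bs" using components_mem[OF Z] by blast
  have le: "0 \<le> x \<bullet> hs A - e A" if "A \<in> components Z" for A
    using x cb that unfolding cell_def by auto
  have eq: "bound e Z - x \<bullet> weight Z = (\<Sum>A\<in>components Z. x \<bullet> hs A - e A)"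
    using x unfolding cell_def weight_def bound_def inner_diff_right half_sum_components[OF Z]
    by (simp add: inner_sum_right sum_subtractf)
  have "0 \<le> (\<Sum>A\<in>components Z. x \<bullet> hs A - e A)" by (rule sum_nonneg) (rule le)
  then show "x \<bullet> weight Z \<le> bound e Z" using eq by linarith
  have "x \<bullet> weight Z = bound e Z \<longleftrightarrow> (\<Sum>A\<in>components Z. x \<bullet> hs A - e A) = 0" using eq by auto
  also have "\<dots> \<longleftrightarrow> (\<forall>A\<in>components Z. x \<bullet> hs A - e A = 0)"
    by (rule sum_nonneg_eq_0_iff[OF finite_components[OF Z] le])
  also have "\<dots> \<longleftrightarrow> components Z \<subseteq> {S\<in>bs. x \<bullet> hs S = e S}" using cb by auto
  finally show "x \<bullet> weight Z = bound e Z \<longleftrightarrow> components Z \<subseteq> {S\<in>bs. x \<bullet> hs S = e S}" .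
qed

text \<open>Subtract the largest multiple of \<open>weight Z\<close>, where \<open>Z\<close> is the set of walls containing the
  vector, that leaves it dominant; this enlarges \<open>Z\<close>.\<close>

lemma dominant_decomposition:
  assumes "\<xi> \<in> span \<Phi>" "dominant \<xi>"
  shows "\<exists>\<Z> t. \<Z> \<subseteq> Pow \<Delta> \<and> (\<forall>Y\<in>\<Z>. \<forall>Z\<in>\<Z>. Y \<subseteq> Z \<or> Z \<subseteq> Y) \<and> (\<forall>Z\<in>\<Z>. 0 \<le> t Z) \<and>
    (\<forall>Z\<in>\<Z>. {\<alpha>\<in>\<Delta>. \<xi> \<bullet> \<alpha> = 0} \<subseteq> Z) \<and> \<xi> = (\<Sum>Z\<in>\<Z>. t Z *\<^sub>R weight Z)"
  using assms
proof (induction "card {\<alpha>\<in>\<Delta>. \<xi> \<bullet> \<alpha> \<noteq> 0}" arbitrary: \<xi> rule: less_induct)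
  case less
  define Z where "Z = {\<alpha>\<in>\<Delta>. \<xi> \<bullet> \<alpha> = 0}"
  have Z: "Z \<subseteq> \<Delta>" unfolding Z_def by blast
  show ?case
  proof (cases "Z = \<Delta>")
    case True
    then have "\<xi> \<bullet> \<alpha> = 0" if "\<alpha> \<in> \<Delta>" for \<alpha> using that unfolding Z_def by blast
    then have "\<xi> \<bullet> \<xi> = 0"
      using less.prems(1) orthogonal_to_span[of \<xi> \<Delta> \<xi>] unfolding span_simple orthogonal_def by blast
    then show ?thesis by (intro exI[of _ "{}"] exI[of _ "\<lambda>_. 0"]) simp
  next
    case False
    define r where "r \<alpha> = (\<xi> \<bullet> \<alpha>) / (weight Z \<bullet> \<alpha>)" for \<alpha>
    define t where "t = Min (r ` (\<Delta> - Z))"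
    have fin': "finite (r ` (\<Delta> - Z))" "r ` (\<Delta> - Z) \<noteq> {}" using finite_simple False Z by auto
    obtain \<gamma> where \<gamma>: "\<gamma> \<in> \<Delta> - Z" "t = r \<gamma>" using Min_in[OF fin'] unfolding t_def by auto
    have tle: "t \<le> r \<alpha>" if "\<alpha> \<in> \<Delta> - Z" for \<alpha>
      unfolding t_def by (rule Min_le) (use fin' that in auto)
    note wpos = weight_inner_pos[OF Z] and wzero = weight_inner_zero[OF Z]
    have t0: "0 \<le> t" unfolding \<gamma>(2) r_def using wpos[OF \<gamma>(1)] less.prems(2) \<gamma>(1) by simp
    define \<xi>' where "\<xi>' = \<xi> - t *\<^sub>R weight Z"
    have inner': "\<xi>' \<bullet> \<alpha> = \<xi> \<bullet> \<alpha> - t * (weight Z \<bullet> \<alpha>)" for \<alpha>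
      unfolding \<xi>'_def by (simp add: inner_diff_left)
    have zero: "\<xi>' \<bullet> \<alpha> = 0" if "\<alpha> \<in> Z" for \<alpha> using inner' wzero[OF that] that unfolding Z_def by simp
    have zero\<gamma>: "\<xi>' \<bullet> \<gamma> = 0" using inner'[of \<gamma>] wpos[OF \<gamma>(1)] unfolding \<gamma>(2) r_def by simp
    have dom: "dominant \<xi>'"
    proof
      fix \<alpha> assume \<alpha>: "\<alpha> \<in> \<Delta>"
      show "0 \<le> \<xi>' \<bullet> \<alpha>"
      proof (cases "\<alpha> \<in> Z")
        case True
        then show ?thesis using zero by simp
      next
        case False
        then have "t * (weight Z \<bullet> \<alpha>) \<le> r \<alpha> * (weight Z \<bullet> \<alpha>)"
          using tle \<alpha> wpos by (intro mult_right_mono) (auto simp: less_imp_le)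
        also have "\<dots> = \<xi> \<bullet> \<alpha>" unfolding r_def using wpos[of \<alpha>] \<alpha> False by simp
        finally show ?thesis using inner' by simp
      qed
    qed
    have sp: "\<xi>' \<in> span \<Phi>" unfolding \<xi>'_def by (intro span_diff span_scale less.prems(1) weight_span)
    have smaller: "{\<alpha>\<in>\<Delta>. \<xi>' \<bullet> \<alpha> \<noteq> 0} \<subset> {\<alpha>\<in>\<Delta>. \<xi> \<bullet> \<alpha> \<noteq> 0}"
      using zero zero\<gamma> \<gamma>(1) unfolding Z_def by blast
    have "card {\<alpha>\<in>\<Delta>. \<xi>' \<bullet> \<alpha> \<noteq> 0} < card {\<alpha>\<in>\<Delta>. \<xi> \<bullet> \<alpha> \<noteq> 0}"
      by (rule psubset_card_mono[OF _ smaller]) (use finite_simple in simp)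
    from less.hyps[OF this sp dom] obtain \<Z> s where \<Z>: "\<Z> \<subseteq> Pow \<Delta>"
      "\<forall>Y\<in>\<Z>. \<forall>Z\<in>\<Z>. Y \<subseteq> Z \<or> Z \<subseteq> Y" "\<forall>Z\<in>\<Z>. 0 \<le> s Z"
      "\<forall>Z\<in>\<Z>. {\<alpha>\<in>\<Delta>. \<xi>' \<bullet> \<alpha> = 0} \<subseteq> Z" "\<xi>' = (\<Sum>Z\<in>\<Z>. s Z *\<^sub>R weight Z)" by blast
    have f\<Z>: "finite \<Z>" using \<Z>(1) finite_simple by (simp add: finite_subset)
    \<comment> \<open>All later sets contain \<open>Z\<close> and the new wall \<gamma>, so
      \<open>Z\<close> lies strictly below them: the family stays a chain and the coefficient of
      \<open>Z\<close> may be set freely.\<close>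
    have big: "Z \<subseteq> Y" "\<gamma> \<in> Y" if "Y \<in> \<Z>" for Y using \<Z>(4) that zero zero\<gamma> Z \<gamma>(1) by blast+
    then have new: "Z \<notin> \<Z>" using \<gamma>(1) by blast
    have "(\<Sum>Y\<in>insert Z \<Z>. (s(Z := t)) Y *\<^sub>R weight Y) = t *\<^sub>R weight Z + (\<Sum>Y\<in>\<Z>. (s(Z := t)) Y *\<^sub>R weight Y)"
      using f\<Z> new by simp
    also have "(\<Sum>Y\<in>\<Z>. (s(Z := t)) Y *\<^sub>R weight Y) = (\<Sum>Y\<in>\<Z>. s Y *\<^sub>R weight Y)"
      by (rule sum.cong) (use new in auto)
    also have "t *\<^sub>R weight Z + \<dots> = \<xi>" unfolding \<Z>(5)[symmetric] \<xi>'_def by simp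
    finally have sum: "\<xi> = (\<Sum>Y\<in>insert Z \<Z>. (s(Z := t)) Y *\<^sub>R weight Y)" by simp
    have 1: "insert Z \<Z> \<subseteq> Pow \<Delta>" using Z \<Z>(1) by blast
    have 2: "\<forall>X\<in>insert Z \<Z>. \<forall>Y\<in>insert Z \<Z>. X \<subseteq> Y \<or> Y \<subseteq> X" using big(1) \<Z>(2) by blast
    have 3: "\<forall>Y\<in>insert Z \<Z>. 0 \<le> (s(Z := t)) Y" using t0 \<Z>(3) by simp
    have 4: "\<forall>Y\<in>insert Z \<Z>. {\<alpha>\<in>\<Delta>. \<xi> \<bullet> \<alpha> = 0} \<subseteq> Y" using big(1) unfolding Z_def[symmetric] by blast
    show ?thesis using 1 2 3 4 sum by (intro exI[of _ "insert Z \<Z>"] exI[of _ "s(Z := t)"]) (intro conjI)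
  qed
qed

section \<open>Inequalities and incidences of permutonestohedra\<close>

definition hull_of_cells :: "('a set \<Rightarrow> real) \<Rightarrow> 'a set" where
  "hull_of_cells e = convex hull (\<Union>w\<in>W. w ` cell e)"

lemma permutonestohedron_eq: "permutonestohedron \<Phi> \<Delta> G \<epsilon> = hull_of_cells (level \<epsilon>)"
  unfolding permutonestohedron_def hull_of_cells_def chamber_nestohedron_eq ..

text \<open>The vertices are indexed by group elements and nested sets, the inequalities by group elements
  and subsets of \<open>\<Delta>\<close>. Which vertices lie on which hyperplanes does not involve the levels.\<close>

definition normal :: "('a \<Rightarrow> 'a) \<times> 'a set \<Rightarrow> 'a" where
  "normal i = fst i (weight (snd i))"

definition vertex_index :: "(('a \<Rightarrow> 'a) \<times> 'a set set) set" where
  "vertex_index = W \<times> {S. cnested S \<and> \<Delta> \<in> S}"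

text \<open>Normals are compared as vectors, since different group elements may carry a weight to
  the same vector.\<close>

definition incidence :: "('a \<Rightarrow> 'a) \<times> 'a set set \<Rightarrow> (('a \<Rightarrow> 'a) \<times> 'a set) set" where
  "incidence j = {i\<in>W \<times> Pow \<Delta>. normal i = fst j (weight (snd i)) \<and> components (snd i) \<subseteq> snd j}"

definition tight_family :: "(('a \<Rightarrow> 'a) \<times> 'a set) set set" where
  "tight_family = {\<Inter>j\<in>K. incidence j | K. K \<subseteq> vertex_index \<and> K \<noteq> {}}"

lemma group_inner_shift:
  assumes "w \<in> W" shows "\<exists>u\<in>W. (\<forall>x. u (w x) = x) \<and> (\<forall>x y. w x \<bullet> y = x \<bullet> u y) \<and> (\<forall>x. w (u x) = x)"
proof -
  obtain u where u: "u \<in> W" "\<forall>x. u (w x) = x" "\<forall>x. w (u x) = x" using group_inverse[OF assms] by blast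
  have "w x \<bullet> y = x \<bullet> u y" for x y using group_props(2)[OF u(1), of "w x" y] u(2) by simp
  then show ?thesis using u by blast
qed

theorem hull_of_cells_polyhedron:
  assumes e: "admissible e"
  shows "hull_of_cells e = {x\<in>span \<Phi>. \<forall>i\<in>W \<times> Pow \<Delta>. x \<bullet> normal i \<le> bound e (snd i)}" (is ?hull)
    and "(\<lambda>x. {i\<in>W \<times> Pow \<Delta>. x \<bullet> normal i = bound e (snd i)}) ` hull_of_cells e = tight_family" (is ?tight)
proof -
  interpret p: polyhedron_by "span \<Phi>" "W \<times> Pow \<Delta>" "\<lambda>i x. x \<bullet> normal i" "\<lambda>i. bound e (snd i)"
  proof (rule polyhedron_by.intro)
    show "affine (span \<Phi>)" by (rule subspace_imp_affine[OF subspace_span])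
    show "finite (W \<times> Pow \<Delta>)" using finite_group finite_simple by simp
    show "linear (\<lambda>x. x \<bullet> normal i)" for i by (rule bounded_linear.linear[OF bounded_linear_inner_left])
  qed
  define v where "v S = (SOME x. x \<in> cell e \<and> (\<forall>A\<in>bs. x \<bullet> hs A = e A \<longleftrightarrow> A \<in> S))" for S
  have v: "v S \<in> cell e" "\<forall>A\<in>bs. v S \<bullet> hs A = e A \<longleftrightarrow> A \<in> S" if "cnested S" "\<Delta> \<in> S" for S
    using someI_ex[of "\<lambda>x. x \<in> cell e \<and> (\<forall>A\<in>bs. x \<bullet> hs A = e A \<longleftrightarrow> A \<in> S)"]
      exists_cell_point[OF e that] unfolding v_def by blast+
  define vv where "vv j = fst j (v (snd j))" for j :: "('a \<Rightarrow> 'a) \<times> 'a set set"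
  have fJ: "finite vertex_index"
  proof -
    have "{S. cnested S \<and> \<Delta> \<in> S} \<subseteq> Pow bs" unfolding cnested_def by blast
    then show ?thesis unfolding vertex_index_def using finite_group finite_bs
      by (meson finite_Pow_iff finite_SigmaI finite_subset)
  qed
  have cell_dom: "dominant x" if "x \<in> cell e" for x
    using cell_positive[OF e that] by (simp add: less_imp_le)
  have in_body: "w x \<in> p.body" if w: "w \<in> W" and x: "x \<in> cell e" for w x
  proof -
    obtain u where u: "u \<in> W" "\<forall>x y. w x \<bullet> y = x \<bullet> u y" using group_inner_shift[OF w] by blast
    have "w x \<bullet> normal i \<le> bound e (snd i)" if i: "i \<in> W \<times> Pow \<Delta>" for i
    proof -
      have Z: "snd i \<subseteq> \<Delta>" using i by auto
      have "w x \<bullet> normal i = x \<bullet> (u \<circ> fst i) (weight (snd i))" using u(2) unfolding normal_def by simp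
      also have "\<dots> \<le> x \<bullet> weight (snd i)"
        by (rule dominant_inner_le[OF cell_dom[OF x] weight_dominant[OF Z] group_comp[OF u(1)]]) (use i in auto)
      also have "\<dots> \<le> bound e (snd i)" by (rule cell_weight(1)[OF x Z])
      finally show ?thesis .
    qed
    moreover have "w x \<in> span \<Phi>" using group_span[OF w] x unfolding cell_def by blast
    ultimately show ?thesis unfolding p.body_def by blast
  qed
  have le1: "hull_of_cells e \<subseteq> p.body"
    unfolding hull_of_cells_def by (rule hull_minimal) (use in_body p.convex_body in auto)
  have vcell: "vv j \<in> (\<Union>w\<in>W. w ` cell e)" if "j \<in> vertex_index" for j
    unfolding vv_def
    by (rule UN_I[of "fst j"], use that in \<open>auto simp: vertex_index_def\<close>)
      (use that v(1) in \<open>auto simp: vertex_index_def\<close>)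
  then have le2: "convex hull (vv ` vertex_index) \<subseteq> hull_of_cells e"
    unfolding hull_of_cells_def by (intro hull_mono) auto
  have vbody: "vv ` vertex_index \<subseteq> p.body"
    using in_body v unfolding vv_def vertex_index_def by auto
  have le3: "p.body \<subseteq> convex hull (vv ` vertex_index)"
  proof
    fix x assume x: "x \<in> p.body"
    show "x \<in> convex hull (vv ` vertex_index)"
    proof (rule ccontr)
      assume "x \<notin> convex hull (vv ` vertex_index)"
      moreover have "closed (convex hull (vv ` vertex_index))"
        using fJ by (intro compact_imp_closed finite_imp_compact_convex_hull) simp
      ultimately obtain a b where ab: "a \<bullet> x < b" "\<forall>y\<in>convex hull (vv ` vertex_index). b < a \<bullet> y"
        using separating_hyperplane_closed_point[OF convex_convex_hull] by blast
      \<comment> \<open>Only the values of the functional on \<open>span \<Phi>\<close> matter. The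
        sign is reversed because the separation puts \<open>x\<close> on the side where
        \<open>a\<close> is small, while \<open>p\<close> should be large at
        \<open>x\<close>.\<close>
      obtain p q where pq: "p \<in> span \<Phi>" "\<And>z. z \<in> span \<Phi> \<Longrightarrow> orthogonal q z" "- a = p + q"
        using orthogonal_subspace_decomp_exists[of \<Phi> "- a"] by metis
      have p: "z \<bullet> p = - (a \<bullet> z)" if "z \<in> span \<Phi>" for z
      proof -
        have "(- a) \<bullet> z = p \<bullet> z" unfolding pq(3) using pq(2)[OF that] by (simp add: inner_add_left orthogonal_def)
        then show ?thesis by (simp add: inner_commute)
      qed
      obtain w where w: "w \<in> W" "dominant (w p)" using exists_dominant by blast
      obtain u where u: "u \<in> W" "\<forall>x. u (w x) = x" "\<forall>x y. w x \<bullet> y = x \<bullet> u y" "\<forall>x. w (u x) = x"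
        using group_inner_shift[OF w(1)] by blast
      obtain \<Z> t where \<Z>: "\<Z> \<subseteq> Pow \<Delta>" "\<forall>Y\<in>\<Z>. \<forall>Z\<in>\<Z>. Y \<subseteq> Z \<or> Z \<subseteq> Y" "\<forall>Z\<in>\<Z>. 0 \<le> t Z"
        "w p = (\<Sum>Z\<in>\<Z>. t Z *\<^sub>R weight Z)"
        using dominant_decomposition[OF group_span[OF w(1) pq(1)] w(2)]
        by (elim exE conjE) (rule that; assumption)
      \<comment> \<open>The cell point with tight set \<open>S\<close> attains
        \<open>bound e Z\<close> for all \<open>Z\<close> of the chain at once, so its image under
        \<open>u\<close> has at least the inner product with \<open>p\<close> that \<open>x\<close>
        has.\<close>
      define S where "S = insert \<Delta> (\<Union>(components ` \<Z>))"
      have S: "cnested S" "\<Delta> \<in> S"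
        unfolding S_def using cnested_insert_top[OF cnested_chain[OF \<Z>(1)]] \<Z>(2) by auto
      have xs: "x \<in> span \<Phi>" using x unfolding p.body_def by blast
      have "x \<bullet> p = w x \<bullet> w p" using group_props(2)[OF w(1)] by simp
      also have "\<dots> = (\<Sum>Z\<in>\<Z>. t Z * (w x \<bullet> weight Z))" unfolding \<Z>(4) by (simp add: inner_sum_right)
      also have "\<dots> \<le> (\<Sum>Z\<in>\<Z>. t Z * bound e Z)"
      proof (rule sum_mono)
        fix Z assume Z: "Z \<in> \<Z>"
        have "w x \<bullet> weight Z = x \<bullet> normal (u, Z)" using u(3) unfolding normal_def by simp
        also have "\<dots> \<le> bound e Z" using x u(1) Z \<Z>(1) unfolding p.body_def by auto
        finally show "t Z * (w x \<bullet> weight Z) \<le> t Z * bound e Z" using \<Z>(3) Z by (simp add: mult_left_mono)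
      qed
      also have "\<dots> = (\<Sum>Z\<in>\<Z>. t Z * (v S \<bullet> weight Z))"
      proof (rule sum.cong)
        fix Z assume Z: "Z \<in> \<Z>"
        then have "Z \<subseteq> \<Delta>" using \<Z>(1) by blast
        moreover have "components Z \<subseteq> {A\<in>bs. v S \<bullet> hs A = e A}"
          using v(2)[OF S] components_mem[OF \<open>Z \<subseteq> \<Delta>\<close>] Z unfolding S_def by auto
        ultimately have "v S \<bullet> weight Z = bound e Z" using cell_weight(2)[OF v(1)[OF S]] by blast
        then show "t Z * bound e Z = t Z * (v S \<bullet> weight Z)" by simp
      qed simp
      also have "\<dots> = v S \<bullet> w p" unfolding \<Z>(4) by (simp add: inner_sum_right)
      also have "\<dots> = u (v S) \<bullet> p" using u(3) by (simp add: inner_commute)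
      finally have "x \<bullet> p \<le> vv (u, S) \<bullet> p" unfolding vv_def by simp
      moreover have J: "(u, S) \<in> vertex_index" unfolding vertex_index_def using u(1) S by simp
      moreover have "vv (u, S) \<in> span \<Phi>" using vbody J unfolding p.body_def by blast
      ultimately have "a \<bullet> vv (u, S) \<le> a \<bullet> x" using p[OF xs] p[of "vv (u, S)"] by simp
      moreover have "b < a \<bullet> vv (u, S)" using ab(2) hull_inc[of "vv (u, S)"] J by blast
      ultimately show False using ab(1) by linarith
    qed
  qed
  have body: "hull_of_cells e = p.body" "p.body = convex hull (vv ` vertex_index)"
    using le1 le2 le3 by auto
  then show ?hull unfolding p.body_def by simp
  have inc: "p.tight (vv j) = incidence j" if j: "j \<in> vertex_index" for j
  proof -
    obtain w S where wS: "j = (w, S)" "w \<in> W" "cnested S" "\<Delta> \<in> S"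
      using j unfolding vertex_index_def by auto
    obtain u where u: "u \<in> W" "\<forall>x. u (w x) = x" "\<forall>x y. w x \<bullet> y = x \<bullet> u y" "\<forall>x. w (u x) = x"
      using group_inner_shift[OF wS(2)] by blast
    note vS = v[OF wS(3,4)]
    have Sbs: "S \<subseteq> bs" using wS(3) unfolding cnested_def by blast
    have tS: "{A\<in>bs. v S \<bullet> hs A = e A} = S" using vS(2) Sbs by auto
    have "vv j \<bullet> normal i = bound e (snd i) \<longleftrightarrow>
        normal i = w (weight (snd i)) \<and> components (snd i) \<subseteq> S" if i: "i \<in> W \<times> Pow \<Delta>" for i
    proof -
      have Z: "snd i \<subseteq> \<Delta>" using i by auto
      have uw: "u \<circ> fst i \<in> W" using group_comp[OF u(1)] i by auto
      have 1: "vv j \<bullet> normal i = v S \<bullet> (u \<circ> fst i) (weight (snd i))"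
        unfolding vv_def wS(1) normal_def using u(3) by simp
      have 2: "\<dots> \<le> v S \<bullet> weight (snd i)"
        by (rule dominant_inner_le[OF cell_dom[OF vS(1)] weight_dominant[OF Z] uw])
      have 3: "v S \<bullet> weight (snd i) \<le> bound e (snd i)" by (rule cell_weight(1)[OF vS(1) Z])
      \<comment> \<open>Attaining the bound forces equality in both estimates. As cell points are
        strictly dominant, the first equality identifies two vectors; the second says that the
        components are tight. Neither condition involves the levels.\<close>
      have "vv j \<bullet> normal i = bound e (snd i) \<longleftrightarrow>
          v S \<bullet> (u \<circ> fst i) (weight (snd i)) = v S \<bullet> weight (snd i) \<and> v S \<bullet> weight (snd i) = bound e (snd i)"
        using 1 2 3 by linarith
      also have "v S \<bullet> (u \<circ> fst i) (weight (snd i)) = v S \<bullet> weight (snd i) \<longleftrightarrow>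
          (u \<circ> fst i) (weight (snd i)) = weight (snd i)"
        using dominant_inner_eq[OF _ weight_dominant[OF Z] uw, of "v S"] cell_positive[OF e vS(1)] by auto
      also have "\<dots> \<longleftrightarrow> normal i = w (weight (snd i))"
        unfolding normal_def comp_def using u(2,4) by metis
      also have "v S \<bullet> weight (snd i) = bound e (snd i) \<longleftrightarrow> components (snd i) \<subseteq> S"
        using cell_weight(2)[OF vS(1) Z] unfolding tS .
      finally show ?thesis .
    qed
    then show ?thesis unfolding p.tight_def incidence_def wS(1) by auto
  qed
  have "p.tight ` p.body = {\<Inter>j\<in>K. p.tight (vv j) | K. K \<subseteq> vertex_index \<and> K \<noteq> {}}"
    by (rule p.tight_convex_hull[OF fJ vbody body(2)])
  also have "\<dots> = tight_family"
  proof -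
    have "(\<Inter>j\<in>K. p.tight (vv j)) = (\<Inter>j\<in>K. incidence j)" if "K \<subseteq> vertex_index" for K
      by (rule INF_cong) (use inc that in auto)
    then show ?thesis unfolding tight_family_def by (intro Collect_cong) (metis (no_types, lifting))
  qed
  finally show ?tight unfolding body(1) p.tight_def .
qed

end

section \<open>Building sets and subsystems\<close>

lemma maximal_in_cover:
  assumes "finite G" "X \<in> G" "X \<subseteq> C"
  shows "\<exists>M\<in>maximal_in G C. X \<subseteq> M"
proof -
  have "finite {A\<in>G. A \<subseteq> C \<and> X \<subseteq> A}" "{A\<in>G. A \<subseteq> C \<and> X \<subseteq> A} \<noteq> {}" using assms by auto
  from finite_has_maximal[OF this] obtain M where M: "M \<in> {A\<in>G. A \<subseteq> C \<and> X \<subseteq> A}"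
    "\<forall>A\<in>{A\<in>G. A \<subseteq> C \<and> X \<subseteq> A}. M \<subseteq> A \<longrightarrow> M = A" ..
  then have "M \<in> maximal_in G C" unfolding maximal_in_def by (auto dest: order_trans)
  then show ?thesis using M(1) by auto
qed

lemma direct_sum_of_disjoint:
  fixes \<M> :: "'a::euclidean_space set set"
  assumes ds: "direct_sum_of \<M> C" and sub: "\<And>M. M \<in> \<M> \<Longrightarrow> subspace M"
    and M: "M \<in> \<M>" "N \<in> \<M>" "M \<noteq> N" and v: "v \<in> M" "v \<in> N"
  shows "v = 0"
proof -
  have fin: "finite \<M>" and ind: "\<And>f. \<forall>A\<in>\<M>. f A \<in> A \<Longrightarrow> (\<Sum>A\<in>\<M>. f A) = 0 \<Longrightarrow> \<forall>A\<in>\<M>. f A = 0"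
    using ds unfolding direct_sum_of_def by auto
  define f where "f A = (if A = M then v else if A = N then - v else 0)" for A
  have "\<forall>A\<in>\<M>. f A \<in> A" unfolding f_def using v M subspace_neg[OF sub] subspace_0[OF sub] by auto
  moreover have "(\<Sum>A\<in>\<M>. f A) = 0"
  proof -
    have "(\<Sum>A\<in>\<M>. f A) = f M + (f N + (\<Sum>A\<in>\<M> - {M} - {N}. f A))"
      using sum.remove[OF fin M(1), of f] sum.remove[of "\<M> - {M}" N f] fin M by simp
    also have "(\<Sum>A\<in>\<M> - {M} - {N}. f A) = 0" by (rule sum.neutral) (auto simp: f_def)
    finally show ?thesis using M(3) by (simp add: f_def)
  qed
  ultimately have "f M = 0" using ind M(1) by blast
  then show ?thesis unfolding f_def by simp
qed

text \<open>The members of the decomposition are spanned by subsets of \<open>Z\<close> because each line through an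
  element of \<open>Z\<close> lies in one of them.\<close>

lemma direct_sum_of_span_parts:
  fixes Z :: "'a::euclidean_space set"
  assumes Z: "finite Z" and ds: "direct_sum_of \<M> (span Z)" and sub: "\<And>M. M \<in> \<M> \<Longrightarrow> subspace M"
    and sp: "\<And>M. M \<in> \<M> \<Longrightarrow> M \<subseteq> span Z"
    and cover: "\<And>\<alpha>. \<alpha> \<in> Z \<Longrightarrow> \<exists>M\<in>\<M>. \<alpha> \<in> M" and M: "M \<in> \<M>"
  shows "M = span (Z \<inter> M)"
proof
  show "span (Z \<inter> M) \<subseteq> M" by (rule span_minimal[OF _ sub[OF M]]) blast
  have fin: "finite \<M>" and ind: "\<And>f. \<forall>A\<in>\<M>. f A \<in> A \<Longrightarrow> (\<Sum>A\<in>\<M>. f A) = 0 \<Longrightarrow> \<forall>A\<in>\<M>. f A = 0"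
    using ds unfolding direct_sum_of_def by auto
  obtain m where m: "\<And>\<alpha>. \<alpha> \<in> Z \<Longrightarrow> m \<alpha> \<in> \<M>" "\<And>\<alpha>. \<alpha> \<in> Z \<Longrightarrow> \<alpha> \<in> m \<alpha>" using cover by metis
  show "M \<subseteq> span (Z \<inter> M)"
  proof
    fix x assume x: "x \<in> M"
    then obtain c where c: "x = (\<Sum>\<alpha>\<in>Z. c \<alpha> *\<^sub>R \<alpha>)" using sp[OF M] span_finite[OF Z] by auto
    \<comment> \<open>Each element of \<open>Z\<close> is assigned to one summand containing it, and
      \<open>g N\<close> collects the terms of \<open>x\<close> assigned to
      \<open>N\<close>.\<close>
    define g where "g N = (\<Sum>\<alpha>\<in>{\<alpha>\<in>Z. m \<alpha> = N}. c \<alpha> *\<^sub>R \<alpha>)" for N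
    have g: "g N \<in> N" if "N \<in> \<M>" for N
      unfolding g_def by (rule subspace_sum[OF sub[OF that]]) (use m(2) subspace_scale[OF sub[OF that]] in auto)
    have gx: "(\<Sum>N\<in>\<M>. g N) = x"
      unfolding g_def c by (rule sum.group[OF Z fin]) (use m(1) in auto)
    \<comment> \<open>Two decompositions of \<open>x\<close> are compared: the one by
      \<open>g\<close>, and the trivial one with \<open>x\<close> itself in \<open>M\<close>. Their
      difference vanishes in every summand.\<close>
    define f where "f N = (if N = M then g M - x else g N)" for N
    have "\<forall>N\<in>\<M>. f N \<in> N" unfolding f_def using g subspace_diff[OF sub[OF M] g[OF M] x] by auto
    moreover have "(\<Sum>N\<in>\<M>. f N) = 0"
    proof -
      have "(\<Sum>N\<in>\<M>. f N) = f M + (\<Sum>N\<in>\<M> - {M}. f N)" by (rule sum.remove[OF fin M])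
      also have "(\<Sum>N\<in>\<M> - {M}. f N) = (\<Sum>N\<in>\<M> - {M}. g N)" by (rule sum.cong) (auto simp: f_def)
      also have "f M + \<dots> = (\<Sum>N\<in>\<M>. g N) - x" unfolding f_def using sum.remove[OF fin M, of g] by simp
      finally show ?thesis using gx by simp
    qed
    ultimately have "f M = 0" using ind M by blast
    then have "x = g M" unfolding f_def by simp
    moreover have "g M \<in> span (Z \<inter> M)"
      unfolding g_def by (rule span_sum) (use m(2) in \<open>auto intro: span_scale span_base\<close>)
    ultimately show "x \<in> span (Z \<inter> M)" by simp
  qed
qed

text \<open>The maximal members of \<open>G\<close> inside \<open>span Z\<close> form a direct sum.
  Members sharing a simple root must lie in the same summand, which gives closure under overlapping
  unions; a root of \<open>span Z\<close> lies in one summand, and this summand is spanned by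
  elements of \<open>Z\<close>.\<close>

lemma nested_root_system_of_building_set:
  fixes \<Phi> \<Delta> :: "'a::euclidean_space set"
  assumes "root_system \<Phi>" "simple_roots \<Phi> \<Delta>" and G: "building_set_of \<Phi> G" and top: "span \<Phi> \<in> G"
  shows "nested_root_system \<Phi> \<Delta> G"
proof -
  interpret root_basis \<Phi> \<Delta> by (rule root_basis.intro) fact+
  have fG: "finite G" and Gsub: "\<And>A. A \<in> G \<Longrightarrow> subspace A" and G0: "\<And>A. A \<in> G \<Longrightarrow> A \<noteq> {0}"
    and dir: "\<And>C. C \<in> sum_closure G \<Longrightarrow> direct_sum_of (maximal_in G C) C"
    and line: "\<And>\<alpha>. \<alpha> \<in> \<Phi> \<Longrightarrow> span {\<alpha>} \<in> G"
    using G unfolding building_set_of_def building_set_def by auto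
  have maxG: "M \<in> G" "M \<subseteq> C" if "M \<in> maximal_in G C" for M C
    using that unfolding maximal_in_def by auto
  have ds: "direct_sum_of (maximal_in G (span Z)) (span Z)" if Z: "Z \<subseteq> \<Delta>" "Z \<noteq> {}" for Z
  proof (rule dir)
    have fZ: "finite Z" using Z(1) finite_simple finite_subset by blast
    have "\<Sum>(span ` (\<lambda>\<alpha>. {\<alpha>}) ` Z) = span (\<Union>((\<lambda>\<alpha>. {\<alpha>}) ` Z))"
      by (rule sum_spans) (use fZ in simp)
    then have "span Z = \<Sum>(span ` (\<lambda>\<alpha>. {\<alpha>}) ` Z)" by simp
    moreover have "span ` (\<lambda>\<alpha>. {\<alpha>}) ` Z \<subseteq> G" using line Z(1) simple_sub by auto
    ultimately show "span Z \<in> sum_closure G" unfolding sum_closure_def using fZ Z(2) by blast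
  qed
  have parts: "M = span (Z \<inter> M)" if Z: "Z \<subseteq> \<Delta>" "Z \<noteq> {}" and M: "M \<in> maximal_in G (span Z)" for Z M
  proof (rule direct_sum_of_span_parts[OF _ ds[OF Z] _ _ _ M])
    show "finite Z" using Z(1) finite_simple finite_subset by blast
    show "subspace N" if "N \<in> maximal_in G (span Z)" for N using Gsub maxG(1)[OF that] by blast
    show "N \<subseteq> span Z" if "N \<in> maximal_in G (span Z)" for N using maxG(2)[OF that] .
    fix \<alpha> assume \<alpha>: "\<alpha> \<in> Z"
    have "span {\<alpha>} \<in> G" "span {\<alpha>} \<subseteq> span Z" using line Z(1) simple_sub \<alpha> span_mono[of "{\<alpha>}" Z] by auto
    from maximal_in_cover[OF fG this] show "\<exists>N\<in>maximal_in G (span Z). \<alpha> \<in> N"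
      using span_base[of \<alpha> "{\<alpha>}"] by blast
  qed
  show ?thesis
  proof
    show "span \<Phi> \<in> G" by (rule top)
    show "{0} \<notin> G" using G0 by blast
    show "span {\<alpha>} \<in> G" if "\<alpha> \<in> \<Delta>" for \<alpha> using line simple_sub that by blast
  next
    fix S T assume S: "S \<subseteq> \<Delta>" "T \<subseteq> \<Delta>" "span S \<in> G" "span T \<in> G" "S \<inter> T \<noteq> {}"
    let ?Z = "S \<union> T"
    have Z: "?Z \<subseteq> \<Delta>" "?Z \<noteq> {}" using S by auto
    obtain M where M: "M \<in> maximal_in G (span ?Z)" "span S \<subseteq> M"
      using maximal_in_cover[OF fG S(3), of "span ?Z"] span_mono[of S ?Z] by blast
    obtain N where N: "N \<in> maximal_in G (span ?Z)" "span T \<subseteq> N"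
      using maximal_in_cover[OF fG S(4), of "span ?Z"] span_mono[of T ?Z] by blast
    obtain \<alpha> where \<alpha>: "\<alpha> \<in> S" "\<alpha> \<in> T" using S(5) by blast
    have subs: "subspace X" if "X \<in> maximal_in G (span ?Z)" for X using Gsub[OF maxG(1)[OF that]] .
    have "M = N"
    proof (rule ccontr)
      assume "M \<noteq> N"
      moreover have "\<alpha> \<in> M" "\<alpha> \<in> N" using \<alpha> M(2) N(2) span_base[of \<alpha> S] span_base[of \<alpha> T] by auto
      ultimately have "\<alpha> = 0"
        using direct_sum_of_disjoint[OF ds[OF Z] subs M(1) N(1)] by blast
      then show False using simple_nonzero \<alpha> S by blast
    qed
    then have "?Z \<subseteq> M" using M(2) N(2) span_superset[of S] span_superset[of T] by blast
    then have "span ?Z \<subseteq> M" using span_minimal Gsub[OF maxG(1)[OF M(1)]] by blast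
    then have "M = span ?Z" using maxG(2)[OF M(1)] by blast
    then show "span (S \<union> T) \<in> G" using maxG(1)[OF M(1)] by simp
  next
    fix \<beta> Z assume \<beta>: "\<beta> \<in> \<Phi>" "Z \<subseteq> \<Delta>" "\<beta> \<in> span Z"
    have "Z \<noteq> {}" using \<beta> zero_root by auto
    have "span {\<beta>} \<subseteq> span Z" using \<beta>(3) by (simp add: span_minimal)
    from maximal_in_cover[OF fG line[OF \<beta>(1)] this] obtain M
      where M: "M \<in> maximal_in G (span Z)" "span {\<beta>} \<subseteq> M" by blast
    have "M = span (Z \<inter> M)" by (rule parts[OF \<beta>(2) \<open>Z \<noteq> {}\<close> M(1)])
    moreover have "\<beta> \<in> M" using M(2) span_base[of \<beta> "{\<beta>}"] by blast
    ultimately show "\<exists>S\<subseteq>Z. span S \<in> G \<and> \<beta> \<in> span S" using maxG(1)[OF M(1)] by (metis inf_le1)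
  qed
qed

section \<open>Subsystems spanned by simple roots\<close>

context root_basis
begin

lemma nonneg_comb_subset_iff:
  assumes S: "S \<subseteq> \<Delta>" and v: "v \<in> span S" shows "nonneg_comb S v \<longleftrightarrow> nonneg_comb \<Delta> v"
proof
  assume "nonneg_comb S v"
  then obtain c where c: "\<forall>\<alpha>\<in>S. 0 \<le> c \<alpha>" "v = (\<Sum>\<alpha>\<in>S. c \<alpha> *\<^sub>R \<alpha>)" unfolding nonneg_comb_def by blast
  have "v = (\<Sum>\<alpha>\<in>\<Delta>. (if \<alpha> \<in> S then c \<alpha> else 0) *\<^sub>R \<alpha>)"
    unfolding c(2) by (rule sum.mono_neutral_cong_left[OF finite_simple S]) auto
  then show "nonneg_comb \<Delta> v" unfolding nonneg_comb_def using c(1)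
    by (intro exI[of _ "\<lambda>\<alpha>. if \<alpha> \<in> S then c \<alpha> else 0"]) simp
next
  assume n: "nonneg_comb \<Delta> v"
  have vs: "v \<in> span \<Delta>" using n nonneg_comb_span by blast
  have "v = (\<Sum>\<alpha>\<in>S. coef v \<alpha> *\<^sub>R \<alpha>)"
    using coef_expand[OF vs] sum.mono_neutral_right[OF finite_simple S, of "\<lambda>\<alpha>. coef v \<alpha> *\<^sub>R \<alpha>"]
      coef_outside[OF S v] by simp
  then show "nonneg_comb S v" unfolding nonneg_comb_def using n S unfolding nonneg_comb_iff by blast
qed

lemma root_basis_subsystem:
  assumes S: "S \<subseteq> \<Delta>" shows "root_basis (\<Phi> \<inter> span S) S"
proof
  let ?A = "span S"
  have refl: "reflect \<alpha> \<beta> \<in> \<Phi> \<inter> ?A" if "\<alpha> \<in> \<Phi> \<inter> ?A" "\<beta> \<in> \<Phi> \<inter> ?A" for \<alpha> \<beta>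
  proof -
    have "reflect \<alpha> \<beta> \<in> ?A" unfolding reflect_def using that by (intro span_diff span_scale) auto
    then show ?thesis using reflect_root that by blast
  qed
  show "root_system (\<Phi> \<inter> ?A)" unfolding root_system_def
  proof (intro conjI ballI)
    show "finite (\<Phi> \<inter> ?A)" "0 \<notin> \<Phi> \<inter> ?A" using finite_roots zero_root by auto
  next
    fix \<alpha> assume \<alpha>: "\<alpha> \<in> \<Phi> \<inter> ?A"
    have "\<Phi> \<inter> span {\<alpha>} = {\<alpha>, - \<alpha>}" using root_system \<alpha> unfolding root_system_def by blast
    moreover have "- \<alpha> \<in> ?A" using \<alpha> span_neg by blast
    ultimately show "\<Phi> \<inter> ?A \<inter> span {\<alpha>} = {\<alpha>, - \<alpha>}" using \<alpha> by blast
  next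
    fix \<alpha> assume \<alpha>: "\<alpha> \<in> \<Phi> \<inter> ?A"
    show "reflect \<alpha> ` (\<Phi> \<inter> ?A) = \<Phi> \<inter> ?A"
    proof
      show "reflect \<alpha> ` (\<Phi> \<inter> ?A) \<subseteq> \<Phi> \<inter> ?A" using refl[OF \<alpha>] by blast
      show "\<Phi> \<inter> ?A \<subseteq> reflect \<alpha> ` (\<Phi> \<inter> ?A)"
      proof
        fix \<beta> assume "\<beta> \<in> \<Phi> \<inter> ?A"
        then have "reflect \<alpha> \<beta> \<in> \<Phi> \<inter> ?A" using refl[OF \<alpha>] by blast
        moreover have "\<alpha> \<noteq> 0" using \<alpha> root_nonzero by blast
        ultimately show "\<beta> \<in> reflect \<alpha> ` (\<Phi> \<inter> ?A)" using reflect_reflect[of \<alpha> \<beta>] by (metis imageI)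
      qed
    qed
  qed
  show "simple_roots (\<Phi> \<inter> ?A) S" unfolding simple_roots_def
  proof (intro conjI ballI)
    show "S \<subseteq> \<Phi> \<inter> ?A" using S simple_sub span_superset by blast
    show "independent S" by (rule independent_mono[OF indep S])
    fix \<beta> assume \<beta>: "\<beta> \<in> \<Phi> \<inter> ?A"
    then have "- \<beta> \<in> ?A" using span_neg by blast
    then show "nonneg_comb S \<beta> \<or> nonneg_comb S (- \<beta>)"
      using root_sign[of \<beta>] \<beta> nonneg_comb_subset_iff[OF S] by blast
  qed
qed

lemma half_sum_subsystem:
  assumes S: "S \<subseteq> \<Delta>" and C: "C \<subseteq> span S"
  shows "half_sum (\<Phi> \<inter> span S) S C = half_sum \<Phi> \<Delta> C"
proof -
  have "positive_roots (\<Phi> \<inter> span S) S \<inter> C = positive_roots \<Phi> \<Delta> \<inter> C"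
    unfolding positive_roots_def using nonneg_comb_subset_iff[OF S] C by blast
  then show ?thesis unfolding half_sum_def by simp
qed

lemma span_subsystem: "S \<subseteq> \<Delta> \<Longrightarrow> span (\<Phi> \<inter> span S) = span S"
proof
  show "span (\<Phi> \<inter> span S) \<subseteq> span S" by (rule span_minimal) auto
  show "span S \<subseteq> span (\<Phi> \<inter> span S)" if "S \<subseteq> \<Delta>"
    by (rule span_mono) (use that simple_sub span_superset in blast)
qed

lemma coeff_ratio_subsystem:
  assumes S: "S \<subseteq> \<Delta>" and A: "A \<subseteq> span S" "subspace A" and B: "B \<subseteq> span S" "subspace B"
  shows "coeff_ratio (\<Phi> \<inter> span S) S A B = coeff_ratio \<Phi> \<Delta> A B"
proof -
  have "S \<inter> B = \<Delta> \<inter> B" using span_inter_simple[OF S] S B(1) by blast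
  moreover have "representation S (half_sum \<Phi> \<Delta> C) = representation \<Delta> (half_sum \<Phi> \<Delta> C)"
    if "C \<subseteq> span S" "subspace C" for C
    using representation_extend[OF indep _ S, of "half_sum \<Phi> \<Delta> C"] half_sum_in[OF that(2)] that(1) by auto
  ultimately show ?thesis
    unfolding coeff_ratio_def half_sum_subsystem[OF S A(1)] half_sum_subsystem[OF S B(1)]
    using A B by simp
qed

text \<open>Half sums and coefficient ratios are the same in the subsystem, so its conditions are
  among those of the full system.\<close>

lemma suitable_subsystem:
  assumes S: "S \<subseteq> \<Delta>" and suit: "suitable \<Phi> \<Delta> G \<epsilon>"
  shows "suitable (\<Phi> \<inter> span S) S (restricted G (span S)) \<epsilon>"
proof -
  have fund: "A \<in> fundamental \<Delta> G \<and> A \<subseteq> span S \<and> subspace A"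
    if "A \<in> fundamental S (restricted G (span S))" for A
    using that S unfolding fundamental_def restricted_def by auto
  have "dim (\<Phi> \<inter> span S) \<le> dim \<Phi>" by (rule dim_subset) blast
  then have sub: "{1..dim (\<Phi> \<inter> span S)} \<subseteq> {1..dim \<Phi>}" by auto
  show ?thesis unfolding suitable_def
  proof (intro conjI ballI allI impI)
    show "0 < \<epsilon> i" if "i \<in> {1..dim (\<Phi> \<inter> span S)}" for i
      using suit that sub unfolding suitable_def by blast
    show "strict_mono_on {1..dim (\<Phi> \<inter> span S)} \<epsilon>"
      using suit sub unfolding suitable_def strict_mono_on_def by blast
    fix A T assume A: "A \<in> fundamental S (restricted G (span S))"
      and T: "T \<subseteq> fundamental S (restricted G (span S))"
        "2 \<le> card T \<and> \<Sum>T = A \<and> (\<forall>B\<in>T. \<Sum>(T - {B}) \<noteq> A)"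
    have "T \<subseteq> fundamental \<Delta> G" using T(1) fund by blast
    then have "(\<Sum>B\<in>T. coeff_ratio \<Phi> \<Delta> A B * \<epsilon> (dim B)) < \<epsilon> (dim A)"
      using suit[unfolded suitable_def, THEN conjunct2, THEN conjunct2, rule_format, of A T] T(2) fund[OF A] by blast
    moreover have "(\<Sum>B\<in>T. coeff_ratio (\<Phi> \<inter> span S) S A B * \<epsilon> (dim B)) = (\<Sum>B\<in>T. coeff_ratio \<Phi> \<Delta> A B * \<epsilon> (dim B))"
    proof (rule sum.cong)
      fix B assume "B \<in> T"
      then have "B \<subseteq> span S \<and> subspace B" using T(1) fund by blast
      then show "coeff_ratio (\<Phi> \<inter> span S) S A B * \<epsilon> (dim B) = coeff_ratio \<Phi> \<Delta> A B * \<epsilon> (dim B)"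
        using coeff_ratio_subsystem[OF S] fund[OF A] by simp
    qed simp
    ultimately show "(\<Sum>B\<in>T. coeff_ratio (\<Phi> \<inter> span S) S A B * \<epsilon> (dim B)) < \<epsilon> (dim A)" by simp
  qed
qed

end

context nested_root_system
begin

lemma subsystem:
  assumes S: "S \<in> bs" shows "nested_root_system (\<Phi> \<inter> span S) S (restricted G (span S))"
proof -
  have SD: "S \<subseteq> \<Delta>" using sub[OF S] .
  interpret s: root_basis "\<Phi> \<inter> span S" S by (rule root_basis_subsystem[OF SD])
  have mem: "span T \<in> restricted G (span S) \<longleftrightarrow> span T \<in> G" if "T \<subseteq> S" for T
    unfolding restricted_def using span_mono[OF that] by blast
  show ?thesis
  proof
    show "span (\<Phi> \<inter> span S) \<in> restricted G (span S)"
      unfolding span_subsystem[OF SD] mem[OF order_refl] using S unfolding bs_def by blast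
    show "{0} \<notin> restricted G (span S)" using zero_mem unfolding restricted_def by blast
    show "span {\<alpha>} \<in> restricted G (span S)" if "\<alpha> \<in> S" for \<alpha>
      using mem[of "{\<alpha>}"] line_mem SD that by blast
    show "span (T \<union> U) \<in> restricted G (span S)" if "T \<subseteq> S" "U \<subseteq> S" "span T \<in> restricted G (span S)"
      "span U \<in> restricted G (span S)" "T \<inter> U \<noteq> {}" for T U
      using union_mem[of T U] that mem[of T] mem[of U] mem[of "T \<union> U"] SD by blast
    show "\<exists>T\<subseteq>Z. span T \<in> restricted G (span S) \<and> \<beta> \<in> span T"
      if "\<beta> \<in> \<Phi> \<inter> span S" "Z \<subseteq> S" "\<beta> \<in> span Z" for \<beta> Z
    proof -
      have "\<beta> \<in> \<Phi>" "Z \<subseteq> \<Delta>" using that(1,2) SD by auto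
      from root_support[OF this that(3)] obtain T where T: "T \<subseteq> Z" "span T \<in> G" "\<beta> \<in> span T" by auto
      moreover have "T \<subseteq> S" using T(1) that(2) by simp
      ultimately show ?thesis using mem[of T] by auto
    qed
  qed
qed

text \<open>The chamber nestohedron of the subsystem of \<open>S\<close>, written with the half sums
  of the full system.\<close>

definition subcell :: "('a set \<Rightarrow> real) \<Rightarrow> 'a set \<Rightarrow> 'a set" where
  "subcell e S = {x\<in>span S. x \<bullet> hs S = e S \<and> (\<forall>T\<in>bs. T \<subseteq> S \<longrightarrow> e T \<le> x \<bullet> hs T)}"

lemma permutonestohedron_subsystem:
  assumes S: "S \<in> bs"
  shows "permutonestohedron (\<Phi> \<inter> span S) S (restricted G (span S)) \<epsilon> =
    convex hull (\<Union>g\<in>reflection_group (\<Phi> \<inter> span S). g ` subcell (level \<epsilon>) S)"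
proof -
  have SD: "S \<subseteq> \<Delta>" using sub[OF S] .
  interpret s: nested_root_system "\<Phi> \<inter> span S" S "restricted G (span S)" by (rule subsystem[OF S])
  have sbs: "s.bs = {T\<in>bs. T \<subseteq> S}"
    unfolding s.bs_def bs_def using SD span_mono[of _ S] by (auto simp: restricted_def)
  have h: "s.hs T = hs T" if "T \<subseteq> S" for T by (rule half_sum_subsystem[OF SD span_mono[OF that]])
  have "s.cell (level \<epsilon>) = subcell (level \<epsilon>) S"
    unfolding s.cell_def subcell_def span_subsystem[OF SD] sbs using h by auto
  then show ?thesis unfolding s.permutonestohedron_eq s.hull_of_cells_def by simp
qed

end

text \<open>All factors are treated at once as one polyhedron in \<open>'p ^ 'k\<close>. Its index
  set is the disjoint union of those of the factors, and tightness is decided in each coordinate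
  separately.\<close>

lemma face_poset_product:
  fixes L :: "'k::finite \<Rightarrow> 'p::euclidean_space set" and a :: "'k \<Rightarrow> 'i \<Rightarrow> 'p \<Rightarrow> real"
  assumes poly: "\<And>i. polyhedron_by (L i) (I i) (a i)"
    and P: "\<And>i. P i = {x\<in>L i. \<forall>j\<in>I i. a i j x \<le> b i j}"
    and \<T>: "\<And>i. (\<lambda>x. {j\<in>I i. a i j x = b i j}) ` P i = \<T> i"
  shows "face_poset {y::'p ^ 'k. \<forall>i. y $ i \<in> P i} {Sigma UNIV X | X. \<forall>i. X i \<in> \<T> i}"
proof -
  interpret p: polyhedron_by "{y::'p ^ 'k. \<forall>i. y $ i \<in> L i}" "Sigma UNIV I"
    "\<lambda>s y. a (fst s) (snd s) (y $ fst s)" "\<lambda>s. b (fst s) (snd s)"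
  proof (rule polyhedron_by.intro)
    show "affine {y::'p ^ 'k. \<forall>i. y $ i \<in> L i}"
      using polyhedron_by.affine[OF poly] unfolding affine_def by simp
    show "finite (Sigma UNIV I)" using polyhedron_by.finite_I[OF poly] by simp
    fix s assume "s \<in> Sigma UNIV I"
    then have "linear (a (fst s) (snd s))" using polyhedron_by.linear_a[OF poly] by auto
    then show "linear (\<lambda>y. a (fst s) (snd s) (y $ fst s))"
      by (intro linearI) (simp_all add: linear_add linear_scale)
  qed
  have body: "p.body = {y. \<forall>i. y $ i \<in> P i}" unfolding p.body_def P by auto
  have t: "p.tight y = Sigma UNIV (\<lambda>i. {j\<in>I i. a i j (y $ i) = b i j})" for y
    unfolding p.tight_def by auto
  have "p.tight ` p.body = {Sigma UNIV X | X. \<forall>i. X i \<in> \<T> i}"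
  proof (intro subset_antisym subsetI)
    fix Y assume "Y \<in> p.tight ` p.body"
    then obtain y where "\<forall>i. y $ i \<in> P i" "Y = p.tight y" unfolding body by blast
    then show "Y \<in> {Sigma UNIV X | X. \<forall>i. X i \<in> \<T> i}"
      unfolding t using \<T> by (auto intro!: exI[of _ "\<lambda>i. {j\<in>I i. a i j (y $ i) = b i j}"])
  next
    fix Y assume "Y \<in> {Sigma UNIV X | X. \<forall>i. X i \<in> \<T> i}"
    then obtain X where X: "Y = Sigma UNIV X" "\<forall>i. X i \<in> \<T> i" by blast
    have "\<forall>i. \<exists>x\<in>P i. X i = {j\<in>I i. a i j x = b i j}" using X(2) unfolding \<T>[symmetric] by auto
    then obtain x where x: "\<And>i. x i \<in> P i" "\<And>i. X i = {j\<in>I i. a i j (x i) = b i j}" by metis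
    have "p.tight (\<chi> i. x i) = Y" unfolding t X(1) using x(2)[symmetric] by simp
    moreover have "(\<chi> i. x i) \<in> p.body" unfolding body using x(1) by simp
    ultimately show "Y \<in> p.tight ` p.body" by blast
  qed
  then show ?thesis using p.face_poset_tight unfolding body by simp
qed

text \<open>The family of labels does not mention the lists, which is what allows one suitable
  choice of them to be exchanged for another.\<close>

lemma permutonestohedra_product_face_poset:
  fixes \<Psi> :: "'k::finite \<Rightarrow> 'a::euclidean_space set"
  assumes inst: "\<And>i. nested_root_system (\<Psi> i) (D i) (H i)"
    and suit: "\<And>i. suitable (\<Psi> i) (D i) (H i) (\<epsilon> i)"
  shows "face_poset {y::'a ^ 'k. \<forall>i. y $ i \<in> permutonestohedron (\<Psi> i) (D i) (H i) (\<epsilon> i)}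
    {Sigma UNIV X | X. \<forall>i. X i \<in> nested_root_system.tight_family (\<Psi> i) (D i) (H i)}"
proof -
  define e where "e i S = \<epsilon> i (dim (span S))" for i and S :: "'a set"
  let ?I = "\<lambda>i. reflection_group (\<Psi> i) \<times> Pow (D i)"
  let ?n = "\<lambda>i. nested_root_system.normal (\<Psi> i) (D i)"
  let ?b = "\<lambda>i j. nested_root_system.bound (D i) (H i) (e i) (snd j)"
  have adm: "weighted_building.admissible (nested_root_system.bs (D i) (H i))
      (\<lambda>S. representation (D i) (half_sum (\<Psi> i) (D i) (span S))) (e i)" for i
    unfolding e_def by (rule nested_root_system.suitable_admissible[OF inst suit])
  have eq: "permutonestohedron (\<Psi> i) (D i) (H i) (\<epsilon> i) =
      nested_root_system.hull_of_cells (\<Psi> i) (D i) (H i) (e i)" for i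
    unfolding e_def by (rule nested_root_system.permutonestohedron_eq[OF inst])
  show ?thesis
  proof (rule face_poset_product[where L = "\<lambda>i. span (\<Psi> i)" and I = ?I and a = "\<lambda>i j x. x \<bullet> ?n i j" and b = ?b])
    fix i
    interpret s: nested_root_system "\<Psi> i" "D i" "H i" by (rule inst)
    show "polyhedron_by (span (\<Psi> i)) (?I i) (\<lambda>j x. x \<bullet> ?n i j)"
    proof (rule polyhedron_by.intro)
      show "affine (span (\<Psi> i))" by (rule subspace_imp_affine[OF subspace_span])
      show "finite (?I i)" using s.finite_group s.finite_simple by simp
      show "linear (\<lambda>x. x \<bullet> ?n i j)" for j by (rule bounded_linear.linear[OF bounded_linear_inner_left])
    qed
    show "permutonestohedron (\<Psi> i) (D i) (H i) (\<epsilon> i) =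
        {x\<in>span (\<Psi> i). \<forall>j\<in>?I i. x \<bullet> ?n i j \<le> ?b i j}"
      unfolding eq by (rule s.hull_of_cells_polyhedron(1)[OF adm])
    show "(\<lambda>x. {j\<in>?I i. x \<bullet> ?n i j = ?b i j}) ` permutonestohedron (\<Psi> i) (D i) (H i) (\<epsilon> i) = s.tight_family"
      unfolding eq by (rule s.hull_of_cells_polyhedron(2)[OF adm])
  qed
qed

section \<open>The quotient building set\<close>

lemma subspace_plus_self:
  assumes "subspace D" shows "D + D = D"
proof
  show "D + D \<subseteq> D" using subspace_add[OF assms] unfolding set_plus_def by blast
  show "D \<subseteq> D + D"
  proof
    fix x assume "x \<in> D"
    then have "x + 0 \<in> D + D" using subspace_0[OF assms] by (rule set_plus_intro)
    then show "x \<in> D + D" by simp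
  qed
qed

lemma quotient_space_subset_iff:
  assumes D: "subspace D" and U: "subspace U'" "D \<subseteq> U'"
  shows "quotient_space U D \<subseteq> quotient_space U' D \<longleftrightarrow> U \<subseteq> U'"
proof
  assume sub: "quotient_space U D \<subseteq> quotient_space U' D"
  show "U \<subseteq> U'"
  proof
    fix x assume "x \<in> U"
    then have "x +o D \<in> quotient_space U' D" using sub unfolding quotient_space_def by blast
    then obtain x' where x': "x' \<in> U'" "x +o D = x' +o D" unfolding quotient_space_def by blast
    have "x + 0 \<in> x +o D" using subspace_0[OF D] by (rule set_plus_intro2)
    then obtain d where "d \<in> D" "x + 0 = x' + d" unfolding x'(2) by (auto simp: elt_set_plus_def)
    then show "x \<in> U'" using x'(1) U subspace_add[OF U(1)] by auto
  qed
qed (auto simp: quotient_space_def)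

lemma quotient_space_plus:
  assumes D: "subspace D"
  shows "quotient_space U D + quotient_space U' D = quotient_space (U + U') D"
proof -
  have "(x +o D) + (y +o D) = (x + y) +o D" for x y
    by (simp add: set_plus_rearrange subspace_plus_self[OF D])
  then show ?thesis unfolding quotient_space_def set_plus_def[of "{x +o D |x. x \<in> U}"]
    unfolding set_plus_def[of U] by fastforce
qed

context nested_root_system
begin

text \<open>A subset \<open>X\<close> of \<open>\<Delta>\<close> containing \<open>D\<close> encodes the subspace spanned by \<open>X\<close> modulo that spanned by \<open>D\<close>.\<close>

definition quot :: "'a set \<Rightarrow> 'a set \<Rightarrow> 'a set set" where
  "quot D X = quotient_space (span (X \<union> D)) (span D)"

lemma quot_subset_iff:
  assumes "D \<subseteq> \<Delta>" "X \<subseteq> \<Delta>" "Y \<subseteq> \<Delta>"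
  shows "quot D X \<subseteq> quot D Y \<longleftrightarrow> X \<subseteq> Y \<union> D"
proof -
  have "quot D X \<subseteq> quot D Y \<longleftrightarrow> span (X \<union> D) \<subseteq> span (Y \<union> D)"
    unfolding quot_def by (rule quotient_space_subset_iff[OF subspace_span subspace_span span_mono]) blast
  also have "\<dots> \<longleftrightarrow> X \<union> D \<subseteq> Y \<union> D" by (rule span_simple_subset_iff) (use assms in auto)
  finally show ?thesis by blast
qed

lemma quot_plus: "quot D X + quot D Y = quot D (X \<union> Y)"
proof -
  have "span (X \<union> D) + span (Y \<union> D) = span ((X \<union> D) \<union> (Y \<union> D))"
    unfolding span_Un[of "X \<union> D" "Y \<union> D"] set_plus_def by blast
  also have "(X \<union> D) \<union> (Y \<union> D) = (X \<union> Y) \<union> D" by blast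
  finally show ?thesis unfolding quot_def quotient_space_plus[OF subspace_span] by simp
qed

text \<open>The empty family is excluded: its sum is \<open>{{0}}\<close>, whereas the zero subspace
  of the quotient is \<open>{span D}\<close>.\<close>

lemma sum_quot:
  assumes "finite T" "T \<noteq> {}" shows "(\<Sum>X\<in>T. quot D X) = quot D (\<Union>T)"
  using assms by (induction T rule: finite_ne_induct) (simp_all add: quot_plus del: set_zero)

text \<open>Index set of the quotient building set without repetitions: not lying in
  \<open>D\<close> makes the class nonzero, and saturation selects one representative of it.\<close>

definition upper :: "'a set \<Rightarrow> 'a set set" where
  "upper D = {C\<in>bs. \<not> C \<subseteq> D \<and> saturated D C}"

lemma upper_quot_subset_iff:
  assumes D: "D \<subseteq> \<Delta>" and C: "C \<in> upper D" "C' \<in> upper D"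
  shows "quot D C \<subseteq> quot D C' \<longleftrightarrow> C \<subseteq> C'"
proof -
  have bs: "C \<in> bs" "C' \<in> bs" "\<not> C \<subseteq> D" "saturated D C'" using C unfolding upper_def by auto
  have "quot D C \<subseteq> quot D C' \<longleftrightarrow> C \<subseteq> C' \<union> D"
    by (rule quot_subset_iff[OF D]) (use bs sub in auto)
  also have "\<dots> \<longleftrightarrow> C \<subseteq> C'"
  proof
    assume "C \<subseteq> C' \<union> D"
    then show "C \<subseteq> C'" using saturatedD[OF bs(4,1)] bs(3) by blast
  qed blast
  finally show ?thesis .
qed

lemma quotient_building_eq:
  assumes D: "D \<subseteq> \<Delta>"
  shows "quotient_building (fundamental \<Delta> G) (span D) = quot D ` upper D"
proof -
  have "span C + span D = span (C \<union> D)" for C :: "'a set" unfolding span_Un set_plus_def by blast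
  moreover have "{quotient_space (C + span D) (span D) | C. C \<in> span ` bs} =
      {quotient_space (span C + span D) (span D) | C. C \<in> bs}" by blast
  ultimately have "quotient_building (fundamental \<Delta> G) (span D) = {quot D C | C. C \<in> bs} - {quot D {}}"
    unfolding quotient_building_def fundamental_eq quot_def by simp
  also have "\<dots> = quot D ` upper D"
  proof (intro subset_antisym subsetI)
    fix x assume "x \<in> {quot D C | C. C \<in> bs} - {quot D {}}"
    then obtain C where C: "C \<in> bs" "x = quot D C" "quot D C \<noteq> quot D {}" by blast
    obtain C' where C': "C' \<in> bs" "C \<subseteq> C'" "C' \<subseteq> C \<union> D" "saturated D C'"
      using exists_saturated[OF C(1) D] by blast
    have "C \<union> D = C' \<union> D" using C' by blast
    then have eq: "quot D C = quot D C'" unfolding quot_def by simp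
    have "\<not> C' \<subseteq> D"
    proof
      assume "C' \<subseteq> D"
      then have "C' \<union> D = {} \<union> D" by blast
      then show False using C(3) eq unfolding quot_def by simp
    qed
    then show "x \<in> quot D ` upper D" using C(2) C' eq unfolding upper_def by blast
  next
    fix x assume "x \<in> quot D ` upper D"
    then obtain C where C: "C \<in> bs" "\<not> C \<subseteq> D" "x = quot D C" unfolding upper_def by blast
    have "quot D C \<noteq> quot D {}" using quot_subset_iff[OF D sub[OF C(1)], of "{}"] C(2) by auto
    then show "x \<in> {quot D C | C. C \<in> bs} - {quot D {}}" using C by blast
  qed
  finally show ?thesis .
qed

text \<open>The nested sets of the quotient form the link of \<open>\<B>\<close>. Elements of
  \<open>D\<close> are invisible in the quotient, and adjoining \<open>\<B>\<close> accounts for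
  them: a cover by \<open>S \<union> \<B>\<close> is a cover by \<open>S\<close> modulo
  \<open>D\<close>.\<close>

lemma nested_quotient_iff:
  assumes \<B>: "cnested \<B>" and disj: "\<And>B B'. B \<in> \<B> \<Longrightarrow> B' \<in> \<B> \<Longrightarrow> B \<noteq> B' \<Longrightarrow> B \<inter> B' = {}"
    and D: "D = \<Union>\<B>" and S: "S \<subseteq> upper D"
  shows "nested (quotient_building (fundamental \<Delta> G) (span D)) (quot D ` S) \<longleftrightarrow> cnested (S \<union> \<B>)"
proof -
  have \<B>bs: "\<B> \<subseteq> bs" using cnested_bs[OF \<B>] by blast
  have DD: "D \<subseteq> \<Delta>" unfolding D using \<B>bs sub by blast
  have Sbs: "S \<subseteq> bs" using S unfolding upper_def by blast
  have satS: "saturated D C" "\<not> C \<subseteq> D" if "C \<in> S" for C using S that unfolding upper_def by auto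
  note order = upper_quot_subset_iff[OF DD]
  have inj: "inj_on (quot D) S"
  proof (rule inj_onI)
    fix C C' assume C: "C \<in> S" "C' \<in> S" "quot D C = quot D C'"
    then have "C \<in> upper D" "C' \<in> upper D" using S by auto
    then show "C = C'" using order[of C C'] order[of C' C] C(3) by auto
  qed
  have fS: "finite S" by (rule finite_subfamily[OF Sbs])
  define AP where "AP \<longleftrightarrow> (\<forall>T\<subseteq>S. 2 \<le> card T \<and> (\<forall>A\<in>T. \<forall>B\<in>T. A \<noteq> B \<longrightarrow> \<not> A \<subseteq> B) \<longrightarrow>
     \<not> (\<exists>C\<in>upper D. C \<union> D = \<Union>T \<union> D))"
  have "nested (quotient_building (fundamental \<Delta> G) (span D)) (quot D ` S) \<longleftrightarrow> AP"
  proof -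
    have "(finite (quot D ` T) \<and> 2 \<le> card (quot D ` T) \<and>
          (\<forall>A\<in>quot D ` T. \<forall>B\<in>quot D ` T. A \<noteq> B \<longrightarrow> \<not> A \<subseteq> B) \<longrightarrow> \<Sum>(quot D ` T) \<notin> quot D ` upper D) \<longleftrightarrow>
        (2 \<le> card T \<and> (\<forall>A\<in>T. \<forall>B\<in>T. A \<noteq> B \<longrightarrow> \<not> A \<subseteq> B) \<longrightarrow>
         \<not> (\<exists>C\<in>upper D. C \<union> D = \<Union>T \<union> D))" if T: "T \<subseteq> S" for T
    proof (cases "2 \<le> card T")
      case True
      have injT: "inj_on (quot D) T" using inj T by (rule inj_on_subset)
      have fT: "finite T" using fS T by (rule finite_subset[rotated])
      have ne: "T \<noteq> {}" using True by auto
      have card: "card (quot D ` T) = card T" by (rule card_image[OF injT])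
      have anti: "(\<forall>A\<in>quot D ` T. \<forall>B\<in>quot D ` T. A \<noteq> B \<longrightarrow> \<not> A \<subseteq> B) \<longleftrightarrow> (\<forall>A\<in>T. \<forall>B\<in>T. A \<noteq> B \<longrightarrow> \<not> A \<subseteq> B)"
      proof -
        have "(quot D A \<noteq> quot D B \<longrightarrow> \<not> quot D A \<subseteq> quot D B) \<longleftrightarrow> (A \<noteq> B \<longrightarrow> \<not> A \<subseteq> B)" if "A \<in> T" "B \<in> T" for A B
          using order[of A B] inj_on_eq_iff[OF injT that] that T S by auto
        then show ?thesis by simp
      qed
      have UT: "\<Union>T \<subseteq> \<Delta>" using T Sbs sub by blast
      have "\<Sum>(quot D ` T) = quot D (\<Union>T)" using sum.reindex[OF injT, of "\<lambda>x. x"] sum_quot[OF fT ne] by simp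
      moreover have "quot D (\<Union>T) = quot D C \<longleftrightarrow> C \<union> D = \<Union>T \<union> D" if "C \<in> upper D" for C
      proof -
        have "C \<subseteq> \<Delta>" using that sub unfolding upper_def by blast
        then have "quot D (\<Union>T) \<subseteq> quot D C \<longleftrightarrow> \<Union>T \<subseteq> C \<union> D" "quot D C \<subseteq> quot D (\<Union>T) \<longleftrightarrow> C \<subseteq> \<Union>T \<union> D"
          using quot_subset_iff[OF DD UT] quot_subset_iff[OF DD _ UT] by auto
        then show ?thesis by auto
      qed
      ultimately have "\<Sum>(quot D ` T) \<in> quot D ` upper D \<longleftrightarrow> (\<exists>C\<in>upper D. C \<union> D = \<Union>T \<union> D)"
        by (simp add: image_iff)
      then show ?thesis using card anti fT by simp
    next
      case False
      have "card (quot D ` T) = card T" by (rule card_image[OF inj_on_subset[OF inj T]])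
      then show ?thesis using False by simp
    qed
    note key = this
    have fund: "quot D ` S \<subseteq> quot D ` upper D" using S by blast
    have "nested (quot D ` upper D) (quot D ` S) \<longleftrightarrow> (\<forall>T\<subseteq>S. finite (quot D ` T) \<and> 2 \<le> card (quot D ` T) \<and>
          (\<forall>A\<in>quot D ` T. \<forall>B\<in>quot D ` T. A \<noteq> B \<longrightarrow> \<not> A \<subseteq> B) \<longrightarrow> \<Sum>(quot D ` T) \<notin> quot D ` upper D)"
      unfolding nested_def using fund by (simp only: all_subset_image simp_thms)
    also have "\<dots> \<longleftrightarrow> AP" unfolding AP_def using key by simp
    finally show ?thesis unfolding quotient_building_eq[OF DD] .
  qed
  also have "AP \<longleftrightarrow> cnested (S \<union> \<B>)"
  proof
    assume AP: AP
    show "cnested (S \<union> \<B>)" unfolding cnested_def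
    proof (intro conjI allI impI ballI)
      show "S \<union> \<B> \<subseteq> bs" using Sbs \<B>bs by blast
      fix T X assume T: "T \<subseteq> S \<union> \<B>" and X: "X \<in> bs" "X \<subseteq> \<Union>T"
      show "\<exists>B\<in>T. X \<subseteq> B"
      proof (cases "X \<subseteq> D")
        case True
        \<comment> \<open>A set inside \<open>D\<close> lies in one \<open>B\<close> of
          \<open>\<B>\<close>. The member of \<open>T\<close> through one of its points either
          equals \<open>B\<close> or is saturated and absorbs the set.\<close>
        obtain B where B: "B \<in> \<B>" "X \<subseteq> B" using cnestedD[OF \<B> order_refl X(1)] True unfolding D by auto
        obtain \<gamma> where \<gamma>: "\<gamma> \<in> X" using mem_nonempty[OF X(1)] by blast
        then obtain Y where Y: "Y \<in> T" "\<gamma> \<in> Y" using X(2) by blast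
        show ?thesis
        proof (cases "Y \<in> S")
          case True
          then have "X \<subseteq> Y" using saturatedD[OF satS(1) X(1), of Y] \<open>X \<subseteq> D\<close> \<gamma> Y(2) by auto
          then show ?thesis using Y(1) by blast
        next
          case False
          then have "Y \<in> \<B>" using Y(1) T by blast
          then have "Y = B" using disj[OF _ B(1), of Y] \<gamma> Y(2) B(2) by auto
          then show ?thesis using Y(1) B(2) by blast
        qed
      next
        case False
        have fT: "finite (T \<inter> S)" using fS by blast
        have "X \<subseteq> \<Union>(T \<inter> S) \<union> D" using X(2) T unfolding D by blast
        then obtain T1 where T1: "T1 \<subseteq> T \<inter> S" "X \<subseteq> \<Union>T1 \<union> D"
          and min: "\<And>T'. T' \<subset> T1 \<Longrightarrow> \<not> X \<subseteq> \<Union>T' \<union> D"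
          using finite_minimal_subfamily[OF fT, of "\<lambda>T. X \<subseteq> \<Union>T \<union> D"] by auto
        have fT1: "finite T1" using T1(1) fT by (rule finite_subset)
        have own: "\<exists>\<gamma>. \<gamma> \<in> X \<and> \<gamma> \<notin> \<Union>(T1 - {Y}) \<union> D" if "Y \<in> T1" for Y
          using min[of "T1 - {Y}"] that by blast
        have meet: "Y \<inter> X \<noteq> {}" if "Y \<in> T1" for Y
        proof -
          obtain \<gamma> where "\<gamma> \<in> X" "\<gamma> \<notin> \<Union>(T1 - {Y}) \<union> D" using own[OF \<open>Y \<in> T1\<close>] by blast
          then show ?thesis using T1(2) \<open>Y \<in> T1\<close> by blast
        qed
        have T1S: "T1 \<subseteq> S" using T1(1) by blast
        have "T1 \<noteq> {}" using T1(2) False by auto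
        show ?thesis
        proof (cases "2 \<le> card T1")
          case True
          \<comment> \<open>Saturating this union gives an element of \<open>upper D\<close> that
            agrees with the union of the antichain \<open>T1\<close> modulo \<open>D\<close>, which
            is exactly what \<open>AP\<close> forbids.\<close>
          have "X \<union> \<Union>T1 \<in> bs" by (rule Union_mem[OF fT1 _ X(1) meet]) (use T1S Sbs in blast)
          from exists_saturated[OF this DD] obtain C where C: "C \<in> bs" "X \<union> \<Union>T1 \<subseteq> C"
            "C \<subseteq> X \<union> \<Union>T1 \<union> D" "saturated D C" by auto
          have "C \<in> upper D" unfolding upper_def using C False by auto
          moreover have "C \<union> D = \<Union>T1 \<union> D" using C(2,3) T1(2) by blast
          moreover have "\<not> A \<subseteq> B" if AB: "A \<in> T1" "B \<in> T1" "A \<noteq> B" for A B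
          proof
            assume "A \<subseteq> B"
            then have "\<Union>T1 \<union> D = \<Union>(T1 - {A}) \<union> D" using AB by blast
            then show False using min[of "T1 - {A}"] T1(2) AB(1) by auto
          qed
          ultimately show ?thesis using AP[unfolded AP_def, rule_format, of T1] True T1S by auto
        next
          case F2: False
          moreover have "card T1 \<noteq> 0" using \<open>T1 \<noteq> {}\<close> fT1 by simp
          ultimately have "card T1 = 1" by linarith
          then obtain Y where Y: "T1 = {Y}" by (rule card_1_singletonE)
          have YS: "Y \<in> S" "Y \<in> T" using T1(1) Y by auto
          have "X \<inter> Y \<noteq> {}" using meet[of Y] Y by auto
          then have "X \<subseteq> Y" using saturatedD[OF satS(1)[OF YS(1)] X(1)] T1(2) Y by auto
          then show ?thesis using YS by blast
        qed
      qed
    qed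
  next
    assume c: "cnested (S \<union> \<B>)"
    show AP unfolding AP_def
    proof (intro allI impI notI)
      fix T assume T: "T \<subseteq> S" "2 \<le> card T \<and> (\<forall>A\<in>T. \<forall>B\<in>T. A \<noteq> B \<longrightarrow> \<not> A \<subseteq> B)"
        and ex: "\<exists>C\<in>upper D. C \<union> D = \<Union>T \<union> D"
      from ex obtain C where C: "C \<in> upper D" "C \<union> D = \<Union>T \<union> D" by blast
      have "C \<in> bs" "\<not> C \<subseteq> D" using C(1) unfolding upper_def by auto
      moreover have "C \<subseteq> \<Union>(T \<union> \<B>)" using C(2) unfolding D by auto
      \<comment> \<open>This one member contains every element of \<open>T\<close> modulo
        \<open>D\<close>, hence outright by saturation, so the antichain reduces to
        \<open>{Y}\<close>.\<close>
      ultimately obtain Y where Y: "Y \<in> T \<union> \<B>" "C \<subseteq> Y" using cnestedD[OF c, of "T \<union> \<B>" C] T(1) by auto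
      have YT: "Y \<in> T" using Y \<open>\<not> C \<subseteq> D\<close> unfolding D by blast
      have "Y' = Y" if Y': "Y' \<in> T" for Y'
      proof -
        have "Y' \<subseteq> C \<union> D" using C(2) Y' by auto
        then have "Y' \<subseteq> Y \<union> D" using Y(2) by blast
        moreover have "\<not> Y' \<subseteq> D" "Y' \<in> bs" using satS(2) Y' T(1) Sbs by auto
        ultimately have "Y' \<subseteq> Y" using saturatedD[OF satS(1), of Y Y'] YT T(1) by blast
        then show ?thesis using T(2) Y' YT by blast
      qed
      then have "T = {Y}" using YT by blast
      then show False using T(2) by simp
    qed
  qed
  finally show ?thesis .
qed

lemma quotient_nested_sets_bij:
  assumes \<B>: "cnested \<B>" and disj: "\<And>B B'. B \<in> \<B> \<Longrightarrow> B' \<in> \<B> \<Longrightarrow> B \<noteq> B' \<Longrightarrow> B \<inter> B' = {}"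
    and D: "D = \<Union>\<B>" and top': "\<Delta> \<in> upper D"
  shows "bij_betw (image (quot D)) {S. S \<subseteq> upper D \<and> cnested (S \<union> \<B>) \<and> \<Delta> \<in> S}
    {S. nested (quotient_building (fundamental \<Delta> G) (span D)) S \<and> quot D \<Delta> \<in> S}"
    and "S \<subseteq> upper D \<Longrightarrow> S' \<subseteq> upper D \<Longrightarrow> S \<subseteq> S' \<longleftrightarrow> quot D ` S \<subseteq> quot D ` S'"
proof -
  have DD: "D \<subseteq> \<Delta>" unfolding D using cnested_bs[OF \<B>] sub by blast
  have inj: "inj_on (quot D) (upper D)"
  proof (rule inj_onI)
    fix C C' assume C: "C \<in> upper D" "C' \<in> upper D" "quot D C = quot D C'"
    then show "C = C'" using upper_quot_subset_iff[OF DD C(1,2)] upper_quot_subset_iff[OF DD C(2,1)] by auto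
  qed
  show ord: "S \<subseteq> S' \<longleftrightarrow> quot D ` S \<subseteq> quot D ` S'" if "S \<subseteq> upper D" "S' \<subseteq> upper D" for S S'
    using inj_on_image_subset_iff[OF inj that] by simp
  have iff: "nested (quotient_building (fundamental \<Delta> G) (span D)) (quot D ` S) \<longleftrightarrow> cnested (S \<union> \<B>)"
    if "S \<subseteq> upper D" for S
    by (rule nested_quotient_iff[OF \<B> _ D that]) (rule disj)
  show "bij_betw (image (quot D)) {S. S \<subseteq> upper D \<and> cnested (S \<union> \<B>) \<and> \<Delta> \<in> S}
    {S. nested (quotient_building (fundamental \<Delta> G) (span D)) S \<and> quot D \<Delta> \<in> S}"
  proof (rule bij_betwI')
    fix S S' assume "S \<in> {S. S \<subseteq> upper D \<and> cnested (S \<union> \<B>) \<and> \<Delta> \<in> S}" "S' \<in> {S. S \<subseteq> upper D \<and> cnested (S \<union> \<B>) \<and> \<Delta> \<in> S}"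
    then have "S \<subseteq> upper D" "S' \<subseteq> upper D" by auto
    then show "quot D ` S = quot D ` S' \<longleftrightarrow> S = S'" by (rule inj_on_image_eq_iff[OF inj])
  next
    fix S assume "S \<in> {S. S \<subseteq> upper D \<and> cnested (S \<union> \<B>) \<and> \<Delta> \<in> S}"
    then show "quot D ` S \<in> {S. nested (quotient_building (fundamental \<Delta> G) (span D)) S \<and> quot D \<Delta> \<in> S}"
      using iff[of S] by auto
  next
    fix X assume X: "X \<in> {S. nested (quotient_building (fundamental \<Delta> G) (span D)) S \<and> quot D \<Delta> \<in> S}"
    then have "X \<subseteq> quot D ` upper D" unfolding quotient_building_eq[OF DD, symmetric] nested_def by blast
    then obtain S where S: "S \<subseteq> upper D" "X = quot D ` S" by (meson subset_imageE)
    moreover have "\<Delta> \<in> S" using X S inj_on_image_mem_iff[OF inj top' S(1)] by auto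
    moreover have "cnested (S \<union> \<B>)" using X S iff[OF S(1)] by auto
    ultimately show "\<exists>S\<in>{S. S \<subseteq> upper D \<and> cnested (S \<union> \<B>) \<and> \<Delta> \<in> S}. X = quot D ` S" by blast
  qed
qed

end

section \<open>The facet as a product\<close>

lemma inner_spans_zero:
  fixes S T :: "'a::euclidean_space set"
  assumes "\<And>\<alpha> \<beta>. \<alpha> \<in> S \<Longrightarrow> \<beta> \<in> T \<Longrightarrow> \<alpha> \<bullet> \<beta> = 0" "x \<in> span S" "y \<in> span T"
  shows "x \<bullet> y = 0"
proof -
  have "\<alpha> \<bullet> y = 0" if "\<alpha> \<in> S" for \<alpha>
    using orthogonal_to_span[OF assms(3), of \<alpha>] assms(1)[OF that] unfolding orthogonal_def by blast
  then have "y \<bullet> x = 0"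
    using orthogonal_to_span[OF assms(2), of y] unfolding orthogonal_def by (simp add: inner_commute)
  then show ?thesis by (simp add: inner_commute)
qed

text \<open>\<open>B i\<close> is the set of simple roots of the i-th labelled subspace. The last
  condition makes the quotient nonzero and puts \<Delta> into \<open>upper D\<close>.\<close>

locale nested_face = nested_root_system +
  fixes B :: "'k::finite \<Rightarrow> 'a set"
  assumes B_mem: "B i \<in> bs"
    and B_disjoint: "i \<noteq> j \<Longrightarrow> B i \<inter> B j = {}"
    and B_nested: "cnested (range B)"
    and B_proper: "\<not> \<Delta> \<subseteq> \<Union>(range B)"
begin

definition D :: "'a set" where
  "D = \<Union>(range B)"

lemma B_sub: "B i \<subseteq> \<Delta>"
  using sub[OF B_mem] .

lemma range_B_disjoint: "X \<in> range B \<Longrightarrow> Y \<in> range B \<Longrightarrow> X \<noteq> Y \<Longrightarrow> X \<inter> Y = {}"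
  using B_disjoint by (metis rangeE)

lemma D_sub: "D \<subseteq> \<Delta>"
  unfolding D_def using B_sub by blast

text \<open>If the two were not orthogonal, \<open>reflect \<alpha> \<beta>\<close> would be a root
  with nonzero coefficients at both. By \<open>root_support\<close> it lies in a member spanned by a
  subset of the pair, and this can only be the whole pair.\<close>

lemma orthogonal_simple:
  assumes \<alpha>: "\<alpha> \<in> \<Delta>" and \<beta>: "\<beta> \<in> \<Delta>" and ne: "\<alpha> \<noteq> \<beta>" and nb: "{\<alpha>, \<beta>} \<notin> bs" shows "\<alpha> \<bullet> \<beta> = 0"
proof (rule ccontr)
  assume nz: "\<alpha> \<bullet> \<beta> \<noteq> 0"
  have "reflect \<alpha> \<beta> \<in> \<Phi>" using reflect_root \<alpha> \<beta> simple_sub by blast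
  moreover have "reflect \<alpha> \<beta> \<in> span {\<alpha>, \<beta>}"
    unfolding reflect_def by (intro span_diff span_scale span_base) auto
  ultimately obtain S where S: "S \<subseteq> {\<alpha>, \<beta>}" "span S \<in> G" "reflect \<alpha> \<beta> \<in> span S"
    using root_support[of "reflect \<alpha> \<beta>" "{\<alpha>, \<beta>}"] \<alpha> \<beta> by auto
  have SD: "S \<subseteq> \<Delta>" using S(1) \<alpha> \<beta> by blast
  have "coef (reflect \<alpha> \<beta>) \<beta> = 1"
    using coef_reflect[OF span_base[OF \<beta>] \<alpha> \<beta>] ne coef_simple[OF \<beta> \<beta>] by simp
  moreover have "coef (reflect \<alpha> \<beta>) \<alpha> \<noteq> 0"
  proof -
    have "coef (reflect \<alpha> \<beta>) \<alpha> = coef \<beta> \<alpha> - (2 * (\<beta> \<bullet> \<alpha>) / (\<alpha> \<bullet> \<alpha>)) * coef \<alpha> \<alpha>"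
      unfolding reflect_def using \<alpha> \<beta>
      by (subst coef_diff) (auto intro: span_scale span_base simp: coef_scale span_base)
    also have "\<dots> = - (2 * (\<beta> \<bullet> \<alpha>) / (\<alpha> \<bullet> \<alpha>))" using \<alpha> \<beta> ne by (simp add: coef_simple)
    finally show ?thesis using nz simple_nonzero[OF \<alpha>] by (simp add: inner_commute)
  qed
  ultimately have "\<beta> \<in> S" "\<alpha> \<in> S" using coef_outside[OF SD S(3)] by force+
  then have "S = {\<alpha>, \<beta>}" using S(1) by blast
  then show False using S(2) SD nb unfolding bs_def by blast
qed

lemma orthogonal_parts:
  assumes "i \<noteq> j" "\<alpha> \<in> B i" "\<beta> \<in> B j" shows "\<alpha> \<bullet> \<beta> = 0"
proof (rule orthogonal_simple)
  show "\<alpha> \<in> \<Delta>" "\<beta> \<in> \<Delta>" using assms B_sub by auto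
  show "\<alpha> \<noteq> \<beta>" using assms B_disjoint[OF assms(1)] by auto
  show "{\<alpha>, \<beta>} \<notin> bs"
  proof
    assume "{\<alpha>, \<beta>} \<in> bs"
    moreover have "{\<alpha>, \<beta>} \<subseteq> \<Union>(range B)" using assms by auto
    ultimately have "\<exists>X\<in>range B. {\<alpha>, \<beta>} \<subseteq> X" by (rule cnestedD[OF B_nested order_refl])
    then obtain k where "{\<alpha>, \<beta>} \<subseteq> B k" by blast
    then have "k = i" "k = j" using assms B_disjoint[of k i] B_disjoint[of k j] by auto
    then show False using assms(1) by simp
  qed
qed

lemma upperD:
  assumes "C \<in> upper D" shows "C \<in> bs" "C \<subseteq> \<Delta>" "\<not> C \<subseteq> D" "saturated D C"
  using assms sub unfolding upper_def by auto

lemma upper_top: "\<Delta> \<in> upper D"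
  unfolding upper_def saturated_def using top B_proper sub unfolding D_def by auto

lemma upper_cases:
  assumes "C \<in> upper D" "\<not> B i \<subseteq> C" shows "B i \<inter> C = {}"
  using saturatedD[OF upperD(4)[OF assms(1)] B_mem[of i]] assms(2) unfolding D_def by blast

lemma orthogonal_upper:
  assumes C: "C \<in> upper D" "\<not> B i \<subseteq> C" and \<alpha>: "\<alpha> \<in> B i" and \<beta>: "\<beta> \<in> C" shows "\<alpha> \<bullet> \<beta> = 0"
proof (rule orthogonal_simple)
  show "\<alpha> \<in> \<Delta>" "\<beta> \<in> \<Delta>" using \<alpha> \<beta> B_sub upperD(2)[OF C(1)] by auto
  show "\<alpha> \<noteq> \<beta>" using \<alpha> \<beta> upper_cases[OF C] by auto
  show "{\<alpha>, \<beta>} \<notin> bs"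
  proof
    assume "{\<alpha>, \<beta>} \<in> bs"
    then have "{\<alpha>, \<beta>} \<subseteq> C" using saturatedD[OF upperD(4)[OF C(1)], of "{\<alpha>, \<beta>}"] \<alpha> \<beta> unfolding D_def by auto
    then show False using \<alpha> upper_cases[OF C] by auto
  qed
qed

lemma inner_parts: "i \<noteq> j \<Longrightarrow> x \<in> span (B i) \<Longrightarrow> y \<in> span (B j) \<Longrightarrow> x \<bullet> y = 0"
  using inner_spans_zero[of "B i" "B j"] orthogonal_parts by blast

lemma inner_part_upper:
  assumes C: "C \<in> upper D" and x: "x \<in> span (B i)"
  shows "x \<bullet> hs C = (if B i \<subseteq> C then x \<bullet> hs (B i) else 0)"
proof (cases "B i \<subseteq> C")
  case True
  have "(hs C - hs (B i)) \<bullet> \<alpha> = 0" if "\<alpha> \<in> B i" for \<alpha>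
  proof -
    have "\<alpha> \<in> \<Delta>" "\<alpha> \<in> span C" "\<alpha> \<in> span (B i)" using that True B_sub by (auto intro: span_base)
    then show ?thesis 
      using half_sum_inner[OF subspace_span, of \<alpha> C] half_sum_inner[OF subspace_span, of \<alpha> "B i"]
      by (simp add: inner_diff_left)
  qed
  then have "orthogonal (hs C - hs (B i)) x"
    by (intro orthogonal_to_span[OF x]) (simp add: orthogonal_def)
  then show ?thesis using True by (simp add: orthogonal_def inner_diff_left inner_commute[of x])
next
  case False
  then show ?thesis
    using inner_spans_zero[OF orthogonal_upper[OF C False] x half_sum_in[OF subspace_span]] by simp
qed

definition perp :: "'a set" where
  "perp = {z\<in>span \<Phi>. \<forall>\<alpha>\<in>D. z \<bullet> \<alpha> = 0}"

lemma subspace_perp: "subspace perp"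
  unfolding perp_def by (rule subspaceI) (auto simp: inner_add_left span_zero intro: span_add span_scale)

lemma perp_inner: "z \<in> perp \<Longrightarrow> x \<in> span (B i) \<Longrightarrow> z \<bullet> x = 0"
  using orthogonal_to_span[of x "B i" z] unfolding perp_def D_def orthogonal_def by blast

text \<open>What remains of the chamber face after the parts in the spans of the \<open>B i\<close>
  are split off: on the face such a part contributes the constant \<open>e (B i)\<close> to each
  \<open>C\<close> containing \<open>B i\<close> and nothing to the other saturated ones.\<close>

definition base :: "('a set \<Rightarrow> real) \<Rightarrow> 'a set" where
  "base e = {z\<in>perp. z \<bullet> hs \<Delta> = e \<Delta> - (\<Sum>i\<in>UNIV. e (B i)) \<and>
     (\<forall>C\<in>upper D. e C - (\<Sum>i\<in>{i. B i \<subseteq> C}. e (B i)) \<le> z \<bullet> hs C)}"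

definition face :: "('a set \<Rightarrow> real) \<Rightarrow> 'a set" where
  "face e = {x\<in>cell e. \<forall>i. x \<bullet> hs (B i) = e (B i)}"

lemma inner_upper:
  assumes "C \<in> upper D" "\<And>i. x i \<in> span (B i)"
  shows "(z + (\<Sum>i\<in>UNIV. x i)) \<bullet> hs C = z \<bullet> hs C + (\<Sum>i\<in>{i. B i \<subseteq> C}. x i \<bullet> hs (B i))"
proof -
  have "(\<Sum>i\<in>UNIV. x i \<bullet> hs C) = (\<Sum>i\<in>UNIV. if B i \<subseteq> C then x i \<bullet> hs (B i) else 0)"
    using inner_part_upper[OF assms(1) assms(2)] by simp
  also have "\<dots> = (\<Sum>i\<in>{i. B i \<subseteq> C}. x i \<bullet> hs (B i))"
    by (rule sum.mono_neutral_cong_right) auto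
  finally show ?thesis by (simp add: inner_add_left inner_sum_left)
qed

lemma inner_lower:
  assumes z: "z \<in> perp" and x: "\<And>i. x i \<in> span (B i)" and y: "y \<in> span (B i)"
  shows "(z + (\<Sum>i\<in>UNIV. x i)) \<bullet> y = x i \<bullet> y"
proof -
  have "(\<Sum>j\<in>UNIV. x j \<bullet> y) = x i \<bullet> y + (\<Sum>j\<in>UNIV - {i}. x j \<bullet> y)" by (rule sum.remove) auto
  also have "(\<Sum>j\<in>UNIV - {i}. x j \<bullet> y) = 0"
    by (rule sum.neutral) (use inner_parts x y in auto)
  finally show ?thesis using perp_inner[OF z y] by (simp add: inner_add_left inner_sum_left)
qed

lemma hs_in: "T \<subseteq> S \<Longrightarrow> hs T \<in> span S"
  using half_sum_in[OF subspace_span, of T] span_mono by blast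

lemma mem_face_iff:
  assumes e: "admissible e" and z: "z \<in> perp" and x: "\<And>i. x i \<in> span (B i)"
  shows "z + (\<Sum>i\<in>UNIV. x i) \<in> face e \<longleftrightarrow> z \<in> base e \<and> (\<forall>i. x i \<in> subcell e (B i))"
proof -
  define y where "y = z + (\<Sum>i\<in>UNIV. x i)"
  have up: "y \<bullet> hs C = z \<bullet> hs C + (\<Sum>i\<in>{i. B i \<subseteq> C}. x i \<bullet> hs (B i))" if "C \<in> upper D" for C
    unfolding y_def by (rule inner_upper[OF that x])
  have low: "y \<bullet> hs T = x i \<bullet> hs T" if "T \<subseteq> B i" for T i
    unfolding y_def by (rule inner_lower[OF z x hs_in[OF that]])
  have all: "{i. B i \<subseteq> \<Delta>} = UNIV" using B_sub by auto
  have ysp: "y \<in> span \<Phi>"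
  proof -
    have "span (B i) \<subseteq> span \<Phi>" for i using span_mono[OF B_sub] span_simple by simp
    then have "x i \<in> span \<Phi>" for i using x by blast
    then show ?thesis unfolding y_def using z unfolding perp_def by (intro span_add span_sum) auto
  qed
  show ?thesis unfolding y_def[symmetric]
  proof
    assume y: "y \<in> face e"
    then have cell: "y \<bullet> hs \<Delta> = e \<Delta>" "\<And>S. S \<in> bs \<Longrightarrow> e S \<le> y \<bullet> hs S" and eqB: "\<And>i. y \<bullet> hs (B i) = e (B i)"
      unfolding face_def cell_def by auto
    have xB: "x i \<bullet> hs (B i) = e (B i)" for i using low[of "B i" i] eqB by simp
    have "z \<in> base e" unfolding base_def
    proof (intro CollectI conjI ballI z)
      show "z \<bullet> hs \<Delta> = e \<Delta> - (\<Sum>i\<in>UNIV. e (B i))" using up[OF upper_top] cell(1) xB all by simp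
      show "e C - (\<Sum>i\<in>{i. B i \<subseteq> C}. e (B i)) \<le> z \<bullet> hs C" if "C \<in> upper D" for C
        using up[OF that] cell(2)[OF upperD(1)[OF that]] xB by simp
    qed
    moreover have "x i \<in> subcell e (B i)" for i
      unfolding subcell_def
    proof (intro CollectI conjI ballI impI x xB)
      show "e T \<le> x i \<bullet> hs T" if "T \<in> bs" "T \<subseteq> B i" for T using low[OF that(2)] cell(2)[OF that(1)] by simp
    qed
    ultimately show "z \<in> base e \<and> (\<forall>i. x i \<in> subcell e (B i))" by blast
  next
    assume a: "z \<in> base e \<and> (\<forall>i. x i \<in> subcell e (B i))"
    have xB: "x i \<bullet> hs (B i) = e (B i)" for i using a unfolding subcell_def by blast
    have eqB: "y \<bullet> hs (B i) = e (B i)" for i using low[of "B i" i] xB by simp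
    have top': "y \<bullet> hs \<Delta> = e \<Delta>" using up[OF upper_top] a xB all unfolding base_def by simp
    have v: "val S (\<lambda>\<alpha>. y \<bullet> \<alpha>) = y \<bullet> hs S" if "S \<in> bs" for S by (rule val_inner[OF sub[OF that]])
    have "e S \<le> y \<bullet> hs S" if S: "S \<in> bs" for S
      unfolding v[OF S, symmetric]
    proof (rule feasible_of_saturated[OF e B_nested _ _ _ _ S])
      show "A \<inter> A' = {}" if "A \<in> range B" "A' \<in> range B" "A \<noteq> A'" for A A'
        by (rule range_B_disjoint[OF that])
      show "val A (\<lambda>\<alpha>. y \<bullet> \<alpha>) = e A" if "A \<in> range B" for A using that eqB v[OF B_mem] by auto
      show "e T \<le> val T (\<lambda>\<alpha>. y \<bullet> \<alpha>)" if T: "A \<in> range B" "T \<in> bs" "T \<subseteq> A" for A T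
      proof -
        obtain i where i: "A = B i" using T(1) by blast
        then have "e T \<le> x i \<bullet> hs T" using a T unfolding subcell_def by blast
        then show ?thesis using low[of T i] T(3) i v[OF T(2)] by simp
      qed
      show "e T \<le> val T (\<lambda>\<alpha>. y \<bullet> \<alpha>)" if T: "T \<in> bs" "\<not> T \<subseteq> \<Union>(range B)" "saturated (\<Union>(range B)) T" for T
      proof -
        have "T \<in> upper D" using T unfolding upper_def D_def by blast
        then show ?thesis using a up[of T] xB v[OF T(1)] unfolding base_def by force
      qed
    qed
    then show "y \<in> face e" unfolding face_def cell_def using ysp top' eqB by blast
  qed
qed

lemma decompose:
  assumes "y \<in> span \<Phi>"
  obtains z x where "z \<in> perp" "\<And>i. x i \<in> span (B i)" "y = z + (\<Sum>i\<in>UNIV. x i)"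
proof -
  have "\<exists>p. p \<in> span (B i) \<and> (\<forall>v\<in>span (B i). (y - p) \<bullet> v = 0)" for i
  proof -
    obtain p q where "p \<in> span (B i)" "\<And>v. v \<in> span (B i) \<Longrightarrow> orthogonal q v" "y = p + q"
      using orthogonal_subspace_decomp_exists[of "B i" y] by metis
    then show ?thesis unfolding orthogonal_def by (intro exI[of _ p]) simp
  qed
  then obtain x where x: "\<And>i. x i \<in> span (B i)" "\<And>i v. v \<in> span (B i) \<Longrightarrow> (y - x i) \<bullet> v = 0" by metis
  define z where "z = y - (\<Sum>i\<in>UNIV. x i)"
  have "z \<bullet> \<alpha> = 0" if "\<alpha> \<in> D" for \<alpha>
  proof -
    obtain i where "\<alpha> \<in> B i" using \<open>\<alpha> \<in> D\<close> unfolding D_def by blast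
    then have \<alpha>: "\<alpha> \<in> span (B i)" by (rule span_base)
    have "(0 + (\<Sum>i\<in>UNIV. x i)) \<bullet> \<alpha> = x i \<bullet> \<alpha>"
      by (rule inner_lower[OF subspace_0[OF subspace_perp] x(1) \<alpha>])
    then show ?thesis unfolding z_def using x(2)[OF \<alpha>] by (simp add: inner_diff_left)
  qed
  moreover have "z \<in> span \<Phi>"
  proof -
    have "span (B i) \<subseteq> span \<Phi>" for i using span_mono[OF B_sub] span_simple by simp
    then show ?thesis unfolding z_def using assms x(1) by (intro span_diff span_sum) auto
  qed
  ultimately have "z \<in> perp" unfolding perp_def by blast
  then show thesis using that[of z x] x(1) unfolding z_def by simp
qed

lemma face_decomposition:
  assumes "admissible e" shows "face e = base e + (\<Sum>i\<in>UNIV. subcell e (B i))"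
proof (intro subset_antisym subsetI)
  fix y assume y: "y \<in> face e"
  then have "y \<in> span \<Phi>" unfolding face_def cell_def by blast
  then obtain z x where zx: "z \<in> perp" "\<And>i. x i \<in> span (B i)" "y = z + (\<Sum>i\<in>UNIV. x i)"
    by (rule decompose) (rule that; assumption)
  have "z \<in> base e \<and> (\<forall>i. x i \<in> subcell e (B i))" using mem_face_iff[OF assms zx(1,2)] y zx(3) by simp
  then show "y \<in> base e + (\<Sum>i\<in>UNIV. subcell e (B i))"
    unfolding zx(3) set_sum_alt[OF finite] by (intro set_plus_intro) auto
next
  fix y assume "y \<in> base e + (\<Sum>i\<in>UNIV. subcell e (B i))"
  then obtain z x where zx: "z \<in> base e" "\<And>i. x i \<in> subcell e (B i)" "y = z + (\<Sum>i\<in>UNIV. x i)"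
    unfolding set_sum_alt[OF finite] by (auto elim!: set_plus_elim)
  have "z \<in> perp" "\<And>i. x i \<in> span (B i)" using zx unfolding base_def subcell_def by auto
  then show "y \<in> face e" using mem_face_iff[OF assms, of z x] zx by simp
qed

abbreviation part_group :: "'k \<Rightarrow> ('a \<Rightarrow> 'a) set" where
  "part_group i \<equiv> reflection_group (\<Phi> \<inter> span (B i))"

lemma part_group_props:
  assumes g: "g \<in> part_group i"
  shows "linear g" "x \<in> span (B i) \<Longrightarrow> g x \<in> span (B i)" "z \<in> perp \<Longrightarrow> g z = z"
    "j \<noteq> i \<Longrightarrow> y \<in> span (B j) \<Longrightarrow> g y = y"
proof -
  interpret s: root_basis "\<Phi> \<inter> span (B i)" "B i" by (rule root_basis_subsystem[OF B_sub])
  show "linear g" by (rule s.group_props(1)[OF g])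
  show "g x \<in> span (B i)" if "x \<in> span (B i)"
    using s.group_span[OF g] that unfolding span_subsystem[OF B_sub] by blast
  show "g z = z" if "z \<in> perp"
    by (rule s.group_props(4)[OF g]) (use perp_inner that in blast)
  show "g y = y" if "j \<noteq> i" "y \<in> span (B j)"
    by (rule s.group_props(4)[OF g]) (use inner_parts that in blast)
qed

text \<open>Stated for partial products so that the induction goes through. Each factor moves only
  its own summand, so the order of the list does not matter.\<close>

lemma foldr_acts:
  assumes g: "\<And>i. g i \<in> part_group i" and z: "z \<in> perp" and x: "\<And>i. x i \<in> span (B i)"
  shows "distinct xs \<Longrightarrow> foldr (\<lambda>i w. g i \<circ> w) xs id (z + (\<Sum>i\<in>UNIV. x i)) =
    z + (\<Sum>i\<in>UNIV. if i \<in> set xs then g i (x i) else x i)"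
proof (induction xs)
  case (Cons i xs)
  define y where "y j = (if j \<in> set xs then g j (x j) else x j)" for j
  have y: "y j \<in> span (B j)" for j unfolding y_def using part_group_props(2)[OF g x] x by simp
  note p = part_group_props[OF g[of i]]
  have "g i (z + (\<Sum>j\<in>UNIV. y j)) = g i z + (\<Sum>j\<in>UNIV. g i (y j))"
    by (simp add: linear_add[OF p(1)] linear_sum[OF p(1)])
  also have "(\<Sum>j\<in>UNIV. g i (y j)) = (\<Sum>j\<in>UNIV. if j \<in> set (i # xs) then g j (x j) else x j)"
  proof (rule sum.cong)
    fix j
    show "g i (y j) = (if j \<in> set (i # xs) then g j (x j) else x j)"
    proof (cases "j = i")
      case True
      then show ?thesis using Cons.prems unfolding y_def by simp
    next
      case False
      then show ?thesis using p(4)[OF False y] unfolding y_def by simp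
    qed
  qed simp
  finally show ?case using Cons unfolding y_def by (simp add: p(3)[OF z])
qed simp

lemma orbit_of_face:
  assumes e: "admissible e"
  shows "(\<Union>h\<in>internal_product part_group. h ` face e) =
    base e + (\<Sum>i\<in>UNIV. \<Union>g\<in>part_group i. g ` subcell e (B i))"
proof (intro subset_antisym subsetI)
  fix y assume "y \<in> (\<Union>h\<in>internal_product part_group. h ` face e)"
  then obtain g xs v where g: "\<And>i. g i \<in> part_group i" "distinct xs" "set xs = UNIV"
    and v: "v \<in> face e" "y = foldr (\<lambda>i w. g i \<circ> w) xs id v"
    unfolding internal_product_def by auto
  obtain z x where zx: "z \<in> base e" "\<And>i. x i \<in> subcell e (B i)" "v = z + (\<Sum>i\<in>UNIV. x i)"
    using v(1) unfolding face_decomposition[OF e] set_sum_alt[OF finite] by (auto elim!: set_plus_elim)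
  have m: "z \<in> perp" "\<And>i. x i \<in> span (B i)" using zx unfolding base_def subcell_def by auto
  have "y = z + (\<Sum>i\<in>UNIV. g i (x i))" unfolding v(2) zx(3) foldr_acts[OF g(1) m g(2)] g(3) by simp
  then show "y \<in> base e + (\<Sum>i\<in>UNIV. \<Union>g\<in>part_group i. g ` subcell e (B i))"
    unfolding set_sum_alt[OF finite] using zx(1,2) g(1) by (auto intro!: set_plus_intro)
next
  fix y assume "y \<in> base e + (\<Sum>i\<in>UNIV. \<Union>g\<in>part_group i. g ` subcell e (B i))"
  then obtain z u where zu: "z \<in> base e" "\<And>i. u i \<in> (\<Union>g\<in>part_group i. g ` subcell e (B i))"
    "y = z + (\<Sum>i\<in>UNIV. u i)"
    unfolding set_sum_alt[OF finite] by (auto elim!: set_plus_elim)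
  have "\<forall>i. \<exists>g x. g \<in> part_group i \<and> x \<in> subcell e (B i) \<and> u i = g x" using zu(2) by blast
  then obtain g x where g: "\<And>i. g i \<in> part_group i" and x: "\<And>i. x i \<in> subcell e (B i)" and u: "\<And>i. u i = g i (x i)"
    by metis
  have m: "z \<in> perp" "\<And>i. x i \<in> span (B i)" using zu(1) x unfolding base_def subcell_def by auto
  obtain xs :: "'k list" where xs: "set xs = UNIV" "distinct xs"
    using finite_distinct_list[of "UNIV :: 'k set"] by auto
  have "y = foldr (\<lambda>i w. g i \<circ> w) xs id (z + (\<Sum>i\<in>UNIV. x i))"
    unfolding foldr_acts[OF g m xs(2)] xs(1) zu(3) u by simp
  moreover have "foldr (\<lambda>i w. g i \<circ> w) xs id \<in> internal_product part_group"
    unfolding internal_product_def using g xs by blast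
  moreover have "z + (\<Sum>i\<in>UNIV. x i) \<in> face e" using mem_face_iff[OF e m] zu(1) x by simp
  ultimately show "y \<in> (\<Union>h\<in>internal_product part_group. h ` face e)" by blast
qed

definition level_below :: "('a set \<Rightarrow> real) \<Rightarrow> 'a set \<Rightarrow> real" where
  "level_below e C = e C - (\<Sum>i\<in>{i. B i \<subseteq> C}. e (B i))"

lemma base_polyhedron:
  "polyhedron_by {z\<in>perp. z \<bullet> hs \<Delta> = level_below e \<Delta>} (upper D) (\<lambda>C z. - (z \<bullet> hs C))"
proof (rule polyhedron_by.intro)
  show "affine {z\<in>perp. z \<bullet> hs \<Delta> = level_below e \<Delta>}"
    unfolding affine_def
    using subspace_add[OF subspace_perp] subspace_scale[OF subspace_perp]
    by (auto simp: inner_add_left distrib_right[symmetric])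
  show "finite (upper D)" unfolding upper_def using finite_bs by simp
  show "linear (\<lambda>z. - (z \<bullet> hs C))" for C by (rule linearI) (auto simp: inner_add_left)
qed

lemma base_eq:
  "base e = {z\<in>{z\<in>perp. z \<bullet> hs \<Delta> = level_below e \<Delta>}. \<forall>C\<in>upper D. - (z \<bullet> hs C) \<le> - level_below e C}"
proof -
  have "{i. B i \<subseteq> \<Delta>} = UNIV" using B_sub by auto
  then show ?thesis unfolding base_def level_below_def by auto
qed

lemma convex_base: "convex (base e)"
proof -
  interpret p: polyhedron_by "{z\<in>perp. z \<bullet> hs \<Delta> = level_below e \<Delta>}" "upper D" "\<lambda>C z. - (z \<bullet> hs C)"
    "\<lambda>C. - level_below e C" by (rule base_polyhedron)
  show ?thesis using p.convex_body unfolding p.body_def base_eq .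
qed

text \<open>The orbit is a Minkowski sum of orbits, one for each part, and convex hulls commute with
  Minkowski sums.\<close>

lemma hull_of_face:
  assumes "admissible e"
  shows "convex hull (\<Union>h\<in>internal_product part_group. h ` face e) =
    base e + (\<Sum>i\<in>UNIV. convex hull (\<Union>g\<in>part_group i. g ` subcell e (B i)))"
  unfolding orbit_of_face[OF assms] convex_hull_set_plus convex_hull_set_sum
  using convex_base by (simp add: hull_same)

text \<open>Whether \<open>C\<close> in \<open>upper D\<close> is tight at \<open>z\<close> can be
  tested at \<open>z\<close> plus any choice of points of the subcells. So tight sets on
  \<open>base e\<close> are traces of tight sets on the chamber face, where the nested sets are
  already known.\<close>

lemma base_face_poset:
  assumes e: "admissible e"
  shows "face_poset (base e) {S. S \<subseteq> upper D \<and> cnested (S \<union> range B) \<and> \<Delta> \<in> S}"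
proof -
  interpret p: polyhedron_by "{z\<in>perp. z \<bullet> hs \<Delta> = level_below e \<Delta>}" "upper D" "\<lambda>C z. - (z \<bullet> hs C)"
    "\<lambda>C. - level_below e C" by (rule base_polyhedron)
  have body: "p.body = base e" unfolding p.body_def base_eq ..
  have tight: "p.tight z = {C\<in>upper D. z \<bullet> hs C = level_below e C}" for z unfolding p.tight_def by auto
  have shift: "z \<bullet> hs C = level_below e C \<longleftrightarrow> (z + (\<Sum>i\<in>UNIV. x i)) \<bullet> hs C = e C"
    if "\<And>i. x i \<in> subcell e (B i)" "C \<in> upper D" for z x C
  proof -
    have "(z + (\<Sum>i\<in>UNIV. x i)) \<bullet> hs C = z \<bullet> hs C + (\<Sum>i\<in>{i. B i \<subseteq> C}. x i \<bullet> hs (B i))"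
      by (rule inner_upper[OF that(2)]) (use that(1) in \<open>auto simp: subcell_def\<close>)
    also have "(\<Sum>i\<in>{i. B i \<subseteq> C}. x i \<bullet> hs (B i)) = (\<Sum>i\<in>{i. B i \<subseteq> C}. e (B i))"
      by (rule sum.cong) (use that(1) in \<open>auto simp: subcell_def\<close>)
    finally show ?thesis unfolding level_below_def by auto
  qed
  have realize: "\<exists>z x. z \<in> base e \<and> (\<forall>i. x i \<in> subcell e (B i)) \<and>
      (\<forall>C\<in>bs. (z + (\<Sum>i\<in>UNIV. x i)) \<bullet> hs C = e C \<longleftrightarrow> C \<in> S \<union> range B)"
    if S: "cnested (S \<union> range B)" "\<Delta> \<in> S" for S
  proof -
    obtain y where y: "y \<in> cell e" "\<forall>A\<in>bs. y \<bullet> hs A = e A \<longleftrightarrow> A \<in> S \<union> range B"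
      using exists_cell_point[OF e S(1)] S(2) by blast
    have "y \<in> face e" unfolding face_def using y B_mem by blast
    moreover have "y \<in> span \<Phi>" using y(1) unfolding cell_def by blast
    from decompose[OF this] obtain z x where zx: "z \<in> perp" "\<And>i. x i \<in> span (B i)" "y = z + (\<Sum>i\<in>UNIV. x i)"
      by metis
    ultimately have "z \<in> base e \<and> (\<forall>i. x i \<in> subcell e (B i))" using mem_face_iff[OF e zx(1,2)] by simp
    then show ?thesis using y(2) zx(3) by blast
  qed
  have "p.tight ` base e = {S. S \<subseteq> upper D \<and> cnested (S \<union> range B) \<and> \<Delta> \<in> S}"
  proof (intro subset_antisym subsetI)
    fix S assume "S \<in> p.tight ` base e"
    then obtain z where z: "z \<in> base e" "S = p.tight z" by blast
    \<comment> \<open>Any points of the subcells will do; they come from a point realizing the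
      nested set of \<Delta> and the \<open>B i\<close>.\<close>
    obtain x where x: "\<And>i. x i \<in> subcell e (B i)"
      using realize[of "{\<Delta>}"] cnested_insert_top[OF B_nested] by auto
    define y where "y = z + (\<Sum>i\<in>UNIV. x i)"
    have "y \<in> face e" unfolding y_def
      using mem_face_iff[OF e, of z x] z(1) x unfolding base_def subcell_def by blast
    then have y: "y \<in> cell e" "\<And>i. y \<bullet> hs (B i) = e (B i)" unfolding face_def by auto
    have "cnested {C\<in>bs. y \<bullet> hs C = e C}" by (rule cnested_tight_cell[OF e y(1)])
    moreover have "S \<union> range B \<subseteq> {C\<in>bs. y \<bullet> hs C = e C}"
      unfolding z(2) tight using shift[OF x, of _ z] upperD(1) y(2) B_mem unfolding y_def by auto
    ultimately have "cnested (S \<union> range B)" by (rule cnested_subset)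
    moreover have "\<Delta> \<in> S" unfolding z(2) tight using upper_top z(1) unfolding base_eq by blast
    ultimately show "S \<in> {S. S \<subseteq> upper D \<and> cnested (S \<union> range B) \<and> \<Delta> \<in> S}"
      unfolding z(2) tight by blast
  next
    fix S assume "S \<in> {S. S \<subseteq> upper D \<and> cnested (S \<union> range B) \<and> \<Delta> \<in> S}"
    then have S: "S \<subseteq> upper D" "cnested (S \<union> range B)" "\<Delta> \<in> S" by auto
    obtain z x where zx: "z \<in> base e" "\<forall>i. x i \<in> subcell e (B i)"
      "\<forall>C\<in>bs. (z + (\<Sum>i\<in>UNIV. x i)) \<bullet> hs C = e C \<longleftrightarrow> C \<in> S \<union> range B"
      using realize[OF S(2,3)] by blast
    have "C \<notin> range B" if "C \<in> upper D" for C using upperD(3)[OF that] unfolding D_def by blast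
    then have "z \<bullet> hs C = level_below e C \<longleftrightarrow> C \<in> S" if "C \<in> upper D" for C
      using shift[of x C z] zx(2,3) upperD(1)[OF that] that by blast
    then have "p.tight z = S" unfolding tight using S(1) by blast
    then show "S \<in> p.tight ` base e" using zx(1) by blast
  qed
  then show ?thesis using p.face_poset_tight unfolding body by simp
qed

end

section \<open>Equivalence of the facet and its base with their models\<close>

context nested_face
begin

definition assemble :: "'a \<times> ('a ^ 'k) \<Rightarrow> 'a" where
  "assemble p = fst p + (\<Sum>i\<in>UNIV. snd p $ i)"

lemma linear_assemble: "linear assemble"
  unfolding assemble_def by (rule linearI) (auto simp: sum.distrib scaleR_add_right scaleR_sum_right)

lemma assemble_image:
  "assemble ` (U \<times> {y. \<forall>i. y $ i \<in> P i}) = U + (\<Sum>i\<in>UNIV. P i)"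
proof (intro subset_antisym subsetI)
  fix v assume "v \<in> assemble ` (U \<times> {y. \<forall>i. y $ i \<in> P i})"
  then show "v \<in> U + (\<Sum>i\<in>UNIV. P i)"
    unfolding assemble_def set_sum_alt[OF finite] by (auto intro!: set_plus_intro)
next
  fix v assume "v \<in> U + (\<Sum>i\<in>UNIV. P i)"
  then obtain z x where zx: "z \<in> U" "\<And>i. x i \<in> P i" "v = z + (\<Sum>i\<in>UNIV. x i)"
    unfolding set_sum_alt[OF finite] by (auto elim!: set_plus_elim)
  then have "v = assemble (z, \<chi> i. x i)" unfolding assemble_def by simp
  then show "v \<in> assemble ` (U \<times> {y. \<forall>i. y $ i \<in> P i})" using zx by (intro image_eqI) auto
qed

text \<open>The summands are pairwise orthogonal, so pairing both images with the difference of the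
  i-th components shows that this difference is orthogonal to itself.\<close>

lemma inj_assemble: "inj_on assemble (perp \<times> {y. \<forall>i. y $ i \<in> span (B i)})"
proof (rule inj_onI)
  fix p q assume p: "p \<in> perp \<times> {y. \<forall>i. y $ i \<in> span (B i)}" and q: "q \<in> perp \<times> {y. \<forall>i. y $ i \<in> span (B i)}"
    and eq: "assemble p = assemble q"
  have "snd p $ i = snd q $ i" for i
  proof -
    let ?d = "snd p $ i - snd q $ i"
    have d: "?d \<in> span (B i)" using p q by (auto intro: span_diff)
    have "assemble p \<bullet> ?d = snd p $ i \<bullet> ?d"
      unfolding assemble_def by (rule inner_lower[where x = "\<lambda>i. snd p $ i", OF _ _ d]) (use p in auto)
    moreover have "assemble q \<bullet> ?d = snd q $ i \<bullet> ?d"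
      unfolding assemble_def by (rule inner_lower[where x = "\<lambda>i. snd q $ i", OF _ _ d]) (use q in auto)
    ultimately have "?d \<bullet> ?d = 0" using eq by (simp add: inner_diff_left)
    then show ?thesis by simp
  qed
  then have "snd p = snd q" by (simp add: vec_eq_iff)
  then show "p = q" using eq unfolding assemble_def by (simp add: prod_eq_iff)
qed

lemma part_permutonestohedron:
  "permutonestohedron (\<Phi> \<inter> span (B i)) (B i) (restricted G (span (B i))) \<epsilon> =
    convex hull (\<Union>g\<in>part_group i. g ` subcell (level \<epsilon>) (B i))"
  by (rule permutonestohedron_subsystem[OF B_mem])

lemma part_permutonestohedron_span:
  "permutonestohedron (\<Phi> \<inter> span (B i)) (B i) (restricted G (span (B i))) \<epsilon> \<subseteq> span (B i)"
  unfolding part_permutonestohedron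
  by (rule hull_minimal) (auto simp: subcell_def intro: part_group_props(2) subspace_imp_convex)

lemma face_combinatorially_equivalent:
  assumes e: "admissible (level \<epsilon>)" and \<sigma>: "\<sigma> \<in> W"
  shows "combinatorially_equivalent
    (\<sigma> ` (convex hull (\<Union>h\<in>internal_product part_group. h ` face (level \<epsilon>))))
    (base (level \<epsilon>) \<times> {y :: 'a ^ 'k. \<forall>i. y $ i \<in>
      permutonestohedron (\<Phi> \<inter> span (B i)) (B i) (restricted G (span (B i))) \<epsilon>})"
proof -
  let ?P = "\<lambda>i. permutonestohedron (\<Phi> \<inter> span (B i)) (B i) (restricted G (span (B i))) \<epsilon>"
  let ?X = "base (level \<epsilon>) \<times> {y :: 'a ^ 'k. \<forall>i. y $ i \<in> ?P i}"
  have "convex hull (\<Union>h\<in>internal_product part_group. h ` face (level \<epsilon>)) = assemble ` ?X"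
    unfolding hull_of_face[OF e] part_permutonestohedron[symmetric] assemble_image ..
  then have "\<sigma> ` (convex hull (\<Union>h\<in>internal_product part_group. h ` face (level \<epsilon>))) = (\<sigma> \<circ> assemble) ` ?X"
    by (simp add: image_comp)
  moreover have "combinatorially_equivalent ((\<sigma> \<circ> assemble) ` ?X) ?X"
  proof (rule combinatorially_equivalent_linear_image)
    show "linear (\<sigma> \<circ> assemble)" by (rule linear_compose[OF linear_assemble group_props(1)[OF \<sigma>]])
    have "?X \<subseteq> perp \<times> {y. \<forall>i. y $ i \<in> span (B i)}"
      using part_permutonestohedron_span unfolding base_def by blast
    then have "inj_on assemble ?X" by (rule inj_on_subset[OF inj_assemble])
    then show "inj_on (\<sigma> \<circ> assemble) ?X"
      by (rule comp_inj_on) (rule inj_on_subset[OF group_injective[OF \<sigma>] subset_UNIV])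
    have "convex (?P i)" for i unfolding part_permutonestohedron by (rule convex_convex_hull)
    then have "convex {y :: 'a ^ 'k. \<forall>i. y $ i \<in> ?P i}" by (simp add: convex_alt)
    then show "convex ?X" by (rule convex_Times[OF convex_base])
  qed
  ultimately show ?thesis by simp
qed

lemma base_equivalent_nestohedron:
  fixes Q :: "'q::euclidean_space set"
  assumes e: "admissible e"
    and Q: "nestohedron (quotient_building (fundamental \<Delta> G) (span D)) (quotient_space (span \<Phi>) (span D)) Q"
  shows "combinatorially_equivalent (base e) Q"
proof -
  note bij = quotient_nested_sets_bij[OF B_nested range_B_disjoint D_def upper_top]
  have "quot D \<Delta> = quotient_space (span \<Phi>) (span D)"
    unfolding quot_def using D_sub span_simple by (simp add: Un_absorb2)
  then have Qp: "face_poset Q {S. nested (quotient_building (fundamental \<Delta> G) (span D)) S \<and> quot D \<Delta> \<in> S}"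
    using nestohedron_face_poset[OF Q] by simp
  have "face_poset (base e) {S. nested (quotient_building (fundamental \<Delta> G) (span D)) S \<and> quot D \<Delta> \<in> S}"
    by (rule face_poset_transfer[OF base_face_poset[OF e] bij(1)]) (use bij(2) in auto)
  from combinatorially_equivalent_of_face_poset[OF this Qp] show ?thesis .
qed

end

theorem theorem6p5:
  fixes \<Phi> \<Delta> :: "'a::euclidean_space set"
    and G :: "'a set set"
    and A :: "'k::finite \<Rightarrow> 'a set"
    and \<sigma> :: "'a \<Rightarrow> 'a"
    and \<epsilon> :: "nat \<Rightarrow> real"
    and \<eta> :: "'k \<Rightarrow> nat \<Rightarrow> real"
    and Q :: "'q::euclidean_space set"
  assumes "root_system \<Phi>" and "span \<Phi> = UNIV" and "simple_roots \<Phi> \<Delta>"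
    and "building_set_of \<Phi> G" and "invariant_under (reflection_group \<Phi>) G" and "UNIV \<in> G"
    and "suitable \<Phi> \<Delta> G \<epsilon>"
    and "\<sigma> \<in> reflection_group \<Phi>"
    and "\<And>i. A i \<in> fundamental \<Delta> G" and "\<And>i. A i \<noteq> UNIV"
    and "inj A" and "\<And>i j. \<not> A j \<subset> A i"
    and "nested (fundamental \<Delta> G) (insert UNIV (range A))"
    and "\<And>i. suitable (\<Phi> \<inter> A i) (\<Delta> \<inter> A i) (restricted G (A i)) (\<eta> i)"
    and "nestohedron (quotient_building (fundamental \<Delta> G) (\<Sum>i\<in>UNIV. A i))
           (quotient_space UNIV (\<Sum>i\<in>UNIV. A i)) Q"
  shows "combinatorially_equivalent
           (permutonestohedron_face \<Phi> \<Delta> G \<epsilon> \<sigma>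
              (internal_product (\<lambda>i. reflection_group (\<Phi> \<inter> A i))) (insert UNIV (range A)))
           (Q \<times> {y :: 'a ^ 'k. \<forall>i. y $ i \<in>
                  permutonestohedron (\<Phi> \<inter> A i) (\<Delta> \<inter> A i) (restricted G (A i)) (\<eta> i)})"
proof -
  have "span \<Phi> \<in> G" using assms(2,6) by simp
  then interpret nested_root_system \<Phi> \<Delta> G
    by (rule nested_root_system_of_building_set[OF assms(1,3,4)])
  define B where "B i = \<Delta> \<inter> A i" for i
  have A: "A i = span (B i)" and Bbs: "B i \<in> bs" for i
  proof -
    obtain S where S: "S \<subseteq> \<Delta>" "A i = span S" using assms(9)[of i] unfolding fundamental_def by blast
    then have "B i = S" unfolding B_def using span_inter_simple[OF S(1)] by (simp add: Int_commute)
    then show "A i = span (B i)" "B i \<in> bs"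
      using S assms(9)[of i] span_mem_fundamental[OF S(1)] by simp_all
  qed
  have top_span: "span \<Delta> = UNIV" using span_simple assms(2) by simp
  have rangeA: "range A = span ` range B" using A by auto
  have "nested (fundamental \<Delta> G) (span ` insert \<Delta> (range B))"
    using assms(13) unfolding rangeA by (simp add: top_span)
  moreover have "insert \<Delta> (range B) \<subseteq> bs" using Bbs top by blast
  ultimately have nest: "cnested (insert \<Delta> (range B))" using nested_iff_cnested by blast
  \<comment> \<open>The labelled subspaces are minimal in the nested set, hence pairwise
    incomparable, and incomparable members of a nested set have disjoint sets of simple
    roots.\<close>
  have disj: "B i \<inter> B j = {}" if "i \<noteq> j" for i j
  proof -
    have "A i \<noteq> A j" using assms(11) \<open>i \<noteq> j\<close> by (simp add: inj_eq)
    then have "\<not> A i \<subseteq> A j" "\<not> A j \<subseteq> A i" using assms(12)[of i j] assms(12)[of j i] by auto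
    then have "\<not> B i \<subseteq> B j" "\<not> B j \<subseteq> B i" unfolding A using span_mono by blast+
    then show ?thesis using cnested_cases[OF nest, of "B i" "B j"] by blast
  qed
  have proper: "\<not> \<Delta> \<subseteq> \<Union>(range B)"
  proof
    assume "\<Delta> \<subseteq> \<Union>(range B)"
    then obtain i where "\<Delta> \<subseteq> B i" using cnestedD[OF nest _ top, of "range B"] by blast
    then have "UNIV \<subseteq> A i" unfolding A top_span[symmetric] by (rule span_mono)
    then show False using assms(10) by blast
  qed
  interpret nested_face \<Phi> \<Delta> G B
  proof
    show "B i \<in> bs" for i by (rule Bbs)
    show "B i \<inter> B j = {}" if "i \<noteq> j" for i j by (rule disj[OF that])
    show "cnested (range B)" by (rule cnested_subset[OF nest]) blast
    show "\<not> \<Delta> \<subseteq> \<Union>(range B)" by (rule proper)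
  qed
  have spanD: "(\<Sum>i\<in>UNIV. A i) = span D"
  proof -
    have "(\<Sum>i\<in>UNIV. A i) = \<Sum>(range A)" using sum.reindex[OF assms(11), of "\<lambda>x. x"] by simp
    then show ?thesis unfolding rangeA D_def sum_spans[OF finite_imageI[OF finite]] .
  qed
  have e: "admissible (level \<epsilon>)" by (rule suitable_admissible[OF assms(7)])
  have face: "chamber_face \<Phi> \<Delta> G \<epsilon> (insert UNIV (range A)) = face (level \<epsilon>)"
    unfolding chamber_face_def chamber_nestohedron_eq face_def A top_span[symmetric]
    by (auto simp: cell_def)
  have Bi: "\<Delta> \<inter> A i = B i" for i unfolding B_def ..
  let ?P = "\<lambda>\<eta>. {y :: 'a ^ 'k. \<forall>i. y $ i \<in>
      permutonestohedron (\<Phi> \<inter> span (B i)) (B i) (restricted G (span (B i))) (\<eta> i)}"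
  have "combinatorially_equivalent
      (permutonestohedron_face \<Phi> \<Delta> G \<epsilon> \<sigma> (internal_product (\<lambda>i. reflection_group (\<Phi> \<inter> A i))) (insert UNIV (range A)))
      (base (level \<epsilon>) \<times> ?P (\<lambda>_. \<epsilon>))"
    unfolding permutonestohedron_face_def face A
    by (rule face_combinatorially_equivalent[OF e assms(8)])
  \<comment> \<open>\<open>Q\<close> and \<open>\<eta>\<close> have no geometric relation to
    \<epsilon>, so the factors are compared through labels: nested sets of the quotient for the
    first factor, \<open>tight_family\<close> for the permutonestohedra.\<close>
  moreover have "combinatorially_equivalent (base (level \<epsilon>) \<times> ?P (\<lambda>_. \<epsilon>)) (Q \<times> ?P \<eta>)"
  proof (rule combinatorially_equivalent_Times)
    show "combinatorially_equivalent (base (level \<epsilon>)) Q"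
      by (rule base_equivalent_nestohedron[OF e]) (use assms(15) spanD assms(2) in simp)
    have inst: "nested_root_system (\<Phi> \<inter> span (B i)) (B i) (restricted G (span (B i)))" for i
      by (rule subsystem[OF Bbs])
    show "combinatorially_equivalent (?P (\<lambda>_. \<epsilon>)) (?P \<eta>)"
    proof (rule combinatorially_equivalent_of_face_poset)
      show "face_poset (?P (\<lambda>_. \<epsilon>)) {Sigma UNIV X | X. \<forall>i. X i \<in>
          nested_root_system.tight_family (\<Phi> \<inter> span (B i)) (B i) (restricted G (span (B i)))}"
        by (rule permutonestohedra_product_face_poset[OF inst suitable_subsystem[OF B_sub assms(7)]])
      show "face_poset (?P \<eta>) {Sigma UNIV X | X. \<forall>i. X i \<in>
          nested_root_system.tight_family (\<Phi> \<inter> span (B i)) (B i) (restricted G (span (B i)))}"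
        by (rule permutonestohedra_product_face_poset[OF inst])
          (use assms(14) in \<open>simp only: Bi A[symmetric]\<close>)
    qed
  qed
  ultimately show ?thesis unfolding Bi unfolding A by (rule combinatorially_equivalent_trans)
qed

end
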